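(* Let $(\tilde G,\varphi)$ be a periodic graph whose quotient colored graph $(G,\gamma)$ has $n$ vertices and $m$ edges. There is a proper algebraic subset $X\subsetneq \mathbb{R}^{2n+4}$ (depending only on $(G,\gamma)$) such that for every $(\mathbf p,\mathbf L)\in \mathbb{R}^{2n+4}\setminus X$, the realization of $(\tilde G,\varphi)$ determined by $(\mathbf p,\mathbf L)$, regarded as a realization of the periodic framework whose edge lengths are the lengths it induces, is minimally rigid if and only if $(G,\gamma)$ is colored-Laman.
   Context: A periodic graph $(\tilde G,\varphi)$ is a simple infinite graph $\tilde G$ with an action $\varphi$ of $\mathbb{Z}^2$ by automorphisms that is free on vertices and edges and has finitely many vertex and edge orbits. Its quotient colored graph $(G,\gamma)$ is obtained as follows: $G=\tilde G/\mathbb{Z}^2$ (a finite directed multigraph, self-loops allowed), oriented arbitrarily; choose a representative $\tilde i$ in each vertex orbit $i$; for an edge $ij$ of $G$ take its unique lift with tail $\tilde i$; its head is $\gamma\cdot\tilde j$ for a unique $\gamma\in\mathbb{Z}^2$, and one sets the color $\gamma_{ij}=(\gamma^1_{ij},\gamma^2_{ij})=\gamma$. Colored graph notions: for a simple cycle $C$ of $G$ (a self-loop counts as a cycle) with a fixed traversal order, $\rho(C)=\sum_{ij\text{ traversed }i\to j}\gamma_{ij}-\sum_{ij\text{ traversed }j\to i}\gamma_{ij}$. The $\mathbb{Z}^2$-rank $\mathrm{rk}(G,\gamma)$ is the rank of the subgroup of $\mathbb{Z}^2$ generated by all $\rho(C)$. Subgraphs are edge-induced (their vertices are the endpoints of their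 edges), with inherited colors; a subgraph $G'$ has $n'$ vertices, $m'$ edges, $c'$ connected components. $(G,\gamma)$ is colored-Laman-sparse if every subgraph satisfies $m'\le 2n'-3+2\,\mathrm{rk}(G',\gamma)-2(c'-1)$, and colored-Laman if moreover $m=2n+1$. A periodic framework is $(\tilde G,\varphi,\tilde\ell)$ with positive lengths $\tilde\ell_{ij}$ constant on edge orbits. A realization is a map $\tilde{\mathbf p}:V(\tilde G)\to\mathbb{R}^2$ and a matrix $\mathbf L\in\mathrm{Mat}_{2\times2}(\mathbb{R})$ with $\tilde{\mathbf p}_{\gamma\cdot i}=\tilde{\mathbf p}_i+\mathbf L\gamma$ for all $\gamma\in\mathbb{Z}^2$, and $\|\tilde{\mathbf p}_j-\tilde{\mathbf p}_i\|=\tilde\ell_{ij}$ for all edges. Such realizations correspond bijectively to $(\mathbf p,\mathbf L)\in(\mathbb{R}^2)^n\times \mathrm{Mat}_{2\times 2}(\mathbb{R})=\mathbb{R}^{2n+4}$ ($\mathbf p_i$ = position of the representative of $i$) satisfying $\|\mathbf p_j+\mathbf L\gamma_{ij}-\mathbf p_i\|^2=\ell_{ij}^2$ for each edge $ij$ of $G$; the set of these is the realization space, with the topology from $\mathbb{R}^{2n+4}$. The Euclidean group acts by $\phi\cdot(\mathbf p,\mathbf L)=(\phi(\mathbf p_1),\dots,\phi(\mathbf p_n),\phi_0\mathbf L)$, $\phi_0$ the rotational part of $\phi$; the configuration space is the quotient by this action. A realization is rigid if it is an isolated point of the configuration space, flexible otherwise, and minimally rigid if it is rigid but becomes flexible when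 any one $\mathbb{Z}^2$-orbit of edges (equivalently any edge of $G$) is removed. *)

theory Defs
  imports
    "HOL-Analysis.Analysis"
    "HOL-Computational_Algebra.Group_Closure"
begin

subsection \<open>Periodic graphs\<close>

definition simple_graph :: "'a set \<Rightarrow> 'a set set \<Rightarrow> bool" where
  "simple_graph V E \<longleftrightarrow> (\<forall>e\<in>E. \<exists>u\<in>V. \<exists>v\<in>V. u \<noteq> v \<and> e = {u, v})"

definition graph_automorphism :: "'a set \<Rightarrow> 'a set set \<Rightarrow> ('a \<Rightarrow> 'a) \<Rightarrow> bool" where
  "graph_automorphism V E f \<longleftrightarrow>
     bij_betw f V V \<and> (\<forall>u\<in>V. \<forall>v\<in>V. {f u, f v} \<in> E \<longleftrightarrow> {u, v} \<in> E)"

definition vertex_orbit :: "(int^2 \<Rightarrow> 'a \<Rightarrow> 'a) \<Rightarrow> 'a \<Rightarrow> 'a set" where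
  "vertex_orbit \<phi> v = range (\<lambda>g. \<phi> g v)"

definition edge_orbit :: "(int^2 \<Rightarrow> 'a \<Rightarrow> 'a) \<Rightarrow> 'a set \<Rightarrow> 'a set set" where
  "edge_orbit \<phi> e = range (\<lambda>g. \<phi> g ` e)"

definition periodic_graph :: "'a set \<Rightarrow> 'a set set \<Rightarrow> (int^2 \<Rightarrow> 'a \<Rightarrow> 'a) \<Rightarrow> bool" where
  "periodic_graph V E \<phi> \<longleftrightarrow>
     infinite V \<and> simple_graph V E \<and>
     (\<forall>g. graph_automorphism V E (\<phi> g)) \<and>
     (\<forall>v\<in>V. \<phi> 0 v = v) \<and>
     (\<forall>g h. \<forall>v\<in>V. \<phi> (g + h) v = \<phi> g (\<phi> h v)) \<and>
     (\<forall>g. \<forall>v\<in>V. \<phi> g v = v \<longrightarrow> g = 0) \<and>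
     (\<forall>g. \<forall>e\<in>E. \<phi> g ` e = e \<longrightarrow> g = 0) \<and>
     finite (vertex_orbit \<phi> ` V) \<and>
     finite (edge_orbit \<phi> ` E)"


subsection \<open>Colored graphs\<close>

text \<open>The vertex set is the whole finite type \<open>'v\<close>, so that \<open>n = CARD('v)\<close>; the
  edges are named by elements of \<open>'e\<close>, so that loops and parallel edges are possible.\<close>

record ('v, 'e) colored_graph =
  edges :: "'e set"
  tail  :: "'e \<Rightarrow> 'v"
  head  :: "'e \<Rightarrow> 'v"
  color :: "'e \<Rightarrow> int^2"

text \<open>The lift of \<open>e\<close> whose tail is the representative \<open>rep i\<close> of \<open>i = tail G e\<close>.\<close>

definition lifted_edge ::
  "(int^2 \<Rightarrow> 'a \<Rightarrow> 'a) \<Rightarrow> ('v \<Rightarrow> 'a) \<Rightarrow> ('v, 'e) colored_graph \<Rightarrow> 'e \<Rightarrow> 'a set" where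
  "lifted_edge \<phi> rep G e = {rep (tail G e), \<phi> (color G e) (rep (head G e))}"

text \<open>\<open>G\<close> is the quotient colored graph of \<open>(V, E, \<phi>)\<close> for the representatives \<open>rep\<close> and
  some orientation. Vertices and edges of \<open>G\<close> are identified with the vertex and edge
  orbits through the two bijections.\<close>

definition quotient_colored_graph ::
  "'a set \<Rightarrow> 'a set set \<Rightarrow> (int^2 \<Rightarrow> 'a \<Rightarrow> 'a) \<Rightarrow> ('v \<Rightarrow> 'a) \<Rightarrow> ('v, 'e) colored_graph \<Rightarrow> bool" where
  "quotient_colored_graph V E \<phi> rep G \<longleftrightarrow>
     range rep \<subseteq> V \<and>
     bij_betw (\<lambda>i. vertex_orbit \<phi> (rep i)) UNIV (vertex_orbit \<phi> ` V) \<and>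
     lifted_edge \<phi> rep G ` edges G \<subseteq> E \<and>
     bij_betw (\<lambda>e. edge_orbit \<phi> (lifted_edge \<phi> rep G e)) (edges G) (edge_orbit \<phi> ` E)"

text \<open>A dart \<open>(e, d)\<close> is the edge \<open>e\<close> traversed from tail to head if \<open>d\<close> holds, and from
  head to tail otherwise.\<close>

fun dart_start :: "('v, 'e) colored_graph \<Rightarrow> 'e \<times> bool \<Rightarrow> 'v" where
  "dart_start G (e, d) = (if d then tail G e else head G e)"

fun dart_end :: "('v, 'e) colored_graph \<Rightarrow> 'e \<times> bool \<Rightarrow> 'v" where
  "dart_end G (e, d) = (if d then head G e else tail G e)"

text \<open>Distinctness of the edges excludes walking back and forth along one edge; self-loops
  are cycles of length 1 and pairs of parallel edges give cycles of length 2.\<close>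

definition simple_cycle :: "('v, 'e) colored_graph \<Rightarrow> 'e set \<Rightarrow> ('e \<times> bool) list \<Rightarrow> bool" where
  "simple_cycle G F c \<longleftrightarrow>
     c \<noteq> [] \<and> fst ` set c \<subseteq> F \<and>
     distinct (map fst c) \<and> distinct (map (dart_start G) c) \<and>
     (\<forall>k<length c. dart_end G (c ! k) = dart_start G (c ! (Suc k mod length c)))"

definition cycle_rho :: "('v, 'e) colored_graph \<Rightarrow> ('e \<times> bool) list \<Rightarrow> int^2" where
  "cycle_rho G c = (\<Sum>(e, d)\<leftarrow>c. if d then color G e else - color G e)"

interpretation int_vec: module "(*s) :: int \<Rightarrow> int^'k \<Rightarrow> int^'k"
  by unfold_locales (simp_all add: vec_eq_iff algebra_simps)

text \<open>The rank of a subgroup of \<open>\<int>\<^sup>2\<close>: the largest number of \<open>\<int>\<close>-linearly independent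
  elements.\<close>

definition subgroup_rank :: "(int^2) set \<Rightarrow> nat" where
  "subgroup_rank A = Max {card B | B. B \<subseteq> A \<and> finite B \<and> int_vec.independent B}"

text \<open>Subgraphs are edge-induced and hence given by their edge sets \<open>F \<subseteq> edges G\<close>.\<close>

definition sub_rank :: "('v, 'e) colored_graph \<Rightarrow> 'e set \<Rightarrow> nat" where
  "sub_rank G F = subgroup_rank (group_closure (cycle_rho G ` {c. simple_cycle G F c}))"

definition sub_vertices :: "('v, 'e) colored_graph \<Rightarrow> 'e set \<Rightarrow> 'v set" where
  "sub_vertices G F = tail G ` F \<union> head G ` F"

definition sub_adj :: "('v, 'e) colored_graph \<Rightarrow> 'e set \<Rightarrow> ('v \<times> 'v) set" where
  "sub_adj G F = (\<lambda>e. (tail G e, head G e)) ` F \<union> (\<lambda>e. (head G e, tail G e)) ` F"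

definition sub_components :: "('v, 'e) colored_graph \<Rightarrow> 'e set \<Rightarrow> 'v set set" where
  "sub_components G F = sub_vertices G F // (sub_adj G F)\<^sup>*"

text \<open>Subgraphs are non-empty: the sparsity inequality is false for the empty one.\<close>

definition colored_laman_sparse :: "('v, 'e) colored_graph \<Rightarrow> bool" where
  "colored_laman_sparse G \<longleftrightarrow>
     (\<forall>F\<subseteq>edges G. F \<noteq> {} \<longrightarrow>
        int (card F) \<le> 2 * int (card (sub_vertices G F)) - 3 + 2 * int (sub_rank G F)
                        - 2 * (int (card (sub_components G F)) - 1))"

definition colored_laman :: "('v::finite, 'e) colored_graph \<Rightarrow> bool" where
  "colored_laman G \<longleftrightarrow> colored_laman_sparse G \<and> card (edges G) = 2 * CARD('v) + 1"


subsection \<open>Periodic frameworks and their realizations\<close>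

definition periodic_framework ::
  "'a set \<Rightarrow> 'a set set \<Rightarrow> (int^2 \<Rightarrow> 'a \<Rightarrow> 'a) \<Rightarrow> ('a set \<Rightarrow> real) \<Rightarrow> bool" where
  "periodic_framework V E \<phi> len \<longleftrightarrow>
     periodic_graph V E \<phi> \<and>
     (\<forall>e\<in>E. len e > 0) \<and> (\<forall>g. \<forall>e\<in>E. len (\<phi> g ` e) = len e)"

definition real_vec :: "int^2 \<Rightarrow> real^2" where
  "real_vec g = (\<chi> k. real_of_int (g $ k))"

definition realization ::
  "'a set \<Rightarrow> 'a set set \<Rightarrow> (int^2 \<Rightarrow> 'a \<Rightarrow> 'a) \<Rightarrow> ('a set \<Rightarrow> real) \<Rightarrow> ('a \<Rightarrow> real^2) \<Rightarrow> real^2^2 \<Rightarrow> bool"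
  where
  "realization V E \<phi> len q L \<longleftrightarrow>
     (\<forall>g. \<forall>v\<in>V. q (\<phi> g v) = q v + L *v real_vec g) \<and>
     (\<forall>u v. {u, v} \<in> E \<longrightarrow> norm (q v - q u) = len {u, v})"

text \<open>The space \<open>\<real>\<^bsup>2n+4\<^esup>\<close> of pairs \<open>(p, L)\<close>.\<close>

type_synonym 'v coords = "((real^2)^'v) \<times> (real^2^2)"

text \<open>The placement of the periodic graph determined by \<open>(p, L)\<close>: the vertex \<open>\<phi> g (rep i)\<close>
  is placed at \<open>p\<^sub>i + L g\<close>.\<close>

definition lifted_placement ::
  "(int^2 \<Rightarrow> 'a \<Rightarrow> 'a) \<Rightarrow> ('v::finite \<Rightarrow> 'a) \<Rightarrow> 'v coords \<Rightarrow> 'a \<Rightarrow> real^2" where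
  "lifted_placement \<phi> rep x v =
     (let (i, g) = (THE (i, g). v = \<phi> g (rep i)) in fst x $ i + snd x *v real_vec g)"

definition induced_length ::
  "(int^2 \<Rightarrow> 'a \<Rightarrow> 'a) \<Rightarrow> ('v::finite \<Rightarrow> 'a) \<Rightarrow> 'v coords \<Rightarrow> 'a set \<Rightarrow> real" where
  "induced_length \<phi> rep x e =
     (THE r. \<exists>u v. e = {u, v} \<and>
        r = norm (lifted_placement \<phi> rep x v - lifted_placement \<phi> rep x u))"

definition realization_space ::
  "'a set \<Rightarrow> 'a set set \<Rightarrow> (int^2 \<Rightarrow> 'a \<Rightarrow> 'a) \<Rightarrow> ('a set \<Rightarrow> real) \<Rightarrow> ('v::finite \<Rightarrow> 'a) \<Rightarrow> 'v coords set"
  where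
  "realization_space V E \<phi> len rep = {x. realization V E \<phi> len (lifted_placement \<phi> rep x) (snd x)}"


subsection \<open>Configuration space and rigidity\<close>

text \<open>The action of the isometry \<open>z \<mapsto> Q z + t\<close> with linear part \<open>Q \<in> O(2)\<close>.\<close>

definition euclidean_act :: "real^2^2 \<Rightarrow> real^2 \<Rightarrow> 'v::finite coords \<Rightarrow> 'v coords" where
  "euclidean_act Q t x = ((\<chi> i. Q *v (fst x $ i) + t), Q ** snd x)"

definition congruence_class :: "'v::finite coords \<Rightarrow> 'v coords set" where
  "congruence_class x = {euclidean_act Q t x | Q t. orthogonal_matrix Q}"

definition quotient_topology :: "'b topology \<Rightarrow> ('b \<Rightarrow> 'c) \<Rightarrow> 'c topology" where
  "quotient_topology T f =
     topology (\<lambda>U. U \<subseteq> f ` topspace T \<and> openin T {x \<in> topspace T. f x \<in> U})"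

lemma openin_quotient_topology:
  "openin (quotient_topology T f) U \<longleftrightarrow>
     U \<subseteq> f ` topspace T \<and> openin T {x \<in> topspace T. f x \<in> U}"
proof -
  have "istopology (\<lambda>U. U \<subseteq> f ` topspace T \<and> openin T {x \<in> topspace T. f x \<in> U})"
    unfolding istopology_def
  proof (intro conjI allI impI)
    fix S U
    assume "S \<subseteq> f ` topspace T \<and> openin T {x \<in> topspace T. f x \<in> S}"
      and "U \<subseteq> f ` topspace T \<and> openin T {x \<in> topspace T. f x \<in> U}"
    moreover have "{x \<in> topspace T. f x \<in> S \<inter> U} =
        {x \<in> topspace T. f x \<in> S} \<inter> {x \<in> topspace T. f x \<in> U}" by auto
    ultimately show "S \<inter> U \<subseteq> f ` topspace T"
      "openin T {x \<in> topspace T. f x \<in> S \<inter> U}" by auto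
  next
    fix K
    assume *: "\<forall>U\<in>K. U \<subseteq> f ` topspace T \<and> openin T {x \<in> topspace T. f x \<in> U}"
    then show "\<Union>K \<subseteq> f ` topspace T" by blast
    have "{x \<in> topspace T. f x \<in> \<Union>K} = (\<Union>U\<in>K. {x \<in> topspace T. f x \<in> U})" by auto
    with * show "openin T {x \<in> topspace T. f x \<in> \<Union>K}" by auto
  qed
  then show ?thesis
    unfolding quotient_topology_def by (simp add: topology_inverse')
qed

lemma topspace_quotient_topology: "topspace (quotient_topology T f) = f ` topspace T"
proof
  show "topspace (quotient_topology T f) \<subseteq> f ` topspace T"
    by (metis openin_quotient_topology openin_topspace)
  have "{x \<in> topspace T. f x \<in> f ` topspace T} = topspace T" by auto
  then show "f ` topspace T \<subseteq> topspace (quotient_topology T f)"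
    by (intro openin_subset) (simp add: openin_quotient_topology)
qed

lemma quotient_map_quotient_topology: "quotient_map T (quotient_topology T f) f"
  unfolding quotient_map_def topspace_quotient_topology
  by (auto simp: openin_quotient_topology)

definition configuration_space ::
  "'a set \<Rightarrow> 'a set set \<Rightarrow> (int^2 \<Rightarrow> 'a \<Rightarrow> 'a) \<Rightarrow> ('a set \<Rightarrow> real) \<Rightarrow> ('v::finite \<Rightarrow> 'a) \<Rightarrow>
     'v coords set topology" where
  "configuration_space V E \<phi> len rep =
     quotient_topology (top_of_set (realization_space V E \<phi> len rep)) congruence_class"

definition rigid ::
  "'a set \<Rightarrow> 'a set set \<Rightarrow> (int^2 \<Rightarrow> 'a \<Rightarrow> 'a) \<Rightarrow> ('a set \<Rightarrow> real) \<Rightarrow> ('v::finite \<Rightarrow> 'a) \<Rightarrow> 'v coords \<Rightarrow> bool"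
  where
  "rigid V E \<phi> len rep x \<longleftrightarrow>
     x \<in> realization_space V E \<phi> len rep \<and>
     openin (configuration_space V E \<phi> len rep) {congruence_class x}"

definition minimally_rigid ::
  "'a set \<Rightarrow> 'a set set \<Rightarrow> (int^2 \<Rightarrow> 'a \<Rightarrow> 'a) \<Rightarrow> ('a set \<Rightarrow> real) \<Rightarrow> ('v::finite \<Rightarrow> 'a) \<Rightarrow> 'v coords \<Rightarrow> bool"
  where
  "minimally_rigid V E \<phi> len rep x \<longleftrightarrow>
     rigid V E \<phi> len rep x \<and> (\<forall>e\<in>E. \<not> rigid V (E - edge_orbit \<phi> e) \<phi> len rep x)"


subsection \<open>Algebraic sets\<close>

definition algebraic_set :: "'b::euclidean_space set \<Rightarrow> bool" where
  "algebraic_set X \<longleftrightarrow>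
     (\<exists>P. (\<forall>f\<in>P. real_polynomial_function f) \<and> X = {x. \<forall>f\<in>P. f x = 0})"

end

theory Submission
  imports Defs
begin

text \<open>Attach to an edge \<open>e = ij\<close> of color \<open>\<gamma>\<close> the vector \<open>a\<^sub>e = (e\<^sub>j - e\<^sub>i, \<gamma>)\<close> of \<open>\<real>\<^bsup>n+2\<^esup>\<close>. The
  vectors of a subgraph span a space of dimension \<open>r = n' - c' + rk\<close>, because circulations are
  combinations of cycles; so the sparsity condition reads \<open>m' \<le> 2r - 1\<close>. A point \<open>x = (p, L)\<close> is a linear map
  from \<open>\<real>\<^bsup>n+2\<^esup>\<close> to the plane, and the row of the rigidity matrix for \<open>e\<close> is \<open>x a\<^sub>e \<otimes> a\<^sub>e\<close>.

  Independent rows satisfy the count since they all annihilate the infinitesimal rotation at \<open>x\<close>.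
  Conversely, by matroid union the count makes the vectors \<open>d\<^sub>e \<otimes> a\<^sub>e\<close> independent for generic
  directions \<open>d\<^sub>e\<close>, even after doubling any one edge; hence some \<open>x\<close> has every \<open>x a\<^sub>e\<close> a nonzero
  multiple of \<open>d\<^sub>e\<close>, and its rows are independent.

  At a generic point the rank of the rows of each edge set is locally constant, and rigidity is
  equivalent to rank \<open>2n + 1\<close>: full rank gives rigidity by a quadratic estimate transversally to
  the congruences, and a rank deficit gives a flex by the inverse function theorem.\<close>

subsection \<open>Linearly independent families\<close>

text \<open>Prescribed directions alone do not suffice: a placement whose edges are parallel to them
  may collapse an edge to a point, and a collapsed edge has row \<open>0\<close>. The
  \<open>1\<close> missing from twice the rank is the room for a second copy of a single edge
  \<open>e\<close>; giving this copy another direction makes the two constraints on \<open>e\<close>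
  independent, and this yields a placement in which \<open>e\<close> does not collapse. There is
  room for one copy only, so each edge gets its own placement, and a generic linear combination of
  these collapses no edge.

  The rank at \<open>x\<close> alone does not decide flexibility, since a rank deficit at a singular
  point need not integrate to a motion. The exceptional set is therefore cut out by one polynomial
  for each edge set whose rows are independent somewhere, together with \<open>det L\<close>; all of
  these depend on \<open>G\<close> alone. Its complement is open, which provides the neighbourhood
  of constant rank. Invertibility of \<open>L\<close> ensures three independent trivial motions and
  keeps reflected copies of \<open>x\<close> away from \<open>x\<close>.\<close>

definition indep_family :: "'i set \<Rightarrow> ('i \<Rightarrow> 'b::real_vector) \<Rightarrow> bool" where
  "indep_family I v \<longleftrightarrow> finite I \<and> (\<forall>c. (\<Sum>i\<in>I. c i *\<^sub>R v i) = 0 \<longrightarrow> (\<forall>i\<in>I. c i = 0))"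

lemma indep_familyI:
  assumes "finite I" "\<And>c i. (\<Sum>i\<in>I. c i *\<^sub>R v i) = 0 \<Longrightarrow> i \<in> I \<Longrightarrow> c i = 0"
  shows "indep_family I v"
  using assms by (auto simp: indep_family_def)

lemma indep_familyD:
  "indep_family I v \<Longrightarrow> (\<Sum>i\<in>I. c i *\<^sub>R v i) = 0 \<Longrightarrow> i \<in> I \<Longrightarrow> c i = 0"
  by (auto simp: indep_family_def)

lemma indep_family_finite: "indep_family I v \<Longrightarrow> finite I"
  by (simp add: indep_family_def)

lemma indep_family_empty [simp]: "indep_family {} v"
  by (simp add: indep_family_def)

lemma indep_family_subset:
  assumes "indep_family I v" "J \<subseteq> I"
  shows "indep_family J v"
proof (rule indep_familyI)
  show "finite J" using assms indep_family_finite finite_subset by blast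
  fix c j assume c: "(\<Sum>i\<in>J. c i *\<^sub>R v i) = 0" and j: "j \<in> J"
  have "(\<Sum>i\<in>I. (if i \<in> J then c i else 0) *\<^sub>R v i) = (\<Sum>i\<in>J. c i *\<^sub>R v i)"
    using assms by (intro sum.mono_neutral_cong_right) (auto simp: indep_family_def)
  with c indep_familyD[OF assms(1), of "\<lambda>i. if i \<in> J then c i else 0" j] j assms(2)
  show "c j = 0" by auto
qed

lemma indep_family_cong:
  assumes "\<And>i. i \<in> I \<Longrightarrow> v i = w i"
  shows "indep_family I v \<longleftrightarrow> indep_family I w"
  using assms by (simp add: indep_family_def cong: sum.cong)

lemma indep_family_scale:
  assumes "indep_family I v" and "\<And>i. i \<in> I \<Longrightarrow> k i \<noteq> 0"
  shows "indep_family I (\<lambda>i. k i *\<^sub>R v i)"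
proof (rule indep_familyI)
  show "finite I" using assms(1) by (rule indep_family_finite)
  fix c i assume "(\<Sum>i\<in>I. c i *\<^sub>R k i *\<^sub>R v i) = 0" "i \<in> I"
  then show "c i = 0"
    using indep_familyD[OF assms(1), of "\<lambda>i. c i * k i" i] assms(2) by simp
qed

lemma indep_family_insert:
  assumes "indep_family I v" "v i \<notin> span (v ` I)"
  shows "indep_family (insert i I) v"
proof (rule indep_familyI)
  have i: "i \<notin> I" using assms(2) by (auto intro: span_base)
  have fin: "finite I" using assms(1) by (rule indep_family_finite)
  then show "finite (insert i I)" by simp
  fix c j assume c: "(\<Sum>i\<in>insert i I. c i *\<^sub>R v i) = 0" and j: "j \<in> insert i I"
  have eq: "c i *\<^sub>R v i + (\<Sum>i\<in>I. c i *\<^sub>R v i) = 0" using c fin i by simp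
  have mem: "(\<Sum>i\<in>I. c i *\<^sub>R v i) \<in> span (v ` I)"
    by (intro span_sum span_scale span_base) auto
  have ci: "c i = 0"
  proof (rule ccontr)
    assume "c i \<noteq> 0"
    have "c i *\<^sub>R v i \<in> span (v ` I)"
      using mem eq by (metis add_eq_0_iff2 span_neg)
    then have "(1 / c i) *\<^sub>R c i *\<^sub>R v i \<in> span (v ` I)" by (rule span_scale)
    with \<open>c i \<noteq> 0\<close> assms(2) show False by simp
  qed
  with eq have "(\<Sum>i\<in>I. c i *\<^sub>R v i) = 0" by simp
  with ci j indep_familyD[OF assms(1)] show "c j = 0" by blast
qed

lemma indep_family_not_in_span:
  assumes "indep_family (insert i I) v" "i \<notin> I"
  shows "v i \<notin> span (v ` I)"
proof
  have fin: "finite I" using indep_family_finite[OF assms(1)] by simp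
  assume "v i \<in> span (v ` I)"
  then obtain c where c: "v i = (\<Sum>x\<in>v ` I. c x *\<^sub>R x)"
    using span_finite[of "v ` I"] fin by auto
  have inj: "inj_on v I"
  proof (rule inj_onI, rule ccontr)
    fix a b assume ab: "a \<in> I" "b \<in> I" "v a = v b" "a \<noteq> b"
    have "(\<Sum>i\<in>I. (if i = a then 1 else if i = b then -1 else 0) *\<^sub>R v i)
        = (\<Sum>i\<in>{a,b}. (if i = a then 1 else if i = b then -1 else 0) *\<^sub>R v i)"
      using ab fin by (intro sum.mono_neutral_right) auto
    also have "\<dots> = 0" using ab by simp
    finally show False
      using indep_familyD[OF indep_family_subset[OF assms(1)], of I _ a] ab by fastforce
  qed
  have "v i = (\<Sum>j\<in>I. c (v j) *\<^sub>R v j)" using c inj by (simp add: sum.reindex)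
  moreover have "(\<Sum>j\<in>I. (if j = i then -1 else c (v j)) *\<^sub>R v j) = (\<Sum>j\<in>I. c (v j) *\<^sub>R v j)"
    using assms(2) by (intro sum.cong) auto
  ultimately have "(\<Sum>j\<in>insert i I. (if j = i then -1 else c (v j)) *\<^sub>R v j) = 0"
    using fin assms(2) by simp
  then show False using indep_familyD[OF assms(1), of _ i] by fastforce
qed

text \<open>Repeated vectors make a family dependent. This is the reason for families instead of
  sets: distinct edges may carry equal vectors and still have to be counted separately.\<close>

lemma indep_family_inj:
  assumes "indep_family I v" shows "inj_on v I"
proof (rule inj_onI, rule ccontr)
  fix a b assume ab: "a \<in> I" "b \<in> I" "v a = v b" "a \<noteq> b"
  then have "v a \<notin> span (v ` (I - {a}))"
    using indep_family_not_in_span[of a "I - {a}" v] assms by (simp add: insert_absorb)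
  moreover have "v a \<in> v ` (I - {a})" using ab by (metis DiffI imageI singletonD)
  ultimately show False by (auto intro: span_base)
qed

lemma indep_family_independent:
  assumes "indep_family I v" shows "independent (v ` I)"
proof (rule independent_if_scalars_zero)
  show "finite (v ` I)" using assms indep_family_finite by blast
  fix f x assume "(\<Sum>x\<in>v ` I. f x *\<^sub>R x) = 0" "x \<in> v ` I"
  then show "f x = 0"
    using indep_familyD[OF assms, of "\<lambda>i. f (v i)"] indep_family_inj[OF assms]
    by (auto simp: sum.reindex)
qed

lemma indep_family_dim:
  fixes v :: "'i \<Rightarrow> 'b::euclidean_space"
  assumes "indep_family I v" shows "dim (v ` I) = card I"
  using indep_family_independent[OF assms] indep_family_inj[OF assms]
  by (simp add: dim_eq_card_independent card_image)

lemma indep_family_if_dim: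
  fixes v :: "'i \<Rightarrow> 'b::euclidean_space"
  assumes "finite I" "dim (v ` I) = card I" shows "indep_family I v"
proof (rule indep_familyI)
  show "finite I" by fact
  have "dim (v ` I) \<le> card (v ` I)" "card (v ` I) \<le> card I"
    using assms(1) by (auto intro: dim_le_card' card_image_le)
  then have c: "card (v ` I) = card I" "card (v ` I) \<le> dim (v ` I)" using assms by auto
  have inj: "inj_on v I" using c assms(1) by (intro eq_card_imp_inj_on) auto
  have ind: "independent (v ` I)"
    using c(2) by (intro card_le_dim_spanning[of _ "v ` I"]) (auto simp: assms(1) span_base)
  fix c i assume "(\<Sum>i\<in>I. c i *\<^sub>R v i) = 0" and i: "i \<in> I"
  then have "(\<Sum>x\<in>v ` I. c (the_inv_into I v x) *\<^sub>R x) = 0"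
    using inj by (simp add: sum.reindex the_inv_into_f_f cong: sum.cong)
  then have "\<forall>x\<in>v ` I. c (the_inv_into I v x) = 0"
    using ind assms(1) by (auto simp: independent_explicit)
  then show "c i = 0" using i inj by (simp add: the_inv_into_f_f)
qed

text \<open>\<open>y\<close> is the component of \<open>v i\<close> orthogonal to the other vectors.
  Keeping it in the span of the family makes it orthogonal to everything the family annihilates, in
  particular to the trivial motions later.\<close>

lemma indep_family_dual:
  fixes v :: "'i \<Rightarrow> 'b::euclidean_space"
  assumes "indep_family (insert i I) v" "i \<notin> I"
  obtains y where "y \<in> span (v ` insert i I)" "\<And>j. j \<in> I \<Longrightarrow> y \<bullet> v j = 0" "y \<bullet> v i \<noteq> 0"
proof -
  obtain y z where y: "y \<in> span (v ` I)" and z: "\<And>w. w \<in> span (v ` I) \<Longrightarrow> orthogonal z w"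
    and eq: "v i = y + z"
    using orthogonal_subspace_decomp_exists[of "v ` I" "v i"] by metis
  have "z \<noteq> 0" using indep_family_not_in_span[OF assms] y eq by auto
  moreover have "z \<bullet> y = 0" using z[OF y] by (simp add: orthogonal_def)
  ultimately have "z \<bullet> v i \<noteq> 0" by (simp add: eq inner_add_right)
  moreover have "z \<bullet> v j = 0" if "j \<in> I" for j
    using z[of "v j"] that by (simp add: orthogonal_def span_base)
  moreover have "z \<in> span (v ` insert i I)"
  proof -
    have "v i \<in> span (v ` insert i I)" by (simp add: span_base)
    moreover have "y \<in> span (v ` insert i I)" using y span_mono[of "v ` I" "v ` insert i I"] by blast
    ultimately have "v i - y \<in> span (v ` insert i I)" by (rule span_diff)
    then show ?thesis by (simp add: eq)
  qed
  ultimately show thesis using that by blast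
qed

lemma maximal_indep_family:
  assumes "finite F"
  obtains I where "I \<subseteq> F" "indep_family I v" "\<And>f. f \<in> F \<Longrightarrow> v f \<in> span (v ` I)"
proof -
  let ?A = "{I. I \<subseteq> F \<and> indep_family I v}"
  have "finite ?A" "?A \<noteq> {}" using assms by (auto intro: exI[of _ "{}"])
  from finite_has_maximal[OF this] obtain I
    where "I \<in> ?A" and mx: "\<forall>J\<in>?A. I \<subseteq> J \<longrightarrow> I = J" ..
  then have I: "I \<subseteq> F" "indep_family I v" by auto
  have "v f \<in> span (v ` I)" if "f \<in> F" for f
  proof (rule ccontr)
    assume n: "v f \<notin> span (v ` I)"
    then have "indep_family (insert f I) v" using I(2) by (intro indep_family_insert)
    then have "I = insert f I" using bspec[OF mx, of "insert f I"] I that by auto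
    then have "v f \<in> v ` I" by blast
    with n show False by (auto intro: span_base)
  qed
  with I show thesis by (rule that)
qed

lemma span_image_finite:
  assumes "finite I"
  shows "z \<in> span (v ` I) \<longleftrightarrow> (\<exists>c. z = (\<Sum>i\<in>I. c i *\<^sub>R v i))"
proof
  assume "z \<in> span (v ` I)"
  then show "\<exists>c. z = (\<Sum>i\<in>I. c i *\<^sub>R v i)"
  proof (induction rule: span_induct_alt)
    case base
    show ?case by (intro exI[of _ "\<lambda>_. 0"]) simp
  next
    case (step k x y)
    then obtain i c where i: "i \<in> I" "x = v i" and c: "y = (\<Sum>i\<in>I. c i *\<^sub>R v i)" by auto
    have "(\<Sum>j\<in>I. (if j = i then k else 0) *\<^sub>R v j) = (\<Sum>j\<in>I. if j = i then k *\<^sub>R v j else 0)"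
      by (intro sum.cong) auto
    then have "(\<Sum>j\<in>I. ((if j = i then k else 0) + c j) *\<^sub>R v j) = k *\<^sub>R x + y"
      using i assms by (simp add: scaleR_add_left sum.distrib c)
    then show ?case by metis
  qed
next
  assume "\<exists>c. z = (\<Sum>i\<in>I. c i *\<^sub>R v i)"
  then show "z \<in> span (v ` I)" by (auto intro!: span_sum intro: span_scale span_base)
qed

text \<open>The orthogonal complement of the kernel inside \<open>U\<close> is mapped injectively,
  and it has the same image as \<open>U\<close>.\<close>

lemma dim_image_add_dim_kernel:
  fixes f :: "'a::euclidean_space \<Rightarrow> 'b::euclidean_space"
  assumes "linear f" "subspace U"
  shows "dim (f ` U) + dim {x \<in> U. f x = 0} = dim U"
proof -
  let ?K = "{x \<in> U. f x = 0}"
  let ?Y = "{y \<in> U. \<forall>x\<in>?K. orthogonal x y}"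
  have K: "subspace ?K"
    using assms by (auto simp: subspace_def linear_0 linear_add linear_scale)
  have Y: "subspace ?Y"
    using assms(2) by (auto simp: subspace_def orthogonal_def inner_add_right)
  have dims: "dim ?Y + dim ?K = dim U"
    using dim_subspace_orthogonal_to_vectors[OF K assms(2)] by auto
  have "inj_on f (span ?Y)"
  proof -
    have "x = 0" if "x \<in> ?Y" "f x = 0" for x
      using that by (auto simp: orthogonal_def)
    then show ?thesis
      using Y assms(1) by (simp add: linear_injective_on_subspace_0 span_eq_iff[THEN iffD2])
  qed
  then have "dim (f ` ?Y) = dim ?Y" using assms(1) by (rule dim_image_eq[rotated])
  moreover have "f ` ?Y = f ` U"
  proof
    show "f ` U \<subseteq> f ` ?Y"
    proof
      fix z assume "z \<in> f ` U"
      then obtain u where u: "u \<in> U" "z = f u" by auto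
      obtain k y where k: "k \<in> span ?K" and y: "\<And>w. w \<in> span ?K \<Longrightarrow> orthogonal y w"
        and eq: "u = k + y"
        using orthogonal_subspace_decomp_exists[of ?K u] by metis
      have k': "k \<in> ?K" using k unfolding span_eq_iff[THEN iffD2, OF K] .
      then have "y \<in> U" using eq u(1) subspace_diff[OF assms(2), of u k] by simp
      moreover have "\<forall>x\<in>?K. orthogonal x y"
        using y by (simp add: orthogonal_commute span_base)
      moreover have "f y = z" using eq k' u(2) assms(1) by (simp add: linear_add)
      ultimately show "z \<in> f ` ?Y" by blast
    qed
  qed auto
  ultimately show ?thesis using dims by simp
qed

subsection \<open>Matroid union\<close>

text \<open>Integer values turn contraction into a plain subtraction of ranks.\<close>

definition matroid_rank :: "('e set \<Rightarrow> int) \<Rightarrow> bool" where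
  "matroid_rank r \<longleftrightarrow> r {} = 0 \<and> (\<forall>S T. S \<subseteq> T \<longrightarrow> r S \<le> r T) \<and>
     (\<forall>S e. r (insert e S) \<le> r S + 1) \<and> (\<forall>S T. r (S \<union> T) + r (S \<inter> T) \<le> r S + r T)"

lemma matroid_rank_mono: "matroid_rank r \<Longrightarrow> S \<subseteq> T \<Longrightarrow> r S \<le> r T"
  by (simp add: matroid_rank_def)

lemma matroid_rank_submodular: "matroid_rank r \<Longrightarrow> r (S \<union> T) + r (S \<inter> T) \<le> r S + r T"
  by (simp add: matroid_rank_def)

lemma matroid_rank_le_card:
  assumes "matroid_rank r" "finite S" shows "r S \<le> int (card S)"
  using assms(2)
proof (induction S)
  case empty then show ?case using assms(1) by (simp add: matroid_rank_def)
next
  case (insert e S)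
  have "r (insert e S) \<le> r S + 1" using assms(1) by (simp add: matroid_rank_def)
  with insert show ?case by simp
qed

text \<open>This is the contraction by \<open>T\<close>, with the elements of \<open>T\<close> kept
  as loops so that the ground set stays the same.\<close>

lemma matroid_rank_contract:
  assumes "matroid_rank r" shows "matroid_rank (\<lambda>S. r (S \<union> T) - r T)"
  unfolding matroid_rank_def
proof (intro conjI allI impI)
  show "r ({} \<union> T) - r T = 0" by simp
  show "r (S \<union> T) - r T \<le> r (S' \<union> T) - r T" if "S \<subseteq> S'" for S S'
    using matroid_rank_mono[OF assms, of "S \<union> T" "S' \<union> T"] that by auto
  show "r (insert e S \<union> T) - r T \<le> r (S \<union> T) - r T + 1" for S e
    using assms by (simp add: matroid_rank_def)
  show "r (S \<union> S' \<union> T) - r T + (r (S \<inter> S' \<union> T) - r T)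
      \<le> r (S \<union> T) - r T + (r (S' \<union> T) - r T)" for S S'
  proof -
    have "(S \<union> T) \<union> (S' \<union> T) = S \<union> S' \<union> T" "(S \<union> T) \<inter> (S' \<union> T) = S \<inter> S' \<union> T" by auto
    moreover have "r ((S \<union> T) \<union> (S' \<union> T)) + r ((S \<union> T) \<inter> (S' \<union> T)) \<le> r (S \<union> T) + r (S' \<union> T)"
      by (rule matroid_rank_submodular[OF assms])
    ultimately show ?thesis by simp
  qed
qed

text \<open>Submodularity for \<open>A \<union> B\<close> and \<open>T\<close> gives
  \<open>|A| + |B| + r T \<le> r (A \<union> B) + r T\<close>. It glues an independent set of the
  restriction to \<open>T\<close> to one of the contraction by \<open>T\<close>.\<close>

lemma matroid_rank_extend:
  assumes r: "matroid_rank r" and "finite A" "finite B" "A \<inter> B = {}" "A \<subseteq> T"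
    and A: "r A = int (card A)" and B: "r (B \<union> T) - r T = int (card B)"
  shows "r (A \<union> B) = int (card (A \<union> B))"
proof -
  have "r ((A \<union> B) \<union> T) + r ((A \<union> B) \<inter> T) \<le> r (A \<union> B) + r T"
    by (rule matroid_rank_submodular[OF r])
  moreover have "(A \<union> B) \<union> T = B \<union> T" using assms(5) by auto
  moreover have "r A \<le> r ((A \<union> B) \<inter> T)"
    using assms(5) by (intro matroid_rank_mono[OF r]) auto
  moreover have "r (A \<union> B) \<le> int (card (A \<union> B))"
    using assms(2,3) by (intro matroid_rank_le_card[OF r]) auto
  ultimately show ?thesis using A B assms(2-4) by (simp add: card_Un_disjoint)
qed

text \<open>Edmonds' theorem. A tight proper subset is split off by restriction and contraction;
  if there is none, contracting any element preserves the hypothesis.\<close>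

theorem matroid_union:
  assumes "finite F" "matroid_rank r" "matroid_rank s"
    and "\<And>S. S \<subseteq> F \<Longrightarrow> int (card S) \<le> r S + s S"
  shows "\<exists>A B. A \<union> B = F \<and> A \<inter> B = {} \<and> r A = int (card A) \<and> s B = int (card B)"
  using assms
proof (induction "card F" arbitrary: F r s rule: less_induct)
  case less
  note fin = less.prems(1) and r = less.prems(2) and s = less.prems(3) and count = less.prems(4)
  show ?case
  proof (cases "\<exists>T. T \<subset> F \<and> T \<noteq> {} \<and> int (card T) = r T + s T")
    case True
    then obtain T where T: "T \<subset> F" "T \<noteq> {}" "int (card T) = r T + s T" by blast
    have finT: "finite T" using T fin finite_subset by blast
    have cT: "card T < card F" "card (F - T) < card F"
      using T fin finT by (auto intro!: psubset_card_mono)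
    have "int (card S) \<le> r S + s S" if "S \<subseteq> T" for S
      using that T(1) by (intro count) blast
    from less.hyps[OF cT(1) finT r s this]
    obtain A B where AB: "A \<union> B = T" "A \<inter> B = {}" "r A = int (card A)" "s B = int (card B)" by blast
    \<comment> \<open>The equality for the tight set \<open>T\<close> is subtracted from the count
      for \<open>S \<union> T\<close>.\<close>
    have "int (card S) \<le> (r (S \<union> T) - r T) + (s (S \<union> T) - s T)" if "S \<subseteq> F - T" for S
    proof -
      have "card (S \<union> T) = card S + card T"
        using that finT fin by (intro card_Un_disjoint) (auto intro: finite_subset)
      moreover have "S \<union> T \<subseteq> F" using that T(1) by blast
      ultimately show ?thesis using count[of "S \<union> T"] T(3) by linarith
    qed
    from less.hyps[OF cT(2) finite_Diff[OF fin] matroid_rank_contract[OF r] matroid_rank_contract[OF s] this]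
    obtain A' B' where AB': "A' \<union> B' = F - T" "A' \<inter> B' = {}"
      "r (A' \<union> T) - r T = int (card A')" "s (B' \<union> T) - s T = int (card B')" by blast
    have f: "finite A" "finite B" "finite A'" "finite B'"
      using AB(1) AB'(1) finT finite_Diff[OF fin, of T] by (auto intro: rev_finite_subset)
    have "r (A \<union> A') = int (card (A \<union> A'))"
      using AB AB' f r by (intro matroid_rank_extend[where T = T]) auto
    moreover have "s (B \<union> B') = int (card (B \<union> B'))"
      using AB AB' f s by (intro matroid_rank_extend[where T = T]) auto
    moreover have "(A \<union> A') \<union> (B \<union> B') = F" "(A \<union> A') \<inter> (B \<union> B') = {}"
      using AB AB' T(1) by auto
    ultimately show ?thesis by blast
  next
    case no_tight: False
    show ?thesis
    proof (cases "F = {}")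
      case True
      then show ?thesis using r s by (intro exI[of _ "{}"]) (auto simp: matroid_rank_def)
    next
      case False
      then obtain e where e: "e \<in> F" by blast
      let ?F = "F - {e}"
      have c: "card ?F < card F" "finite ?F" using e fin card_Diff1_less[of F e] by auto
      \<comment> \<open>No proper nonempty subset is tight, so one unit of slack remains. It pays
        for the rank \<open>1\<close> lost when \<open>e\<close> is contracted below.\<close>
      have slack: "int (card S) + 1 \<le> r S + s S" if "S \<subseteq> ?F" "S \<noteq> {}" for S
      proof -
        have "S \<subset> F" using that e by blast
        then have "int (card S) \<noteq> r S + s S" using no_tight that by blast
        with count[of S] \<open>S \<subset> F\<close> show ?thesis by auto
      qed
      have mono: "r S \<le> r (S \<union> {e})" "s S \<le> s (S \<union> {e})" for S
        by (rule matroid_rank_mono[OF r], blast) (rule matroid_rank_mono[OF s], blast)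
      have r0: "r {} = 0" "s {} = 0" using r s by (auto simp: matroid_rank_def)
      have "r {e} \<le> 1" "s {e} \<le> 1" using matroid_rank_le_card[OF r, of "{e}"]
          matroid_rank_le_card[OF s, of "{e}"] by auto
      moreover have "1 \<le> r {e} + s {e}" using count[of "{e}"] e by simp
      ultimately consider "r {e} = 1" | "s {e} = 1" by linarith
      then show ?thesis
      proof cases
        case 1
        have "int (card S) \<le> (r (S \<union> {e}) - r {e}) + s S" if "S \<subseteq> ?F" for S
          using slack[OF that] mono(1)[of S] r0 1 by (cases "S = {}") auto
        from less.hyps[OF c matroid_rank_contract[OF r] s this]
        obtain A B where AB: "A \<union> B = ?F" "A \<inter> B = {}"
            "r (A \<union> {e}) - r {e} = int (card A)" "s B = int (card B)" by blast
        have "finite A" "e \<notin> A" "e \<notin> B" using AB(1) c by (auto intro: finite_subset)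
        then have "insert e A \<union> B = F" "insert e A \<inter> B = {}"
          "r (insert e A) = int (card (insert e A))"
          using AB e 1 by auto
        then show ?thesis using AB(4) by blast
      next
        case 2
        have "int (card S) \<le> r S + (s (S \<union> {e}) - s {e})" if "S \<subseteq> ?F" for S
          using slack[OF that] mono(2)[of S] r0 2 by (cases "S = {}") auto
        from less.hyps[OF c r matroid_rank_contract[OF s] this]
        obtain A B where AB: "A \<union> B = ?F" "A \<inter> B = {}"
            "r A = int (card A)" "s (B \<union> {e}) - s {e} = int (card B)" by blast
        have "finite B" "e \<notin> A" "e \<notin> B" using AB(1) c by (auto intro: finite_subset)
        then have "A \<union> insert e B = F" "A \<inter> insert e B = {}"
          "s (insert e B) = int (card (insert e B))"
          using AB e 2 by auto
        then show ?thesis using AB(3) by blast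
      qed
    qed
  qed
qed

text \<open>The dimension formula for sums and intersections of subspaces gives submodularity; it is
  only an inequality because the vectors common to \<open>S\<close> and \<open>T\<close> may span
  less than the intersection of the two spans.\<close>

lemma matroid_rank_dim:
  fixes a :: "'e \<Rightarrow> 'b::euclidean_space"
  shows "matroid_rank (\<lambda>S. int (dim (a ` S)))"
  unfolding matroid_rank_def
proof (intro conjI allI impI)
  show "int (dim (a ` {})) = 0" by simp
  show "int (dim (a ` S)) \<le> int (dim (a ` T))" if "S \<subseteq> T" for S T
    using that by (simp add: dim_subset image_mono)
  show "int (dim (a ` insert e S)) \<le> int (dim (a ` S)) + 1" for S e
    by (simp add: dim_insert)
  show "int (dim (a ` (S \<union> T))) + int (dim (a ` (S \<inter> T))) \<le> int (dim (a ` S)) + int (dim (a ` T))"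
    for S T
  proof -
    have "dim {x + y |x y. x \<in> span (a ` S) \<and> y \<in> span (a ` T)} + dim (span (a ` S) \<inter> span (a ` T))
        = dim (a ` S) + dim (a ` T)"
      using dim_sums_Int[of "span (a ` S)" "span (a ` T)"] by simp
    moreover have "{x + y |x y. x \<in> span (a ` S) \<and> y \<in> span (a ` T)} = span (a ` (S \<union> T))"
      by (auto simp: image_Un span_Un)
    moreover have "dim (a ` (S \<inter> T)) \<le> dim (span (a ` S) \<inter> span (a ` T))"
      by (intro dim_subset) (auto intro: span_base)
    ultimately show ?thesis by simp
  qed
qed

subsection \<open>Genericity\<close>

lemma real_polynomial_function_inner:
  "polynomial_function v \<Longrightarrow> real_polynomial_function (\<lambda>x. v x \<bullet> b)"
  using bounded_linear_inner_left[of b] unfolding polynomial_function_def o_def by blast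

text \<open>Fraction-free Gaussian elimination; \<open>P\<close> is the product of the pivots.\<close>

lemma indep_family_polynomial:
  fixes v :: "'i \<Rightarrow> 'a::real_normed_vector \<Rightarrow> 'b::euclidean_space"
  assumes "indep_family I (\<lambda>i. v i x0)" "\<And>i. i \<in> I \<Longrightarrow> polynomial_function (v i)"
  shows "\<exists>P. real_polynomial_function P \<and> P x0 \<noteq> 0 \<and> (\<forall>x. P x \<noteq> 0 \<longrightarrow> indep_family I (\<lambda>i. v i x))"
proof -
  have "finite I" using assms(1) by (rule indep_family_finite)
  then show ?thesis using assms
  proof (induction I arbitrary: v)
    case empty
    show ?case by (intro exI[of _ "\<lambda>_. 1"]) auto
  next
    case (insert k I)
    have "v k x0 \<noteq> 0"
      using indep_family_not_in_span[OF insert.prems(1) insert.hyps(2)] span_0 by metis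
    then obtain b where b: "v k x0 \<bullet> b \<noteq> 0" by (metis inner_eq_zero_iff)
    define p where "p = (\<lambda>x. v k x \<bullet> b)"
    \<comment> \<open>The \<open>b\<close> component of \<open>w i\<close> is eliminated.
      Multiplying by the pivot \<open>p\<close> in place of dividing by it keeps the entries
      polynomial.\<close>
    define w where "w = (\<lambda>i x. p x *\<^sub>R v i x + (- (v i x \<bullet> b)) *\<^sub>R v k x)"
    have p: "real_polynomial_function p"
      unfolding p_def using insert.prems(2) by (intro real_polynomial_function_inner) auto
    have eq: "(\<Sum>i\<in>I. c i *\<^sub>R w i x) = p x *\<^sub>R (\<Sum>i\<in>I. c i *\<^sub>R v i x) - ((\<Sum>i\<in>I. c i *\<^sub>R v i x) \<bullet> b) *\<^sub>R v k x"
      for c x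
      by (simp add: w_def scaleR_diff_right scaleR_sum_right inner_sum_left
          scaleR_sum_left sum_subtractf mult.commute)
    have "indep_family I (\<lambda>i. w i x0)"
    proof (rule indep_familyI)
      fix c i assume c: "(\<Sum>i\<in>I. c i *\<^sub>R w i x0) = 0" and i: "i \<in> I"
      define s where "s = (\<Sum>i\<in>I. c i *\<^sub>R v i x0)"
      define c' where "c' = (\<lambda>i. if i = k then - (s \<bullet> b) else p x0 * c i)"
      have "(\<Sum>i\<in>insert k I. c' i *\<^sub>R v i x0) = - (s \<bullet> b) *\<^sub>R v k x0 + (\<Sum>i\<in>I. c' i *\<^sub>R v i x0)"
        using insert.hyps by (simp add: c'_def)
      also have "(\<Sum>i\<in>I. c' i *\<^sub>R v i x0) = p x0 *\<^sub>R s"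
        using insert.hyps(2) unfolding s_def scaleR_sum_right c'_def by (intro sum.cong) auto
      finally have "(\<Sum>i\<in>insert k I. c' i *\<^sub>R v i x0) = 0"
        using c eq[of c x0] by (simp add: s_def)
      then have "c' i = 0" using indep_familyD[OF insert.prems(1), of c' i] i by simp
      moreover have "i \<noteq> k" using i insert.hyps(2) by auto
      ultimately show "c i = 0" using b by (simp add: c'_def p_def)
    qed (use insert in simp)
    moreover have "polynomial_function (w i)" if "i \<in> I" for i
    proof -
      have "real_polynomial_function (\<lambda>x. - (v i x \<bullet> b))"
        using insert.prems(2)[of i] that
        by (intro real_polynomial_function_minus real_polynomial_function_inner) auto
      then show ?thesis
        unfolding w_def using insert.prems(2) that p
        by (intro polynomial_function_add polynomial_function_mult) (auto simp: real_polynomial_function_eq)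
    qed
    ultimately obtain P where P: "real_polynomial_function P" "P x0 \<noteq> 0"
      "\<And>x. P x \<noteq> 0 \<Longrightarrow> indep_family I (\<lambda>i. w i x)"
      using insert.IH[of w] by blast
    have "indep_family (insert k I) (\<lambda>i. v i x)" if nz: "p x * P x \<noteq> 0" for x
    proof (rule indep_familyI)
      fix c i assume c: "(\<Sum>i\<in>insert k I. c i *\<^sub>R v i x) = 0" and i: "i \<in> insert k I"
      then have s: "(\<Sum>i\<in>I. c i *\<^sub>R v i x) = - (c k *\<^sub>R v k x)"
        using insert.hyps by (simp add: add_eq_0_iff)
      \<comment> \<open>A dependency makes the sum over \<open>I\<close> a multiple of
        \<open>v k x\<close>, and the elimination sends such multiples to \<open>0\<close>.\<close>
      have "(\<Sum>i\<in>I. c i *\<^sub>R w i x) = 0"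
        unfolding eq s by (simp add: p_def mult.commute)
      then have z: "\<forall>i\<in>I. c i = 0" using P(3)[of x] nz indep_familyD by fastforce
      with s have "c k *\<^sub>R v k x = 0" by simp
      moreover have "v k x \<noteq> 0" using nz by (auto simp: p_def)
      ultimately show "c i = 0" using z i by auto
    qed (use insert in simp)
    moreover have "real_polynomial_function (\<lambda>x. p x * P x)" using p P(1) by auto
    moreover have "p x0 * P x0 \<noteq> 0" using P(2) b by (simp add: p_def)
    ultimately show ?case by blast
  qed
qed

section \<open>Generic assignments, tested along lines\<close>

lemma real_polynomial_function_finite_roots:
  fixes P :: "real \<Rightarrow> real"
  assumes "real_polynomial_function P" "P t0 \<noteq> 0"
  shows "finite {t. P t = 0}"
proof -
  obtain a n where P: "P = (\<lambda>x. \<Sum>i\<le>n. a i * x ^ i)"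
    using assms(1) by (auto simp: real_polynomial_function_iff_sum)
  have "\<exists>i\<le>n. a i \<noteq> 0"
  proof (rule ccontr)
    assume "\<not> ?thesis"
    then have "P t0 = 0" unfolding P by simp
    with assms(2) show False by simp
  qed
  then show ?thesis
    unfolding P using polyfun_finite_roots[of a n] by blast
qed

text \<open>Assignments are functions on a type \<open>'e\<close> that need not be finite, so
  genericity is tested on lines: a line starting at a good assignment has only finitely many bad
  parameters. This plays the role of a Zariski open condition.\<close>

definition generic_cond :: "(('e \<Rightarrow> 'b::real_vector) \<Rightarrow> bool) \<Rightarrow> bool" where
  "generic_cond C \<longleftrightarrow> (\<forall>d d'. C d \<longrightarrow> finite {t::real. \<not> C (\<lambda>e. d e + t *\<^sub>R (d' e - d e))})"

text \<open>A solution of the conditions treated so far is joined by a line to a solution of the new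
  one; each condition fails at finitely many points of this line only.\<close>

lemma generic_cond_simultaneous:
  assumes "finite J" "\<And>j. j \<in> J \<Longrightarrow> generic_cond (C j)" "\<And>j. j \<in> J \<Longrightarrow> \<exists>d. C j d"
  shows "\<exists>d. \<forall>j\<in>J. C j d"
  using assms
proof (induction J)
  case empty then show ?case by simp
next
  case (insert k J)
  then obtain d where d: "\<forall>j\<in>J. C j d" by blast
  obtain d' where d': "C k d'" using insert.prems(2) by blast
  define l where "l = (\<lambda>t::real. \<lambda>e. d e + t *\<^sub>R (d' e - d e))"
  have "{t. \<not> C j (l t)} = {t. \<not> C j (\<lambda>e. d e + t *\<^sub>R (d' e - d e))}" for j by (simp add: l_def)
  then have 1: "finite {t. \<not> C j (l t)}" if "j \<in> J" for j
    using insert.prems(1)[of j] d that unfolding generic_cond_def by auto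
  \<comment> \<open>The same line run backwards starts at \<open>d'\<close>, where the new condition
    holds.\<close>
  have l': "l (1 - t) = (\<lambda>e. d' e + t *\<^sub>R (d e - d' e))" for t
    by (auto simp: l_def algebra_simps)
  have "finite {t. \<not> C k (l (1 - t))}"
    unfolding l' using insert.prems(1)[of k] d' unfolding generic_cond_def by blast
  then have "finite ((\<lambda>t. 1 - t) ` {t. \<not> C k (l (1 - t))})" by blast
  moreover have "{t. \<not> C k (l t)} \<subseteq> (\<lambda>t. 1 - t) ` {t. \<not> C k (l (1 - t))}"
  proof
    fix t assume "t \<in> {t. \<not> C k (l t)}"
    then show "t \<in> (\<lambda>t. 1 - t) ` {t. \<not> C k (l (1 - t))}"
      by (intro image_eqI[where x = "1 - t"]) auto
  qed
  ultimately have 2: "finite {t. \<not> C k (l t)}" using finite_subset by blast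
  have "finite (\<Union>j\<in>insert k J. {t. \<not> C j (l t)})" using 1 2 insert.hyps by auto
  then obtain t where "t \<notin> (\<Union>j\<in>insert k J. {t. \<not> C j (l t)})"
    using ex_new_if_finite[OF infinite_UNIV_char_0] by blast
  then show ?case by blast
qed

lemma generic_cond_polynomial:
  fixes P :: "'b::real_normed_vector \<Rightarrow> real"
  assumes "real_polynomial_function P"
  shows "generic_cond (\<lambda>d. P (d (k::'e)) \<noteq> 0)"
  unfolding generic_cond_def
proof (intro allI impI)
  fix d d' :: "'e \<Rightarrow> 'b" assume nz: "P (d k) \<noteq> 0"
  have "polynomial_function (\<lambda>t::real. d k + t *\<^sub>R (d' k - d k))" by auto
  then have "real_polynomial_function (\<lambda>t. P (d k + t *\<^sub>R (d' k - d k)))"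
    using real_polynomial_function_compose[OF _ assms] by (simp add: o_def)
  from real_polynomial_function_finite_roots[OF this, of 0] nz
  show "finite {t. \<not> P (d k + t *\<^sub>R (d' k - d k)) \<noteq> 0}" by simp
qed

text \<open>Along a line the vectors are polynomial in the parameter, so a polynomial nonzero at the
  parameter \<open>0\<close> certifies independence off its finitely many roots.\<close>

lemma generic_cond_indep_family:
  fixes v :: "'i \<Rightarrow> 'b::euclidean_space \<Rightarrow> 'c::euclidean_space"
  assumes "\<And>i. i \<in> I \<Longrightarrow> linear (v i)"
  shows "generic_cond (\<lambda>d. indep_family I (\<lambda>i. v i (d (k i :: 'e))))"
  unfolding generic_cond_def
proof (intro allI impI)
  fix d d' :: "'e \<Rightarrow> 'b" assume nz: "indep_family I (\<lambda>i. v i (d (k i)))"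
  let ?w = "\<lambda>i t. v i (d (k i) + t *\<^sub>R (d' (k i) - d (k i)))"
  have "polynomial_function (?w i)" if "i \<in> I" for i
  proof -
    have "polynomial_function (\<lambda>t::real. d (k i) + t *\<^sub>R (d' (k i) - d (k i)))" by auto
    moreover have "polynomial_function (v i)"
      using assms[OF that] by (simp add: linear_conv_bounded_linear polynomial_function_bounded_linear)
    ultimately show ?thesis
      using polynomial_function_compose[of "\<lambda>t. d (k i) + t *\<^sub>R (d' (k i) - d (k i))" "v i"]
      by (simp add: o_def)
  qed
  moreover have "indep_family I (\<lambda>i. ?w i 0)" using nz by simp
  ultimately obtain P where P: "real_polynomial_function P" "P 0 \<noteq> 0"
      "\<And>t. P t \<noteq> 0 \<Longrightarrow> indep_family I (\<lambda>i. ?w i t)"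
    using indep_family_polynomial[of I ?w 0] by blast
  have "{t. \<not> indep_family I (\<lambda>i. ?w i t)} \<subseteq> {t. P t = 0}" using P(3) by auto
  then show "finite {t. \<not> indep_family I (\<lambda>i. ?w i t)}"
    using real_polynomial_function_finite_roots[OF P(1,2)] finite_subset by blast
qed

subsection \<open>The rank of a subgroup of the integer plane\<close>

lemma real_vec_simps [simp]:
  "real_vec 0 = 0" "real_vec (a + b) = real_vec a + real_vec b"
  "real_vec (a - b) = real_vec a - real_vec b" "real_vec (- a) = - real_vec a"
  "real_vec (k *s a) = real_of_int k *\<^sub>R real_vec a"
  by (simp_all add: real_vec_def vec_eq_iff)

lemma real_vec_nth [simp]: "real_vec a $ i = real_of_int (a $ i)"
  by (simp add: real_vec_def)

lemma inj_real_vec: "inj real_vec"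
  by (rule injI) (simp add: vec_eq_iff)

lemma real_vec_eq_0_iff [simp]: "real_vec a = 0 \<longleftrightarrow> a = 0"
  by (simp add: vec_eq_iff)

lemma real_vec_sum: "real_vec (sum f A) = (\<Sum>a\<in>A. real_vec (f a))"
  by (induction A rule: infinite_finite_induct) auto

lemma int_independentD:
  assumes "int_vec.independent B" "finite T" "T \<subseteq> B" "(\<Sum>b\<in>T. c b *s b) = 0" "b \<in> T"
  shows "c b = 0"
  using assms unfolding int_vec.dependent_explicit by blast

lemma independent_real_vec_imp_int:
  assumes "independent (real_vec ` B)"
  shows "int_vec.independent B"
  unfolding int_vec.dependent_explicit
proof clarify
  fix T u b assume T: "finite T" "T \<subseteq> B" "(\<Sum>b\<in>T. u b *s b) = 0" "b \<in> T" "u b \<noteq> 0"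
  have "(\<Sum>b\<in>T. real_of_int (u b) *\<^sub>R real_vec b) = real_vec (\<Sum>b\<in>T. u b *s b)"
    by (simp add: real_vec_sum)
  then have "(\<Sum>x\<in>real_vec ` T. real_of_int (u (inv real_vec x)) *\<^sub>R x) = 0"
    using T(3) inj_real_vec by (simp add: sum.reindex inj_on_subset inv_f_f)
  moreover have "independent (real_vec ` T)"
    using assms T(2) by (meson image_mono independent_mono)
  ultimately have "real_of_int (u (inv real_vec (real_vec b))) = 0"
    using T(1,4) by (auto simp: independent_explicit)
  then show False using T(5) inj_real_vec by (simp add: inv_f_f)
qed

text \<open>If the determinant vanishes, then \<open>v $ k *s u - u $ k *s v\<close> is
  \<open>0\<close> for both coordinates \<open>k\<close>, and independence forces every entry of
  \<open>u\<close> and \<open>v\<close> to vanish.\<close>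

lemma int_independent_det:
  fixes u v :: "int^2"
  assumes B: "int_vec.independent B" and uv: "u \<in> B" "v \<in> B" "u \<noteq> v"
  shows "u $ 1 * v $ 2 - u $ 2 * v $ 1 \<noteq> 0"
proof
  assume det: "u $ 1 * v $ 2 - u $ 2 * v $ 1 = 0"
  have comb: "c = 0 \<and> d = 0" if "c *s u + d *s v = 0" for c d
    using int_independentD[OF B, of "{u, v}" "\<lambda>x. if x = u then c else d"] uv that by force
  have "v $ 1 = 0 \<and> - (u $ 1) = 0"
    by (rule comb) (use det in \<open>simp add: vec_eq_iff forall_2 algebra_simps\<close>)
  moreover have "v $ 2 = 0 \<and> - (u $ 2) = 0"
    by (rule comb) (use det in \<open>simp add: vec_eq_iff forall_2 algebra_simps\<close>)
  ultimately have "u = v" by (simp add: vec_eq_iff forall_2)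
  with uv show False by simp
qed

text \<open>In the plane explicit integer relations suffice: three distinct vectors are excluded by
  Cramer's identity, and for two vectors the nonzero determinant also settles real
  coefficients.\<close>

lemma int_independent_imp_real_vec:
  fixes B :: "(int^2) set"
  assumes B: "int_vec.independent B" and fin: "finite B"
  shows "independent (real_vec ` B)"
proof -
  have two: "\<not> (\<exists>u\<in>B. \<exists>v\<in>B. \<exists>w\<in>B. u \<noteq> v \<and> u \<noteq> w \<and> v \<noteq> w)"
  proof
    assume "\<exists>u\<in>B. \<exists>v\<in>B. \<exists>w\<in>B. u \<noteq> v \<and> u \<noteq> w \<and> v \<noteq> w"
    then obtain u v w where uvw: "u \<in> B" "v \<in> B" "w \<in> B" "u \<noteq> v" "u \<noteq> w" "v \<noteq> w" by blast
    \<comment> \<open>Cramer's identity: the coefficient of each vector is, up to sign, the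
      determinant of the other two.\<close>
    let ?c = "\<lambda>x. if x = u then v $ 1 * w $ 2 - v $ 2 * w $ 1
      else if x = v then w $ 1 * u $ 2 - w $ 2 * u $ 1 else u $ 1 * v $ 2 - u $ 2 * v $ 1"
    have "(\<Sum>b\<in>{u, v, w}. ?c b *s b) = (v $ 1 * w $ 2 - v $ 2 * w $ 1) *s u
        + (w $ 1 * u $ 2 - w $ 2 * u $ 1) *s v + (u $ 1 * v $ 2 - u $ 2 * v $ 1) *s w"
      using uvw(4-6) uvw(4-6)[symmetric] by (simp add: add.assoc)
    also have "\<dots> = 0"
      by (simp add: vec_eq_iff forall_2 algebra_simps)
    finally have "(\<Sum>b\<in>{u, v, w}. ?c b *s b) = 0" .
    then have "?c w = 0" using int_independentD[OF B, of "{u, v, w}" ?c w] uvw by auto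
    then show False using int_independent_det[OF B uvw(1,2,4)] uvw by auto
  qed
  have "indep_family B real_vec"
  proof (rule indep_familyI[OF fin])
    fix c b assume c: "(\<Sum>b\<in>B. c b *\<^sub>R real_vec b) = 0" and b: "b \<in> B"
    show "c b = 0"
    proof (cases "\<exists>v\<in>B. v \<noteq> b")
      case True
      then obtain v where v: "v \<in> B" "v \<noteq> b" by blast
      then have Beq: "B = {b, v}" using two b by blast
      have eq: "c b *\<^sub>R real_vec b + c v *\<^sub>R real_vec v = 0" using c v by (simp add: Beq)
      have "c b * real_of_int (b $ 1 * v $ 2 - b $ 2 * v $ 1) =
          (c b *\<^sub>R real_vec b + c v *\<^sub>R real_vec v) $ 1 * real_of_int (v $ 2)
          - (c b *\<^sub>R real_vec b + c v *\<^sub>R real_vec v) $ 2 * real_of_int (v $ 1)"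
        by (simp add: algebra_simps)
      then have "c b * real_of_int (b $ 1 * v $ 2 - b $ 2 * v $ 1) = 0" using eq by simp
      then show ?thesis using int_independent_det[OF B b v(1)] v(2) by (metis mult_eq_0_iff of_int_eq_0_iff)
    next
      case False
      then have Beq: "B = {b}" using b by blast
      then have "c b *\<^sub>R real_vec b = 0" using c by simp
      moreover have "b \<noteq> 0" using int_independentD[OF B, of "{b}" "\<lambda>_. 1" b] b by auto
      ultimately show ?thesis by simp
    qed
  qed
  then show ?thesis by (rule indep_family_independent)
qed

text \<open>Integrally independent sets stay independent over the reals, which bounds the rank from
  above. Conversely a real basis chosen among the generators is a fortiori integrally
  independent.\<close>

lemma subgroup_rank_eq_dim:
  fixes S :: "(int^2) set"
  shows "subgroup_rank (group_closure S) = dim (real_vec ` S)"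
  unfolding subgroup_rank_def
proof (rule Max_eqI)
  have closure: "real_vec x \<in> span (real_vec ` S)" if "x \<in> group_closure S" for x
    using that by induction (auto intro: span_base span_diff span_zero)
  have le: "card B \<le> dim (real_vec ` S)"
    if "B \<subseteq> group_closure S" "finite B" "int_vec.independent B" for B
  proof -
    have "real_vec ` B \<subseteq> span (real_vec ` S)" using closure that(1) by blast
    moreover have "card (real_vec ` B) = card B"
      using inj_real_vec by (metis card_image inj_on_subset subset_UNIV)
    ultimately show ?thesis
      using independent_card_le_dim[of "real_vec ` B" "span (real_vec ` S)"]
        int_independent_imp_real_vec[OF that(3,2)] by simp
  qed
  then show "y \<le> dim (real_vec ` S)"
    if "y \<in> {card B |B. B \<subseteq> group_closure S \<and> finite B \<and> int_vec.independent B}" for y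
    using that by blast
  then show "finite {card B |B. B \<subseteq> group_closure S \<and> finite B \<and> int_vec.independent B}"
    by (meson atMost_iff finite_atMost finite_subset subsetI)
  obtain C where C: "C \<subseteq> real_vec ` S" "independent C" "card C = dim (real_vec ` S)"
    using basis_exists[of "real_vec ` S"] by metis
  then obtain B where B: "B \<subseteq> S" "C = real_vec ` B" by (meson subset_imageE)
  have "card B = card C" using B inj_real_vec by (metis card_image inj_on_subset subset_UNIV)
  moreover have "finite B"
    using B C(2) inj_real_vec independent_imp_finite finite_imageD inj_on_subset by (metis subset_UNIV)
  moreover have "B \<subseteq> group_closure S" using B(1) by (auto intro: group_closure.base)
  moreover have "int_vec.independent B" using C(2) B(2) independent_real_vec_imp_int by blast
  ultimately show "dim (real_vec ` S) \<in> {card B |B. B \<subseteq> group_closure S \<and> finite B \<and> int_vec.independent B}"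
    using C(3) by (intro CollectI exI[of _ B]) simp
qed

subsection \<open>The frame matroid of a colored graph\<close>

definition boundary :: "('v::finite, 'e) colored_graph \<Rightarrow> 'e \<Rightarrow> real^'v" where
  "boundary G e = axis (head G e) 1 - axis (tail G e) 1"

definition incidence :: "('v::finite, 'e) colored_graph \<Rightarrow> 'e \<Rightarrow> (real^'v) \<times> (real^2)" where
  "incidence G e = (boundary G e, real_vec (color G e))"

text \<open>This is the rank \<open>n' - c'\<close> of the graphic matroid. Every component gets a
  root, and the differences \<open>b v\<close> between a non-root vertex \<open>v\<close> and its
  root form a basis.\<close>

lemma dim_boundary:
  fixes G :: "('v::finite, 'e) colored_graph"
  shows "dim (boundary G ` F) + card (sub_components G F) = card (sub_vertices G F)"
proof -
  define R where "R = (sub_adj G F)\<^sup>*"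
  define V where "V = sub_vertices G F"
  \<comment> \<open>The choice depends on the class of \<open>v\<close> alone, so connected vertices
    share their root.\<close>
  define root where "root = (\<lambda>v. SOME u. u \<in> R `` {v})"
  define b where "b = (\<lambda>v. axis v (1::real) - axis (root v) 1 :: real^'v)"
  define J where "J = V - root ` V"
  have "sym (sub_adj G F)" by (auto simp: sub_adj_def sym_def)
  then have sym: "sym R" unfolding R_def by (rule sym_rtrancl)
  have trans: "trans R" by (simp add: R_def trans_rtrancl)
  have root: "(v, root v) \<in> R" for v
    unfolding root_def using someI[of "\<lambda>u. u \<in> R `` {v}" v] by (auto simp: R_def)
  have cls: "R `` {v} = R `` {w}" if "(v, w) \<in> R" for v w
    using that sym trans unfolding sym_def trans_def by blast
  have root_eq: "root v = root w" if "(v, w) \<in> R" for v w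
    unfolding root_def cls[OF that] ..
  have V_closed: "w \<in> V" if "(v, w) \<in> R" "v \<in> V" for v w
    using that unfolding R_def by (induction) (auto simp: sub_adj_def V_def sub_vertices_def)
  have root_V: "root v \<in> V" if "v \<in> V" for v using V_closed[OF root] that by blast
  have root_root: "root (root v) = root v" for v using root_eq[OF root] by simp
  have "bij_betw (\<lambda>v. R `` {v}) (root ` V) (sub_components G F)"
    unfolding bij_betw_def
  proof
    show "inj_on (\<lambda>v. R `` {v}) (root ` V)"
    proof (rule inj_onI)
      fix x y assume "x \<in> root ` V" "y \<in> root ` V" "R `` {x} = R `` {y}"
      then show "x = y" using root_root by (metis imageE root_def)
    qed
    have "(\<lambda>v. R `` {v}) ` root ` V = (\<lambda>v. R `` {v}) ` V"
      unfolding image_image using cls[OF root] by simp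
    then show "(\<lambda>v. R `` {v}) ` root ` V = sub_components G F"
      by (auto simp: sub_components_def quotient_def R_def V_def)
  qed
  then have comps: "card (sub_components G F) = card (root ` V)" by (simp add: bij_betw_same_card)
  have cardJ: "card J + card (root ` V) = card V"
  proof -
    have "root ` V \<subseteq> V" using root_V by blast
    then show ?thesis
      unfolding J_def using card_Diff_subset[of "root ` V" V] card_mono[of V "root ` V"] by simp
  qed
  have "indep_family J b"
  proof (rule indep_familyI)
    fix c j assume c: "(\<Sum>v\<in>J. c v *\<^sub>R b v) = 0" and j: "j \<in> J"
    have "b v $ j = (if v = j then 1 else 0)" if "v \<in> J" for v
      using that j by (auto simp: b_def axis_def J_def)
    then have "(\<Sum>v\<in>J. c v *\<^sub>R b v) $ j = (\<Sum>v\<in>J. if v = j then c v else 0)"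
      unfolding sum_component by (intro sum.cong) auto
    then show "c j = 0" using c j by simp
  qed simp
  then have "dim (b ` J) = card J" by (rule indep_family_dim)
  moreover have "span (b ` J) = span (boundary G ` F)"
  proof (rule span_eq[THEN iffD2], intro conjI subsetI)
    have bV: "b v \<in> span (b ` J)" if "v \<in> V" for v
    proof (cases "v \<in> J")
      case False
      then have "root v = v" using that root_root by (auto simp: J_def)
      then show ?thesis by (simp add: b_def span_zero)
    qed (auto intro: span_base)
    fix x assume "x \<in> boundary G ` F"
    then obtain e where e: "e \<in> F" "x = boundary G e" by blast
    then have hv: "head G e \<in> V" "tail G e \<in> V" by (auto simp: V_def sub_vertices_def)
    have "(tail G e, head G e) \<in> R" using e by (auto simp: R_def sub_adj_def)
    then have "x = b (head G e) - b (tail G e)"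
      using root_eq by (simp add: e b_def boundary_def)
    then show "x \<in> span (b ` J)" using bV hv by (simp add: span_diff)
  next
    fix x assume "x \<in> b ` J"
    then obtain v where v: "x = b v" by blast
    have "(axis w 1 - axis v 1 :: real^'v) \<in> span (boundary G ` F)" if "(v, w) \<in> R" for w
      using that unfolding R_def
    proof induction
      case (step y z)
      then obtain e where e: "e \<in> F" "(y, z) = (tail G e, head G e) \<or> (y, z) = (head G e, tail G e)"
        by (auto simp: sub_adj_def)
      have be: "boundary G e \<in> span (boundary G ` F)" using e by (auto intro: span_base)
      then have "(axis z 1 - axis y 1 :: real^'v) \<in> span (boundary G ` F)"
        using e(2) span_neg[OF be] by (auto simp: boundary_def)
      from span_add[OF this step.IH] show ?case by simp
    qed (simp add: span_zero)
    from span_neg[OF this[OF root]] show "x \<in> span (boundary G ` F)" by (simp add: v b_def)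
  qed
  ultimately have "dim (boundary G ` F) = card J" by (metis dim_span)
  with comps cardJ show ?thesis by (simp add: V_def)
qed

text \<open>Trades the index modulo \<open>length c\<close> for a chain with a closing condition,
  the form in which a growing path presents itself.\<close>

lemma simple_cycleI:
  assumes "c \<noteq> []" "fst ` set c \<subseteq> F" "distinct (map fst c)" "distinct (map (dart_start G) c)"
    and chain: "successively (\<lambda>d d'. dart_end G d = dart_start G d') c"
    and close: "dart_end G (last c) = dart_start G (hd c)"
  shows "simple_cycle G F c"
  unfolding simple_cycle_def
proof (intro conjI allI impI)
  fix k assume k: "k < length c"
  show "dart_end G (c ! k) = dart_start G (c ! (Suc k mod length c))"
  proof (cases "Suc k < length c")
    case True
    then show ?thesis using chain by (simp add: successively_conv_nth)
  next
    case False
    then have "k = length c - 1" using k by simp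
    then show ?thesis using close assms(1) by (simp add: last_conv_nth hd_conv_nth)
  qed
qed (use assms in auto)

lemma starts_of_chain:
  "successively (\<lambda>d d'. dart_end G d = dart_start G d') c \<Longrightarrow>
     map (dart_start G) (tl c) = map (dart_end G) (butlast c)"
  by (induction c rule: induct_list012) auto

lemma dart_start_or_end:
  "v \<in> {tail G e, head G e} \<Longrightarrow> v = dart_start G (e, b) \<or> v = dart_end G (e, b)"
  by auto

text \<open>In the support of a circulation no walk ends in a dead end, so a longest path closes up.\<close>

lemma circulation_support_has_cycle:
  fixes G :: "('v::finite, 'e) colored_graph"
  assumes fin: "finite S" and "S \<noteq> {}" and nz: "\<And>e. e \<in> S \<Longrightarrow> c e \<noteq> 0"
    and circ: "(\<Sum>e\<in>S. c e *\<^sub>R boundary G e) = 0"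
  shows "\<exists>C. simple_cycle G S C"
proof (rule ccontr)
  assume none: "\<nexists>C. simple_cycle G S C"
  have noloop: "tail G e \<noteq> head G e" if "e \<in> S" for e
  proof
    assume "tail G e = head G e"
    then have "simple_cycle G S [(e, True)]" using that by (intro simple_cycleI) auto
    then show False using none by blast
  qed
  \<comment> \<open>If \<open>e\<close> were the only edge of the support at \<open>v\<close>, the
    circulation would have the component \<open>c e\<close> or \<open>- c e\<close> there.\<close>
  have another: "\<exists>e'\<in>S. e' \<noteq> e \<and> v \<in> {tail G e', head G e'}"
    if e: "e \<in> S" "v \<in> {tail G e, head G e}" for e v
  proof (rule ccontr)
    assume "\<not> ?thesis"
    then have "boundary G e' $ v = 0" if "e' \<in> S" "e' \<noteq> e" for e'
      using that by (auto simp: boundary_def axis_def)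
    then have "(\<Sum>e\<in>S. c e *\<^sub>R boundary G e) $ v = (\<Sum>e'\<in>S. if e' = e then c e * boundary G e $ v else 0)"
      unfolding sum_component by (intro sum.cong) auto
    then have "c e * boundary G e $ v = 0" using circ fin e(1) by simp
    moreover have "boundary G e $ v \<noteq> 0"
      using e noloop[OF e(1)] by (auto simp: boundary_def axis_def)
    ultimately show False using nz[OF e(1)] by simp
  qed
  \<comment> \<open>Paths are extended at the front. The start of the first dart and all ends are
    distinct, which bounds the length by the number of vertices.\<close>
  define path where "path = (\<lambda>P. P \<noteq> [] \<and> fst ` set P \<subseteq> S \<and> distinct (map fst P) \<and>
    distinct (dart_start G (hd P) # map (dart_end G) P) \<and>
    successively (\<lambda>d d'. dart_end G d = dart_start G d') P)"
  obtain e where e: "e \<in> S" using \<open>S \<noteq> {}\<close> by blast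
  have base: "path [(e, True)]" using e noloop[OF e] by (simp add: path_def)
  have bound: "length P < Suc CARD('v)" if "path P" for P
  proof -
    have "distinct (map (dart_end G) P)" using that by (simp add: path_def)
    then have "card (set (map (dart_end G) P)) = length P" by (metis distinct_card length_map)
    moreover have "card (set (map (dart_end G) P)) \<le> CARD('v)" by (intro card_mono) auto
    ultimately show ?thesis by simp
  qed
  obtain P where P: "path P" and longest: "\<And>Q. path Q \<Longrightarrow> length Q \<le> length P"
    using ex_has_greatest_nat[of path "[(e, True)]" length "Suc CARD('v)"] base bound
    by (metis less_imp_le)
  obtain h t where Pht: "P = h # t" using P by (cases P) (auto simp: path_def)
  define v where "v = dart_start G h"
  have h: "fst h \<in> S" "v \<in> {tail G (fst h), head G (fst h)}"
    using P by (auto simp: path_def Pht v_def prod_eq_iff) (cases h; auto)+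
  from another[OF h] obtain e' where e': "e' \<in> S" "e' \<noteq> fst h" "v \<in> {tail G e', head G e'}" by blast
  \<comment> \<open>\<open>d\<close> traverses \<open>e'\<close> towards \<open>v\<close>, so that
    it can be put in front of \<open>P\<close>.\<close>
  define d where "d = (e', head G e' = v)"
  have d: "dart_end G d = v" "fst d = e'" using e'(3) by (auto simp: d_def)
  have ud: "dart_start G d \<noteq> v" using noloop[OF e'(1)] e'(3) by (auto simp: d_def)
  have vend: "v \<notin> set (map (dart_end G) P)" using P by (simp add: path_def Pht v_def)
  have chainP: "successively (\<lambda>d d'. dart_end G d = dart_start G d') P" using P by (simp add: path_def)
  \<comment> \<open>A dart of \<open>P\<close> along \<open>e'\<close> would start or end at
    \<open>v\<close>. No dart of \<open>P\<close> ends there, and every dart after the first starts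
    at the end of another.\<close>
  have fresh: "e' \<notin> fst ` set P"
  proof
    assume "e' \<in> fst ` set P"
    then obtain b where b: "(e', b) \<in> set P" by auto
    then have "v \<noteq> dart_end G (e', b)" using vend by (metis image_eqI set_map)
    then have vs: "v = dart_start G (e', b)" using dart_start_or_end[OF e'(3)] by blast
    have "(e', b) \<in> set t" using b e'(2) by (auto simp: Pht)
    then have "v \<in> set (map (dart_start G) (tl P))"
      unfolding vs Pht list.sel set_map by (rule imageI)
    then have "v \<in> set (map (dart_end G) (butlast P))" using starts_of_chain[OF chainP] by simp
    then show False using vend by (auto dest: in_set_butlastD)
  qed
  show False
  proof (cases "dart_start G d \<in> set (map (dart_end G) P)")
    case False
    then have "path (d # P)"
      using P fresh d e'(1) ud unfolding path_def by (auto simp: Pht v_def)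
    from longest[OF this] show False by simp
  next
    case True
    then obtain p where "p \<in> set P" "dart_end G p = dart_start G d" by auto
    then obtain A B where AB: "P = A @ p # B" by (meson split_list)
    have pu: "dart_end G p = dart_start G d" by fact
    \<comment> \<open>\<open>d\<close> leaves a vertex already visited by \<open>P\<close>; the
      initial piece of \<open>P\<close> up to the dart \<open>p\<close> ending there leads from
      \<open>v\<close> back to it.\<close>
    let ?C = "d # A @ [p]"
    have chA: "successively (\<lambda>d d'. dart_end G d = dart_start G d') (A @ [p])"
      using chainP by (simp add: AB successively_append_iff successively_Cons)
    have hd: "hd (A @ [p]) = h" using AB Pht by (cases A) auto
    have "map (dart_start G) (A @ [p]) = v # map (dart_end G) A"
      using starts_of_chain[OF chA] hd by (cases A) (auto simp: v_def)
    moreover have "distinct (dart_start G d # v # map (dart_end G) A)"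
    proof -
      have "distinct (v # map (dart_end G) P)" using P by (simp add: path_def Pht v_def)
      then show ?thesis unfolding AB using pu ud by simp
    qed
    ultimately have "distinct (map (dart_start G) ?C)" by simp
    moreover have "distinct (map fst ?C)" "fst ` set ?C \<subseteq> S"
      using P fresh d e'(1) by (auto simp: path_def AB)
    moreover have "successively (\<lambda>d d'. dart_end G d = dart_start G d') ?C"
      using chA hd d by (cases A) (auto simp: v_def)
    ultimately have "simple_cycle G S ?C" using pu by (intro simple_cycleI) auto
    then show False using none by blast
  qed
qed

section \<open>Cycles as circulations, and the colors of circulations\<close>

definition dart_sign :: "bool \<Rightarrow> real" where
  "dart_sign d = (if d then 1 else -1)"

definition cycle_coeff :: "('e \<times> bool) list \<Rightarrow> 'e \<Rightarrow> real" where
  "cycle_coeff C e = (\<Sum>(e', d)\<leftarrow>C. if e' = e then dart_sign d else 0)"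

lemma cycle_coeff_simps [simp]:
  "cycle_coeff [] e = 0"
  "cycle_coeff ((e', d) # C) e = (if e' = e then dart_sign d else 0) + cycle_coeff C e"
  by (simp_all add: cycle_coeff_def)

lemma cycle_coeff_notin: "e \<notin> fst ` set C \<Longrightarrow> cycle_coeff C e = 0"
  by (induction C) (auto simp: cycle_coeff_def)

lemma sum_cycle_coeff:
  fixes w :: "'e \<Rightarrow> 'z::real_vector"
  assumes "finite F" "fst ` set C \<subseteq> F"
  shows "(\<Sum>e\<in>F. cycle_coeff C e *\<^sub>R w e) = (\<Sum>(e, d)\<leftarrow>C. dart_sign d *\<^sub>R w e)"
  using assms(2)
proof (induction C)
  case (Cons x C)
  obtain e d where x: "x = (e, d)" by fastforce
  have "(\<Sum>e'\<in>F. (if e = e' then dart_sign d else 0) *\<^sub>R w e') = (\<Sum>e'\<in>F. if e = e' then dart_sign d *\<^sub>R w e' else 0)"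
    by (intro sum.cong) auto
  then show ?case using Cons assms(1) by (simp add: x scaleR_add_left sum.distrib)
qed simp

lemma real_vec_cycle_rho: "real_vec (cycle_rho G C) = (\<Sum>(e, d)\<leftarrow>C. dart_sign d *\<^sub>R real_vec (color G e))"
  by (induction C) (auto simp: cycle_rho_def dart_sign_def)

text \<open>The ends of the darts are their starts in cyclically shifted order, so the two sums
  cancel.\<close>

lemma simple_cycle_boundary:
  fixes G :: "('v::finite, 'e) colored_graph"
  assumes "simple_cycle G F C"
  shows "(\<Sum>(e, d)\<leftarrow>C. dart_sign d *\<^sub>R boundary G e) = 0"
proof -
  let ?n = "length C"
  let ?s = "\<lambda>k. axis (dart_start G (C ! k)) (1::real) :: real^'v"
  obtain m where m: "?n = Suc m"
    using assms by (cases C) (auto simp: simple_cycle_def)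
  have eq: "dart_sign d *\<^sub>R boundary G e = axis (dart_end G (e, d)) 1 - axis (dart_start G (e, d)) 1" for e d
    by (simp add: dart_sign_def boundary_def)
  have "(\<Sum>(e, d)\<leftarrow>C. dart_sign d *\<^sub>R boundary G e)
      = (\<Sum>x\<leftarrow>C. axis (dart_end G x) 1 - axis (dart_start G x) 1)"
    by (intro arg_cong[of _ _ sum_list] map_cong) (auto simp only: eq split: prod.splits)
  also have "\<dots> = (\<Sum>k<?n. axis (dart_end G (C ! k)) 1 - ?s k)"
    by (simp add: sum_list_sum_nth atLeast0LessThan)
  also have "\<dots> = (\<Sum>k<?n. ?s (Suc k mod ?n)) - (\<Sum>k<?n. ?s k)"
    unfolding sum_subtractf using assms by (intro arg_cong2[of _ _ _ _ "(-)"] sum.cong) (auto simp: simple_cycle_def)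
  also have "(\<Sum>k<?n. ?s (Suc k mod ?n)) = (\<Sum>k<m. ?s (Suc k mod Suc m)) + ?s (Suc m mod Suc m)"
    unfolding m by simp
  also have "\<dots> = (\<Sum>k<m. ?s (Suc k)) + ?s 0" by simp
  also have "\<dots> = (\<Sum>k<?n. ?s k)" unfolding m by (simp only: sum.lessThan_Suc_shift add.commute)
  finally show ?thesis by simp
qed

text \<open>Subtracting a multiple of a cycle inside the support, chosen to cancel one of its edges,
  yields a circulation with smaller support; induction on the size of the support finishes.\<close>

lemma circulation_color_in_cycle_span:
  fixes G :: "('v::finite, 'e) colored_graph"
  assumes fin: "finite F" and "(\<Sum>e\<in>F. c e *\<^sub>R boundary G e) = 0"
  shows "(\<Sum>e\<in>F. c e *\<^sub>R real_vec (color G e)) \<in> span (real_vec ` cycle_rho G ` {C. simple_cycle G F C})"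
  using assms(2)
proof (induction "card {e\<in>F. c e \<noteq> 0}" arbitrary: c rule: less_induct)
  case less
  let ?S = "{e\<in>F. c e \<noteq> 0}"
  have finS: "finite ?S" using fin by simp
  show ?case
  proof (cases "?S = {}")
    case True
    then have "(\<Sum>e\<in>F. c e *\<^sub>R real_vec (color G e)) = 0" by (intro sum.neutral) auto
    then show ?thesis by (simp add: span_zero)
  next
    case False
    have "(\<Sum>e\<in>?S. c e *\<^sub>R boundary G e) = (\<Sum>e\<in>F. c e *\<^sub>R boundary G e)"
      using fin by (intro sum.mono_neutral_left) auto
    then obtain C where C: "simple_cycle G ?S C"
      using circulation_support_has_cycle[OF finS False, of c G] less.prems by auto
    then have CF: "simple_cycle G F C" by (auto simp: simple_cycle_def)
    obtain e d C' where Ceq: "C = (e, d) # C'"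
      using C by (cases C) (auto simp: simple_cycle_def)
    have CS: "fst ` set C \<subseteq> ?S" and dist: "distinct (map fst C)" using C by (auto simp: simple_cycle_def)
    have eS: "e \<in> ?S" using CS Ceq by auto
    have sg: "cycle_coeff C e = dart_sign d" "dart_sign d * dart_sign d = 1"
      using dist by (auto simp: Ceq cycle_coeff_notin dart_sign_def)
    \<comment> \<open>\<open>dart_sign d\<close> is its own inverse, so this \<open>k\<close> makes
      \<open>c'\<close> vanish at the first edge \<open>e\<close> of the cycle.\<close>
    define k where "k = c e * dart_sign d"
    define c' where "c' = (\<lambda>x. c x - k * cycle_coeff C x)"
    have "{x\<in>F. c' x \<noteq> 0} \<subset> ?S"
    proof
      show "{x\<in>F. c' x \<noteq> 0} \<subseteq> ?S"
      proof
        fix x assume x: "x \<in> {x\<in>F. c' x \<noteq> 0}"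
        show "x \<in> ?S"
        proof (rule ccontr)
          assume "x \<notin> ?S"
          then have "c x = 0" "x \<notin> fst ` set C" using x CS by auto
          then show False using x cycle_coeff_notin[of x C] by (simp add: c'_def)
        qed
      qed
      have "c' e = 0" using sg by (simp add: c'_def k_def mult.assoc)
      then show "{x\<in>F. c' x \<noteq> 0} \<noteq> ?S" using eS by blast
    qed
    then have card: "card {x\<in>F. c' x \<noteq> 0} < card ?S" using finS by (simp add: psubset_card_mono)
    have split: "(\<Sum>e\<in>F. c' e *\<^sub>R w e) = (\<Sum>e\<in>F. c e *\<^sub>R w e) - k *\<^sub>R (\<Sum>(e, d)\<leftarrow>C. dart_sign d *\<^sub>R w e)"
      for w :: "'e \<Rightarrow> 'z::real_vector"
    proof -
      have "(\<Sum>e\<in>F. cycle_coeff C e *\<^sub>R w e) = (\<Sum>(e, d)\<leftarrow>C. dart_sign d *\<^sub>R w e)"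
        using fin CS by (intro sum_cycle_coeff) auto
      then show ?thesis
        by (simp add: c'_def scaleR_diff_left sum_subtractf flip: scaleR_scaleR scaleR_sum_right)
    qed
    have "(\<Sum>e\<in>F. c' e *\<^sub>R boundary G e) = 0"
      using split[of "boundary G"] less.prems simple_cycle_boundary[OF CF] by simp
    from less.hyps[OF card this]
    have "(\<Sum>e\<in>F. c e *\<^sub>R real_vec (color G e)) - k *\<^sub>R real_vec (cycle_rho G C)
        \<in> span (real_vec ` cycle_rho G ` {C. simple_cycle G F C})"
      using split[of "\<lambda>e. real_vec (color G e)"] by (simp add: real_vec_cycle_rho)
    moreover have "k *\<^sub>R real_vec (cycle_rho G C) \<in> span (real_vec ` cycle_rho G ` {C. simple_cycle G F C})"
      using CF by (intro span_scale span_base) auto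
    ultimately show ?thesis using span_add by fastforce
  qed
qed

text \<open>Rank-nullity for the projection of the span to its boundary part. The image has
  dimension \<open>n' - c'\<close>; the kernel consists of the colors of circulations, which is the
  real span of the \<open>cycle_rho\<close> values.\<close>

theorem dim_incidence:
  fixes G :: "('v::finite, 'e) colored_graph"
  assumes fin: "finite F"
  shows "dim (incidence G ` F) + card (sub_components G F) = card (sub_vertices G F) + sub_rank G F"
proof -
  let ?U = "span (incidence G ` F)"
  let ?\<Gamma> = "real_vec ` cycle_rho G ` {C. simple_cycle G F C}"
  have "fst ` ?U = span (fst ` incidence G ` F)"
    by (simp add: linear_span_image linear_fst)
  moreover have "fst ` incidence G ` F = boundary G ` F"
    by (simp add: image_image incidence_def)
  ultimately have 1: "dim (fst ` ?U) = dim (boundary G ` F)" by simp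
  have "{x \<in> ?U. fst x = 0} = (\<lambda>g. (0, g)) ` span ?\<Gamma>"
  proof (intro set_eqI iffI)
    fix x assume x: "x \<in> {x \<in> ?U. fst x = 0}"
    then obtain c where c: "x = (\<Sum>e\<in>F. c e *\<^sub>R incidence G e)"
      using span_image_finite[OF fin] by blast
    have "fst x = (\<Sum>e\<in>F. c e *\<^sub>R boundary G e)" "snd x = (\<Sum>e\<in>F. c e *\<^sub>R real_vec (color G e))"
      by (simp_all add: c fst_sum snd_sum incidence_def)
    then have "snd x \<in> span ?\<Gamma>"
      using circulation_color_in_cycle_span[OF fin, of c G] x by simp
    then show "x \<in> (\<lambda>g. (0, g)) ` span ?\<Gamma>" using x by (auto simp: image_iff prod_eq_iff)
  next
    have lin: "linear (\<lambda>g::real^2. (0::real^'v, g))" by (rule linearI) auto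
    have sub: "(0, real_vec (cycle_rho G C)) \<in> ?U" if C: "simple_cycle G F C" for C
    proof -
      have CF: "fst ` set C \<subseteq> F" using C by (simp add: simple_cycle_def)
      have "(\<Sum>e\<in>F. cycle_coeff C e *\<^sub>R boundary G e) = 0"
        using sum_cycle_coeff[OF fin CF, of "boundary G"] simple_cycle_boundary[OF C] by simp
      then have "(0, real_vec (cycle_rho G C)) = (\<Sum>e\<in>F. cycle_coeff C e *\<^sub>R incidence G e)"
        using sum_cycle_coeff[OF fin CF, of "\<lambda>e. real_vec (color G e)"]
        by (simp add: prod_eq_iff fst_sum snd_sum incidence_def real_vec_cycle_rho)
      then show ?thesis using span_image_finite[OF fin] by blast
    qed
    have "(\<lambda>g. (0::real^'v, g)) ` span ?\<Gamma> = span ((\<lambda>g. (0, g)) ` ?\<Gamma>)"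
      by (simp add: linear_span_image[OF lin])
    also have "\<dots> \<subseteq> ?U" using sub by (intro span_minimal) auto
    finally have "(\<lambda>g. (0::real^'v, g)) ` span ?\<Gamma> \<subseteq> ?U" .
    then show "x \<in> {x \<in> ?U. fst x = 0}" if "x \<in> (\<lambda>g. (0, g)) ` span ?\<Gamma>" for x
      using that by auto
  qed
  moreover have "dim ((\<lambda>g. (0::real^'v, g)) ` span ?\<Gamma>) = dim ?\<Gamma>"
    by (subst dim_image_eq) (auto intro!: linearI inj_onI)
  ultimately have 2: "dim {x \<in> ?U. fst x = 0} = sub_rank G F"
    by (simp add: sub_rank_def subgroup_rank_eq_dim)
  have "dim (fst ` ?U) + dim {x \<in> ?U. fst x = 0} = dim ?U"
    by (intro dim_image_add_dim_kernel linear_fst subspace_span)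
  then show ?thesis using 1 2 dim_boundary[of G F] by simp
qed

lemma colored_laman_sparse_iff:
  fixes G :: "('v::finite, 'e) colored_graph"
  assumes "finite (edges G)"
  shows "colored_laman_sparse G \<longleftrightarrow>
    (\<forall>F\<subseteq>edges G. F \<noteq> {} \<longrightarrow> card F + 1 \<le> 2 * dim (incidence G ` F))"
  unfolding colored_laman_sparse_def
proof (intro all_cong imp_cong refl)
  fix F assume "F \<subseteq> edges G"
  then have "dim (incidence G ` F) + card (sub_components G F) = card (sub_vertices G F) + sub_rank G F"
    using assms finite_subset by (intro dim_incidence) blast
  then show "(int (card F) \<le> 2 * int (card (sub_vertices G F)) - 3 + 2 * int (sub_rank G F)
      - 2 * (int (card (sub_components G F)) - 1)) \<longleftrightarrow> card F + 1 \<le> 2 * dim (incidence G ` F)"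
    by presburger
qed

subsection \<open>Rows of the rigidity matrix\<close>

definition displacement :: "('v::finite, 'e) colored_graph \<Rightarrow> 'e \<Rightarrow> 'v coords \<Rightarrow> real^2" where
  "displacement G e x = fst x $ head G e + snd x *v real_vec (color G e) - fst x $ tail G e"

text \<open>The adjoint of \<open>displacement G e\<close>. Identifying \<open>\<real>\<^bsup>2n+4\<^esup>\<close> with \<open>\<real>\<^sup>2 \<otimes> \<real>\<^bsup>n+2\<^esup>\<close>,
  it is the map \<open>z \<mapsto> z \<otimes> incidence G e\<close>.\<close>

definition edge_tensor :: "('v::finite, 'e) colored_graph \<Rightarrow> 'e \<Rightarrow> real^2 \<Rightarrow> 'v coords" where
  "edge_tensor G e z = ((\<chi> i. boundary G e $ i *\<^sub>R z), (\<chi> k. z $ k *\<^sub>R real_vec (color G e)))"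

text \<open>The gradient at \<open>x\<close> of half the squared length of \<open>e\<close>.\<close>

definition rigidity_row :: "('v::finite, 'e) colored_graph \<Rightarrow> 'e \<Rightarrow> 'v coords \<Rightarrow> 'v coords" where
  "rigidity_row G e x = edge_tensor G e (displacement G e x)"

text \<open>Row \<open>k\<close> of \<open>x\<close> viewed as a matrix with two rows and
  \<open>n + 2\<close> columns; on the tensors of an edge it takes multiples of the incidence
  vector.\<close>

definition coord_part :: "2 \<Rightarrow> 'v::finite coords \<Rightarrow> (real^'v) \<times> (real^2)" where
  "coord_part k x = ((\<chi> i. fst x $ i $ k), snd x $ k)"

lemma linear_displacement: "linear (displacement G e)"
  by (rule linearI) (simp_all add: displacement_def matrix_vector_mult_add_rdistrib
      scaleR_matrix_vector_assoc[symmetric] algebra_simps)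

lemma linear_edge_tensor: "linear (edge_tensor G e)"
  by (rule linearI) (simp_all add: edge_tensor_def vec_eq_iff algebra_simps)

lemma linear_rigidity_row: "linear (rigidity_row G e)"
  using linear_compose[OF linear_displacement linear_edge_tensor]
  by (simp add: rigidity_row_def[abs_def] o_def)

lemma linear_coord_part: "linear (coord_part k)"
  by (rule linearI) (simp_all add: coord_part_def vec_eq_iff)

lemma coord_part_edge_tensor: "coord_part k (edge_tensor G e z) = z $ k *\<^sub>R incidence G e"
  by (simp add: coord_part_def edge_tensor_def incidence_def vec_eq_iff mult.commute)

lemma coord_part_eq_0: "coord_part 1 x = 0 \<Longrightarrow> coord_part 2 x = 0 \<Longrightarrow> x = 0"
  by (simp add: coord_part_def prod_eq_iff vec_eq_iff forall_2)

lemma inner_edge_tensor: "edge_tensor G e z \<bullet> y = z \<bullet> displacement G e y"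
proof -
  have "(\<chi> i. boundary G e $ i *\<^sub>R z) \<bullet> fst y = z \<bullet> (fst y $ head G e) - z \<bullet> (fst y $ tail G e)"
  proof -
    have "(\<chi> i. boundary G e $ i *\<^sub>R z) \<bullet> fst y
        = (\<Sum>i\<in>UNIV. (if i = head G e then z \<bullet> fst y $ i else 0) - (if i = tail G e then z \<bullet> fst y $ i else 0))"
      unfolding inner_vec_def[of _ "fst y"] by (intro sum.cong) (auto simp: boundary_def axis_def)
    then show ?thesis by (simp add: sum_subtractf)
  qed
  moreover have "(\<chi> k. z $ k *\<^sub>R real_vec (color G e)) \<bullet> snd y = z \<bullet> (snd y *v real_vec (color G e))"
    by (simp add: inner_vec_def matrix_vector_mult_def sum_distrib_left mult_ac)
  ultimately show ?thesis
    by (simp add: inner_prod_def edge_tensor_def displacement_def inner_add_right inner_diff_right)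
qed

lemma inner_rigidity_row: "rigidity_row G e x \<bullet> y = displacement G e x \<bullet> displacement G e y"
  by (simp add: rigidity_row_def inner_edge_tensor)

definition quarter_turn :: "real^2^2" where
  "quarter_turn = vector [vector [0, -1], vector [1, 0]]"

lemma quarter_turn_nth [simp]:
  "(quarter_turn *v z) $ 1 = - z $ 2" "(quarter_turn *v z) $ 2 = z $ 1"
  by (simp_all add: quarter_turn_def matrix_vector_mult_def sum_2)

lemma inner_2: "(z::real^2) \<bullet> w = z $ 1 * w $ 1 + z $ 2 * w $ 2"
  by (simp add: inner_vec_def sum_2)

lemma quarter_turn_inner [simp]:
  "z \<bullet> (quarter_turn *v z) = 0" "(quarter_turn *v z) \<bullet> z = 0"
  "(quarter_turn *v z) \<bullet> (quarter_turn *v w) = z \<bullet> w"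
  by (simp_all add: inner_2)

lemma displacement_euclidean_act:
  "displacement G e (euclidean_act Q t x) = Q *v displacement G e x"
  by (simp add: displacement_def euclidean_act_def matrix_vector_mul_assoc
      matrix_vector_mult_diff_distrib matrix_vector_right_distrib)

subsection \<open>Generic independence of the rows\<close>

text \<open>All rows at \<open>x\<close> annihilate the rotation \<open>Jx\<close>, which is not orthogonal to
  \<open>(J z) \<otimes> a\<close> for a row \<open>z \<otimes> a\<close>.\<close>

lemma rigidity_rows_count:
  fixes G :: "('v::finite, 'e) colored_graph"
  assumes ind: "indep_family F (\<lambda>e. rigidity_row G e x)" and "F \<noteq> {}"
  shows "card F + 1 \<le> 2 * dim (incidence G ` F)"
proof -
  let ?R = "(\<lambda>e. rigidity_row G e x) ` F"
  let ?A = "span (incidence G ` F)"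
  obtain f where f: "f \<in> F" using \<open>F \<noteq> {}\<close> by blast
  define d where "d = displacement G f x"
  \<comment> \<open>This tensor pairs with the infinitesimal rotation to
    \<open>d \<bullet> d\<close>, so it lies outside the span of the rows and supplies the
    \<open>+ 1\<close> of the count.\<close>
  define w where "w = edge_tensor G f (quarter_turn *v d)"
  \<comment> \<open>Splitting into the two coordinate rows embeds all tensors over \<open>F\<close>
    in \<open>?A \<times> ?A\<close>, whose dimension is the right-hand side.\<close>
  define h :: "'v coords \<Rightarrow> ((real^'v) \<times> (real^2)) \<times> ((real^'v) \<times> (real^2))"
    where "h = (\<lambda>y. (coord_part 1 y, coord_part 2 y))"
  let ?Jx = "euclidean_act quarter_turn 0 x"
  have "d \<noteq> 0"
  proof
    assume "d = 0"
    then have "rigidity_row G f x = 0" by (simp add: rigidity_row_def d_def linear_0[OF linear_edge_tensor])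
    moreover have "indep_family (insert f {}) (\<lambda>e. rigidity_row G e x)"
      using indep_family_subset[OF ind] f by simp
    ultimately show False using indep_family_not_in_span by fastforce
  qed
  then have "w \<bullet> ?Jx \<noteq> 0"
    by (simp add: w_def inner_edge_tensor displacement_euclidean_act d_def)
  moreover have "y \<bullet> ?Jx = 0" if "y \<in> span ?R" for y
    using that
  proof (induction rule: span_induct_alt)
    case (step c y z)
    then show ?case by (auto simp: inner_add_left inner_rigidity_row displacement_euclidean_act)
  qed simp
  ultimately have "w \<notin> span ?R" by blast
  then have "dim (insert w ?R) = card F + 1"
    using indep_family_dim[OF ind] by (simp add: dim_insert)
  moreover have lin: "linear h"
    by (rule linearI) (simp_all add: h_def linear_add[OF linear_coord_part] linear_scale[OF linear_coord_part])
  have "inj h"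
    unfolding linear_injective_0[OF lin]
  proof (intro allI impI)
    fix y assume "h y = 0"
    then have "coord_part 1 y = 0" "coord_part 2 y = 0" by (metis Pair_inject zero_prod_def h_def)+
    then show "y = 0" by (rule coord_part_eq_0)
  qed
  then have "dim (h ` insert w ?R) = dim (insert w ?R)"
    using lin by (intro dim_image_eq) (auto intro: inj_on_subset)
  moreover have "h (edge_tensor G e z) \<in> ?A \<times> ?A" if "e \<in> F" for e z
    using that by (auto simp: h_def coord_part_edge_tensor intro: span_scale span_base)
  then have "h w \<in> ?A \<times> ?A" "\<And>e. e \<in> F \<Longrightarrow> h (rigidity_row G e x) \<in> ?A \<times> ?A"
    using f by (simp_all only: rigidity_row_def w_def)
  then have "h ` insert w ?R \<subseteq> ?A \<times> ?A"
    unfolding image_insert image_image by (intro insert_subsetI image_subsetI)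
  then have "dim (h ` insert w ?R) \<le> dim (?A \<times> ?A)" by (rule dim_subset)
  moreover have "dim (?A \<times> ?A) = 2 * dim (incidence G ` F)"
    by (subst dim_Times) auto
  ultimately show ?thesis by simp
qed

text \<open>The \<open>+ 1\<close> in \<open>count\<close> pays for a second copy of
  \<open>e\<close>. Matroid union for the contraction by \<open>e\<close> in both matroids places
  one copy in each part without a new edge name.\<close>

lemma split_with_common_edge:
  fixes G :: "('v::finite, 'e) colored_graph"
  assumes fin: "finite F" and e: "e \<in> F"
    and count: "\<And>S. S \<subseteq> F \<Longrightarrow> S \<noteq> {} \<Longrightarrow> card S + 1 \<le> 2 * dim (incidence G ` S)"
  obtains A B where "A \<union> B = F - {e}" "A \<inter> B = {}"
    "indep_family (insert e A) (incidence G)" "indep_family (insert e B) (incidence G)"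
proof -
  define r where "r = (\<lambda>S. int (dim (incidence G ` S)))"
  have r: "matroid_rank r" unfolding r_def by (rule matroid_rank_dim)
  have "r {e} \<le> 1" using matroid_rank_le_card[OF r, of "{e}"] by simp
  moreover have "2 \<le> 2 * dim (incidence G ` {e})" using count[of "{e}"] e by simp
  ultimately have re: "r {e} = 1" by (simp add: r_def)
  have "int (card S) \<le> (r (S \<union> {e}) - r {e}) + (r (S \<union> {e}) - r {e})" if "S \<subseteq> F - {e}" for S
  proof -
    have "card (insert e S) = card S + 1" using that fin by (subst card_insert_disjoint) (auto intro: finite_subset)
    then have "card S + 2 \<le> 2 * dim (incidence G ` insert e S)"
      using count[of "insert e S"] that e by auto
    then show ?thesis using re by (simp add: r_def)
  qed
  from matroid_union[OF finite_Diff[OF fin, of "{e}"] matroid_rank_contract[OF r, of "{e}"]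
      matroid_rank_contract[OF r, of "{e}"] this]
  obtain A B where AB: "A \<union> B = F - {e}" "A \<inter> B = {}"
    "r (A \<union> {e}) - r {e} = int (card A)" "r (B \<union> {e}) - r {e} = int (card B)" by blast
  have AF: "A \<subseteq> F" "B \<subseteq> F" "e \<notin> A" "e \<notin> B" using AB(1) by auto
  have ind: "indep_family (insert e S) (incidence G)"
    if "r (S \<union> {e}) - r {e} = int (card S)" "S \<subseteq> F" "e \<notin> S" for S
  proof (rule indep_family_if_dim)
    have "finite S" using that fin finite_subset by blast
    then show "finite (insert e S)" "dim (incidence G ` insert e S) = card (insert e S)"
      using that re by (auto simp: r_def)
  qed
  show thesis using that[OF AB(1,2) ind[OF AB(3) AF(1,3)] ind[OF AB(4) AF(2,4)]] .
qed

text \<open>Expansion of the turned vector along \<open>d\<close>, to which it is parallel in the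
  plane, cleared of the denominator \<open>d \<bullet> d\<close>.\<close>

lemma quarter_turn_orthogonal:
  assumes "(z::real^2) \<bullet> d = 0"
  shows "(d \<bullet> d) *\<^sub>R (quarter_turn *v z) = (- (z \<bullet> (quarter_turn *v d))) *\<^sub>R d"
proof -
  have "z $ 1 * d $ 1 = - (z $ 2 * d $ 2)" using assms by (simp add: inner_2)
  then have "z $ 1 * d $ 1 * d $ 1 = - (z $ 2 * d $ 2 * d $ 1)" "z $ 1 * d $ 1 * d $ 2 = - (z $ 2 * d $ 2 * d $ 2)"
    by auto
  then show ?thesis by (simp add: vec_eq_iff forall_2 inner_2 algebra_simps)
qed

text \<open>For generic prescribed directions \<open>d\<close>, matroid union with any one edge doubled shows that
  some placement with edges perpendicular to \<open>d\<close> collapses no edge; turned by a right angle, it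
  has the rows \<open>d f \<otimes> a\<^sub>f\<close> up to nonzero factors.\<close>

lemma exists_indep_rigidity_rows:
  fixes G :: "('v::finite, 'e) colored_graph"
  assumes fin: "finite F"
    and count: "\<And>S. S \<subseteq> F \<Longrightarrow> S \<noteq> {} \<Longrightarrow> card S + 1 \<le> 2 * dim (incidence G ` S)"
  shows "\<exists>x. indep_family F (\<lambda>e. rigidity_row G e x)"
proof (cases "F = {}")
  case False
  \<comment> \<open>The index \<open>None\<close> is the second copy of \<open>e\<close>, whose
    direction is that of \<open>e\<close> turned by a right angle.\<close>
  define v where "v = (\<lambda>e i. case i of None \<Rightarrow> (\<lambda>z. edge_tensor G e (quarter_turn *v z)) | Some f \<Rightarrow> edge_tensor G f)"
  define k where "k = (\<lambda>(e::'e) i. case i of None \<Rightarrow> e | Some f \<Rightarrow> f)"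
  let ?I = "insert None (Some ` F)"
  let ?C = "\<lambda>e (d :: 'e \<Rightarrow> real^2). indep_family ?I (\<lambda>i. v e i (d (k e i)))"
  have lin: "linear (v e i)" for e i
    using linear_compose[OF matrix_vector_mul_linear[of quarter_turn] linear_edge_tensor, of G e]
    by (cases i) (auto simp: v_def linear_edge_tensor o_def)
  have "generic_cond (?C e)" for e using lin by (intro generic_cond_indep_family)
  moreover have "\<exists>d. ?C e d" if e: "e \<in> F" for e
  proof -
    obtain A B where AB: "A \<union> B = F - {e}" "A \<inter> B = {}"
      and A: "indep_family (insert e A) (incidence G)" and B: "indep_family (insert e B) (incidence G)"
      using split_with_common_edge[OF fin e count] by blast
    have eAB: "e \<notin> A" "e \<notin> B" "insert e A \<subseteq> F" "B \<subseteq> F" using AB e by auto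
    \<comment> \<open>Horizontal directions on \<open>insert e A\<close> and vertical ones
      elsewhere; the copy \<open>None\<close> then is vertical. The two coordinates of a relation
      separate into relations on \<open>insert e A\<close> and on \<open>insert e B\<close>, where
      the second copy takes the place of \<open>e\<close>.\<close>
    define d :: "'e \<Rightarrow> real^2" where "d = (\<lambda>f. if f \<in> insert e A then axis 1 1 else axis 2 1)"
    have "?C e d"
    proof (rule indep_familyI)
      fix c i assume "(\<Sum>i\<in>?I. c i *\<^sub>R v e i (d (k e i))) = 0" and i: "i \<in> ?I"
      moreover have "quarter_turn *v axis 1 1 = axis 2 1"
        by (simp add: vec_eq_iff forall_2 axis_def)
      ultimately have eq: "c None *\<^sub>R edge_tensor G e (axis 2 1) + (\<Sum>f\<in>F. c (Some f) *\<^sub>R edge_tensor G f (d f)) = 0"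
        using fin by (simp add: sum.reindex v_def k_def d_def)
      have eqk: "(c None * axis 2 1 $ l) *\<^sub>R incidence G e + (\<Sum>f\<in>F. (c (Some f) * d f $ l) *\<^sub>R incidence G f) = 0" for l
        using arg_cong[OF eq, of "coord_part l"]
        by (simp add: linear_add[OF linear_coord_part] linear_sum[OF linear_coord_part]
            linear_scale[OF linear_coord_part] linear_0[OF linear_coord_part] coord_part_edge_tensor)
      have "(\<Sum>f\<in>F. (c (Some f) * d f $ 1) *\<^sub>R incidence G f) = (\<Sum>f\<in>insert e A. c (Some f) *\<^sub>R incidence G f)"
        using fin eAB by (intro sum.mono_neutral_cong_right) (auto simp: d_def axis_def)
      then have "(\<Sum>f\<in>insert e A. c (Some f) *\<^sub>R incidence G f) = 0"
        using eqk[of 1] by (simp add: axis_def)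
      then have cA: "c (Some f) = 0" if "f \<in> insert e A" for f
        using indep_familyD[OF A, of "\<lambda>f. c (Some f)"] that by blast
      have "(\<Sum>f\<in>F. (c (Some f) * d f $ 2) *\<^sub>R incidence G f) = (\<Sum>f\<in>B. c (Some f) *\<^sub>R incidence G f)"
        using fin eAB AB by (intro sum.mono_neutral_cong_right) (auto simp: d_def axis_def)
      also have "\<dots> = (\<Sum>f\<in>B. (if f = e then c None else c (Some f)) *\<^sub>R incidence G f)"
        using eAB by (intro sum.cong) auto
      finally have "(\<Sum>f\<in>insert e B. (if f = e then c None else c (Some f)) *\<^sub>R incidence G f) = 0"
        using eqk[of 2] eAB finite_subset[OF eAB(4) fin] by (simp add: axis_def)
      then have cB: "(if f = e then c None else c (Some f)) = 0" if "f \<in> insert e B" for f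
        using indep_familyD[OF B, of "\<lambda>f. if f = e then c None else c (Some f)"] that by blast
      show "c i = 0"
      proof (cases i)
        case None
        then show ?thesis using cB[of e] by simp
      next
        case (Some f)
        then have "f \<in> insert e A \<or> f \<in> B" using i AB(1) by auto
        then show ?thesis using cA[of f] cB[of f] eAB Some by (auto split: if_splits)
      qed
    qed (use fin in simp)
    then show ?thesis by blast
  qed
  ultimately obtain d where d: "\<And>e. e \<in> F \<Longrightarrow> ?C e d"
    using generic_cond_simultaneous[OF fin, of ?C] by blast
  have "\<exists>y. (\<forall>f\<in>F. y \<bullet> edge_tensor G f (d f) = 0) \<and> y \<bullet> edge_tensor G e (quarter_turn *v d e) \<noteq> 0"
    if "e \<in> F" for e
  proof -
    show ?thesis
    proof (rule indep_family_dual[OF d[OF that]])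
      fix y assume y: "\<And>j. j \<in> Some ` F \<Longrightarrow> y \<bullet> v e j (d (k e j)) = 0"
        "y \<bullet> v e None (d (k e None)) \<noteq> 0"
      have "y \<bullet> edge_tensor G f (d f) = 0" if "f \<in> F" for f
        using y(1)[of "Some f"] that by (simp add: v_def k_def)
      then show ?thesis using y(2) by (intro exI[of _ y]) (simp add: v_def k_def)
    qed auto
  qed
  \<comment> \<open>Dual to the copy \<open>None\<close>: in \<open>y e\<close> every edge is
    perpendicular to its vector \<open>d f\<close>, and \<open>e\<close> does not collapse.\<close>
  then obtain y where y: "\<And>e f. e \<in> F \<Longrightarrow> f \<in> F \<Longrightarrow> y e \<bullet> edge_tensor G f (d f) = 0"
    and ynz: "\<And>e. e \<in> F \<Longrightarrow> y e \<bullet> edge_tensor G e (quarter_turn *v d e) \<noteq> 0" by metis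
  let ?w = "\<lambda>e. edge_tensor G e (quarter_turn *v d e)"
  have linear_root: "t = - a / b" if "a \<noteq> 0" "a + t * b = 0" for a b t :: real
    using that by (cases "b = 0") (auto simp: field_simps add_eq_0_iff)
  \<comment> \<open>\<open>y e\<close> is known to be good for \<open>e\<close> only, so the
    placements are combined. For each edge the tested quantity is affine along a line of
    coefficients \<open>s\<close>, hence has at most one root where it does not start at
    \<open>0\<close>.\<close>
  have "\<exists>s. \<forall>e\<in>F. (\<Sum>f\<in>F. s f *\<^sub>R y f) \<bullet> ?w e \<noteq> 0"
  proof (rule generic_cond_simultaneous[OF fin])
    fix e assume e: "e \<in> F"
    show "generic_cond (\<lambda>s. (\<Sum>f\<in>F. s f *\<^sub>R y f) \<bullet> ?w e \<noteq> 0)"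
      unfolding generic_cond_def
    proof (intro allI impI)
      fix s s' :: "'e \<Rightarrow> real"
      let ?a = "(\<Sum>f\<in>F. s f *\<^sub>R y f) \<bullet> ?w e" and ?b = "(\<Sum>f\<in>F. (s' f - s f) *\<^sub>R y f) \<bullet> ?w e"
      assume "?a \<noteq> 0"
      moreover have "(\<Sum>f\<in>F. (s f + t *\<^sub>R (s' f - s f)) *\<^sub>R y f) \<bullet> ?w e = ?a + t * ?b" for t
        by (simp add: scaleR_add_left sum.distrib inner_add_left inner_sum_left sum_distrib_left mult.assoc)
      ultimately have "{t. \<not> (\<Sum>f\<in>F. (s f + t *\<^sub>R (s' f - s f)) *\<^sub>R y f) \<bullet> ?w e \<noteq> 0} \<subseteq> {- ?a / ?b}"
        using linear_root by auto
      then show "finite {t. \<not> (\<Sum>f\<in>F. (s f + t *\<^sub>R (s' f - s f)) *\<^sub>R y f) \<bullet> ?w e \<noteq> 0}"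
        using finite_subset by blast
    qed
    have "(\<Sum>f\<in>F. (if f = e then 1 else 0) *\<^sub>R y f) = (\<Sum>f\<in>F. if f = e then y f else 0)"
      by (intro sum.cong) auto
    then have "(\<Sum>f\<in>F. (if f = e then 1 else 0) *\<^sub>R y f) = y e" using e fin by simp
    then show "\<exists>s. (\<Sum>f\<in>F. s f *\<^sub>R y f) \<bullet> ?w e \<noteq> 0"
      using ynz[OF e] by (intro exI[of _ "\<lambda>f. if f = e then 1 else 0"]) simp
  qed
  then obtain s where s: "\<And>e. e \<in> F \<Longrightarrow> (\<Sum>f\<in>F. s f *\<^sub>R y f) \<bullet> ?w e \<noteq> 0" by blast
  define z where "z = (\<Sum>f\<in>F. s f *\<^sub>R y f)"
  define u where "u = (\<lambda>f. displacement G f z)"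
  have perp: "u f \<bullet> d f = 0" if "f \<in> F" for f
  proof -
    have "z \<bullet> edge_tensor G f (d f) = 0" using y that by (simp add: z_def inner_sum_left)
    then show ?thesis by (metis inner_commute inner_edge_tensor u_def)
  qed
  have nz: "u f \<bullet> (quarter_turn *v d f) \<noteq> 0" if "f \<in> F" for f
    using s[OF that] unfolding z_def[symmetric] u_def by (metis inner_commute inner_edge_tensor)
  define q where "q = (\<lambda>f. - (u f \<bullet> (quarter_turn *v d f)) / (d f \<bullet> d f))"
  have turn: "quarter_turn *v u f = q f *\<^sub>R d f" and qnz: "q f \<noteq> 0" if "f \<in> F" for f
  proof -
    have "d f \<noteq> 0" using nz[OF that] by auto
    then have dd: "d f \<bullet> d f \<noteq> 0" by simp
    have "(1 / (d f \<bullet> d f)) *\<^sub>R (d f \<bullet> d f) *\<^sub>R (quarter_turn *v u f) = (1 / (d f \<bullet> d f)) *\<^sub>R (- (u f \<bullet> (quarter_turn *v d f))) *\<^sub>R d f"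
      using quarter_turn_orthogonal[OF perp[OF that]] by simp
    then show "quarter_turn *v u f = q f *\<^sub>R d f" using dd by (simp add: q_def)
    show "q f \<noteq> 0" using nz[OF that] dd by (simp add: q_def)
  qed
  let ?x = "euclidean_act quarter_turn 0 z"
  have row: "rigidity_row G f ?x = q f *\<^sub>R edge_tensor G f (d f)" if "f \<in> F" for f
    using turn[OF that] by (simp add: rigidity_row_def displacement_euclidean_act u_def
        linear_scale[OF linear_edge_tensor])
  obtain e where "e \<in> F" using False by blast
  have ind: "indep_family (Some ` F) (\<lambda>i. v e i (d (k e i)))"
    using indep_family_subset[OF d[OF \<open>e \<in> F\<close>]] by blast
  have "indep_family F (\<lambda>f. edge_tensor G f (d f))"
  proof (rule indep_familyI[OF fin])
    fix c f assume "(\<Sum>f\<in>F. c f *\<^sub>R edge_tensor G f (d f)) = 0" "f \<in> F"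
    then show "c f = 0"
      using indep_familyD[OF ind, of "\<lambda>i. c (the i)" "Some f"] by (simp add: sum.reindex v_def k_def)
  qed
  from indep_family_scale[OF this qnz] have "indep_family F (\<lambda>f. q f *\<^sub>R edge_tensor G f (d f))" .
  then have "indep_family F (\<lambda>f. rigidity_row G f ?x)"
    using indep_family_cong[of F "\<lambda>f. rigidity_row G f ?x" "\<lambda>f. q f *\<^sub>R edge_tensor G f (d f)"] row by blast
  then show ?thesis by blast
qed simp

subsection \<open>Congruences\<close>

definition translation :: "real^2 \<Rightarrow> 'v::finite coords" where
  "translation t = ((\<chi> i. t), 0)"

abbreviation turn :: "'v::finite coords \<Rightarrow> 'v coords" where
  "turn \<equiv> euclidean_act quarter_turn 0"

definition rotation_mat :: "real \<Rightarrow> real \<Rightarrow> real^2^2" where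
  "rotation_mat c s = vector [vector [c, - s], vector [s, c]]"

lemma euclidean_act_translation: "euclidean_act Q t x = euclidean_act Q 0 x + translation t"
  by (simp add: euclidean_act_def translation_def vec_eq_iff)

lemma linear_euclidean_act: "linear (euclidean_act Q 0)"
  by (rule linearI) (simp_all add: euclidean_act_def vec_eq_iff matrix_vector_right_distrib
      matrix_add_ldistrib matrix_vector_mult_scaleR matrix_matrix_mult_def sum_distrib_left distrib_left sum.distrib mult_ac)

lemma linear_translation: "linear translation"
  by (rule linearI) (simp_all add: translation_def vec_eq_iff)

lemma euclidean_act_of_translation: "euclidean_act Q 0 (translation t) = translation (Q *v t)"
  by (simp add: euclidean_act_def translation_def)

lemma euclidean_act_compose:
  "euclidean_act P s (euclidean_act Q t x) = euclidean_act (P ** Q) (P *v t + s) x"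
  by (simp add: euclidean_act_def matrix_mul_assoc matrix_vector_mul_assoc matrix_vector_right_distrib
      add.assoc)

lemma euclidean_act_id: "euclidean_act (mat 1) 0 x = x"
  by (simp add: euclidean_act_def)

lemma orthogonal_matrix_transpose_iff: "orthogonal_matrix (transpose Q) \<longleftrightarrow> orthogonal_matrix Q"
  by (auto simp: orthogonal_matrix_def)

lemma euclidean_act_inverse:
  fixes Q :: "real^2^2"
  assumes "orthogonal_matrix Q"
  shows "euclidean_act (transpose Q) (- (transpose Q *v t)) (euclidean_act Q t x) = x"
  using assms by (simp add: euclidean_act_compose orthogonal_matrix_def euclidean_act_id)

lemma congruence_class_sym:
  assumes "y \<in> congruence_class x" shows "x \<in> congruence_class y"
proof -
  obtain Q t where Q: "orthogonal_matrix Q" "y = euclidean_act Q t x"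
    using assms by (auto simp: congruence_class_def)
  then have "x = euclidean_act (transpose Q) (- (transpose Q *v t)) y"
    by (simp only: euclidean_act_inverse)
  moreover have "orthogonal_matrix (transpose Q)" using Q(1) by (simp only: orthogonal_matrix_transpose_iff)
  ultimately show ?thesis unfolding congruence_class_def by blast
qed

lemma congruence_class_trans:
  assumes "y \<in> congruence_class x" "z \<in> congruence_class y" shows "z \<in> congruence_class x"
proof -
  obtain P s Q t where "orthogonal_matrix P" "z = euclidean_act P s y"
    and "orthogonal_matrix Q" "y = euclidean_act Q t x"
    using assms by (auto simp: congruence_class_def)
  then have "z = euclidean_act (P ** Q) (P *v t + s) x" "orthogonal_matrix (P ** Q)"
    by (auto simp: euclidean_act_compose intro: orthogonal_matrix_mul)
  then show ?thesis unfolding congruence_class_def by blast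
qed

lemma congruence_class_refl: "x \<in> congruence_class x"
  unfolding congruence_class_def
  by (intro CollectI exI[of _ "mat 1"] exI[of _ 0]) (simp add: euclidean_act_id orthogonal_matrix_id)

lemma congruence_class_eq_iff: "congruence_class y = congruence_class x \<longleftrightarrow> y \<in> congruence_class x"
  using congruence_class_refl congruence_class_sym congruence_class_trans by blast

lemma norm_orthogonal_matrix:
  fixes Q :: "real^'n^'n"
  assumes "orthogonal_matrix Q" shows "norm (Q *v z) = norm z"
proof -
  have "orthogonal_transformation ((*v) Q)"
    using assms by (simp add: orthogonal_transformation_matrix)
  then show ?thesis by (simp add: orthogonal_transformation)
qed

lemma norm_displacement_congruent:
  assumes "y \<in> congruence_class x"
  shows "norm (displacement G e y) = norm (displacement G e x)"
  using assms by (auto simp: congruence_class_def displacement_euclidean_act norm_orthogonal_matrix)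

section \<open>Rotations, centering and alignment\<close>

lemma inner_coords:
  "(x :: 'v::finite coords) \<bullet> y = (\<Sum>i\<in>UNIV. fst x $ i \<bullet> fst y $ i) + snd x $ 1 \<bullet> snd y $ 1 + snd x $ 2 \<bullet> snd y $ 2"
  by (simp add: inner_prod_def inner_vec_def[of "fst x"] inner_vec_def[of "snd x"] sum_2)

lemma fst_turn: "fst (turn x) $ i = quarter_turn *v (fst x $ i)"
  by (simp add: euclidean_act_def)

lemma snd_turn: "snd (turn x) $ 1 = - snd x $ 2" "snd (turn x) $ 2 = snd x $ 1"
  by (simp_all add: euclidean_act_def quarter_turn_def matrix_matrix_mult_def sum_2 vec_eq_iff)

lemma inner_turn_left: "turn x \<bullet> y = - (x \<bullet> turn y)"
proof -
  have "(quarter_turn *v z) \<bullet> w = - (z \<bullet> (quarter_turn *v w))" for z w by (simp add: inner_2)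
  then show ?thesis
    by (simp add: inner_coords fst_turn snd_turn sum_negf)
qed

lemma turn_turn: "turn (turn x) = - x"
  by (simp add: prod_eq_iff vec_eq_iff[of "fst _"] vec_eq_iff[of "snd _"] forall_2 fst_turn snd_turn)
    (simp add: vec_eq_iff forall_2)

lemma inner_turn_turn: "turn x \<bullet> turn y = x \<bullet> y"
  by (simp add: inner_turn_left turn_turn)

lemma inner_turn_self [simp]: "x \<bullet> turn x = 0" "turn x \<bullet> x = 0"
  using inner_turn_left[of x x] by (simp_all add: inner_commute)

lemma rotation_mat_orthogonal:
  assumes "c\<^sup>2 + s\<^sup>2 = 1" shows "orthogonal_matrix (rotation_mat c s)"
  using assms unfolding orthogonal_matrix rotation_mat_def
  by (simp add: vec_eq_iff forall_2 matrix_matrix_mult_def transpose_def sum_2 mat_def power2_eq_square)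

lemma euclidean_act_rotation: "euclidean_act (rotation_mat c s) 0 x = c *\<^sub>R x + s *\<^sub>R turn x"
  by (simp add: prod_eq_iff euclidean_act_def vec_eq_iff forall_2 rotation_mat_def quarter_turn_def
      matrix_matrix_mult_def matrix_vector_mult_def sum_2)

lemma orthogonal_matrix_2_det_1:
  fixes Q :: "real^2^2"
  assumes "orthogonal_matrix Q" "det Q = 1"
  obtains c s where "Q = rotation_mat c s" "c\<^sup>2 + s\<^sup>2 = 1"
proof -
  have QQ: "transpose Q ** Q = mat 1" using assms(1) by (simp add: orthogonal_matrix)
  have "(transpose Q ** Q) $ 1 $ 1 = 1" "(transpose Q ** Q) $ 2 $ 2 = 1"
    unfolding QQ by (simp_all add: mat_def)
  then have 1: "Q$1$1 * Q$1$1 + Q$2$1 * Q$2$1 = 1" "Q$1$2 * Q$1$2 + Q$2$2 * Q$2$2 = 1"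
    by (simp_all add: matrix_matrix_mult_def transpose_def sum_2)
  have 2: "Q$1$1 * Q$2$2 - Q$1$2 * Q$2$1 = 1" using assms(2) by (simp add: det_2)
  \<comment> \<open>The sum of the squared column norms minus twice the determinant.\<close>
  have "(Q$1$1 - Q$2$2)\<^sup>2 + (Q$1$2 + Q$2$1)\<^sup>2 = 0"
    using 1 2 by (simp add: power2_eq_square algebra_simps)
  then have "Q$1$1 = Q$2$2" "Q$1$2 = - Q$2$1" by (auto simp: sum_power2_eq_zero_iff)
  then have "Q = rotation_mat (Q$1$1) (Q$2$1)"
    by (simp add: rotation_mat_def vec_eq_iff forall_2)
  then show thesis using that 1(1) by (simp add: power2_eq_square)
qed

text \<open>The orthogonal projection along the translations: the barycenter of the representatives
  moves to the origin, while \<open>L\<close> stays.\<close>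

definition centered :: "'v::finite coords \<Rightarrow> 'v coords" where
  "centered x = x - translation ((1 / real CARD('v)) *\<^sub>R (\<Sum>i\<in>UNIV. fst x $ i))"

lemma inner_translation: "x \<bullet> translation t = (\<Sum>i\<in>UNIV. fst x $ i) \<bullet> t"
  by (simp add: inner_coords translation_def inner_sum_left)

lemma inner_centered_translation: "centered x \<bullet> translation t = 0"
  unfolding inner_translation
  by (simp add: centered_def translation_def sum_subtractf sum_constant_scaleR inner_diff_left del: sum_constant)

lemma decompose_centered: "\<exists>m. x = centered x + translation m"
  by (auto simp: centered_def)

lemma inner_turn_centered_translation: "turn (centered x) \<bullet> translation t = 0"
  by (simp add: inner_turn_left euclidean_act_of_translation inner_centered_translation)

lemma snd_centered: "snd (centered x) = snd x"
  by (simp add: centered_def translation_def)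

lemma turn_decompose: "x = x' + translation m \<Longrightarrow> turn x = turn x' + translation (quarter_turn *v m)"
  by (simp add: linear_add[OF linear_euclidean_act] euclidean_act_of_translation)

text \<open>Moving \<open>y\<close> by the congruence that brings it closest to \<open>x\<close>.\<close>

lemma exists_aligning_congruence:
  fixes x y :: "'v::finite coords"
  obtains y' where "y' \<in> congruence_class y" "norm (y' - x) \<le> norm (y - x)"
    "\<And>t. (y' - x) \<bullet> translation t = 0" "(y' - x) \<bullet> turn x = 0"
proof -
  define a where "a = centered x"
  define b where "b = centered y"
  obtain m where m: "x = a + translation m" using decompose_centered a_def by blast
  obtain l where l: "y = b + translation l" using decompose_centered b_def by blast
  have orth: "a \<bullet> translation t = 0" "b \<bullet> translation t = 0" "turn a \<bullet> translation t = 0"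
    "turn b \<bullet> translation t = 0" for t
    by (simp_all add: a_def b_def inner_centered_translation inner_turn_centered_translation)
  \<comment> \<open>A rotation of \<open>b\<close> by \<open>(c, s)\<close> has inner product
    \<open>c * q - s * p\<close> with \<open>a\<close>. Over the unit circle its maximum
    \<open>r\<close> is attained at \<open>(q, - p) / r\<close>; for \<open>r = 0\<close> the
    product is always \<open>0\<close> and the identity serves.\<close>
  define p where "p = b \<bullet> turn a"
  define q where "q = b \<bullet> a"
  define r where "r = sqrt (p\<^sup>2 + q\<^sup>2)"
  define c where "c = (if r = 0 then 1 else q / r)"
  define s where "s = (if r = 0 then 0 else - p / r)"
  have r2: "r * r = p * p + q * q" by (simp add: r_def power2_eq_square)
  have r0: "p = 0 \<and> q = 0" if "r = 0" using that by (simp add: r_def sum_power2_eq_zero_iff)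
  have cs: "c\<^sup>2 + s\<^sup>2 = 1"
  proof (cases "r = 0")
    case False
    then have "c\<^sup>2 + s\<^sup>2 = (p * p + q * q) / (r * r)"
      by (simp add: c_def s_def power2_eq_square add_divide_distrib)
    then show ?thesis using False by (simp flip: r2)
  qed (simp add: c_def s_def)
  have r_ge: "q \<le> r" unfolding r_def by (rule real_le_rsqrt) simp
  have cr: "c * q - s * p = r"
  proof (cases "r = 0")
    case False
    then have "c * q - s * p = (p * p + q * q) / r" by (simp add: c_def s_def add_divide_distrib)
    then show ?thesis using False by (simp flip: r2)
  qed (use r0 in \<open>simp add: c_def s_def\<close>)
  \<comment> \<open>The derivative along rotations vanishes at the maximum; this becomes
    orthogonality to \<open>turn a\<close>.\<close>
  have csz: "c * p + s * q = 0" using r0 by (auto simp: c_def s_def)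
  define w where "w = c *\<^sub>R b + s *\<^sub>R turn b"
  define y' where "y' = w + translation m"
  have wt: "w \<bullet> translation t = 0" for t using orth by (simp add: w_def inner_add_left)
  have u: "y' - x = w - a" by (simp add: y'_def m)
  have ba: "turn b \<bullet> a = - p" by (simp add: inner_turn_left p_def)
  have "b = euclidean_act (mat 1) (- l) y"
    by (simp add: l euclidean_act_translation[of _ "- l"] euclidean_act_id linear_neg[OF linear_translation])
  then have b_y: "b \<in> congruence_class y" using orthogonal_matrix_id by (auto simp: congruence_class_def)
  have "y' = euclidean_act (rotation_mat c s) m b"
    unfolding y'_def w_def euclidean_act_translation[of _ m] euclidean_act_rotation ..
  then have "y' \<in> congruence_class b"
    using rotation_mat_orthogonal[OF cs] by (auto simp: congruence_class_def)
  with b_y have 1: "y' \<in> congruence_class y" by (rule congruence_class_trans)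
  have ww: "w \<bullet> w = b \<bullet> b"
  proof -
    have "w \<bullet> w = (c\<^sup>2 + s\<^sup>2) * (b \<bullet> b)"
      by (simp add: w_def inner_add_left inner_add_right inner_turn_turn power2_eq_square algebra_simps)
    then show ?thesis by (simp add: cs)
  qed
  have wa: "w \<bullet> a = r" using cr by (simp add: w_def inner_add_left q_def[symmetric] ba)
  have "(w - a) \<bullet> (w - a) \<le> (b - a) \<bullet> (b - a)"
    using r_ge wa ww q_def by (simp add: inner_diff_left inner_diff_right inner_commute)
  \<comment> \<open>Centering is an orthogonal projection, so it does not lengthen the
    difference.\<close>
  also have "\<dots> \<le> (y - x) \<bullet> (y - x)"
  proof -
    have yx: "y - x = (b - a) + translation (l - m)"
      by (simp add: m l linear_diff[OF linear_translation])
    have "(b - a) \<bullet> translation (l - m) = 0" using orth by (simp add: inner_diff_left)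
    then have "(y - x) \<bullet> (y - x) = (b - a) \<bullet> (b - a) + (translation (l - m) :: 'v coords) \<bullet> translation (l - m)"
      unfolding yx by (simp add: inner_add_left inner_add_right inner_commute[of "translation _" "_ - _"])
    then show ?thesis by simp
  qed
  finally have 2: "norm (y' - x) \<le> norm (y - x)" unfolding u by (simp add: norm_le)
  have 3: "(y' - x) \<bullet> translation t = 0" for t unfolding u using wt orth by (simp add: inner_diff_left)
  have "(w - a) \<bullet> turn a = 0"
    using csz by (simp add: inner_diff_left w_def inner_add_left inner_turn_turn p_def[symmetric] q_def[symmetric])
  then have 4: "(y' - x) \<bullet> turn x = 0"
    using 3 unfolding turn_decompose[OF m] u by (simp add: inner_add_right)
  show thesis using that[OF 1 2 3 4] .
qed

text \<open>These span the tangent space at \<open>x\<close> of its orbit under congruences: the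
  infinitesimal rotation and the two coordinate translations.\<close>

definition trivial_motions :: "'v::finite coords \<Rightarrow> 'v coords set" where
  "trivial_motions x = {turn x, translation (axis 1 1), translation (axis 2 1)}"

lemma orthogonal_trivial_motions_iff:
  "(\<forall>\<tau>\<in>trivial_motions x. u \<bullet> \<tau> = 0) \<longleftrightarrow> (\<forall>t. u \<bullet> translation t = 0) \<and> u \<bullet> turn x = 0"
proof -
  have eq: "translation t = t $ 1 *\<^sub>R translation (axis 1 1) + t $ 2 *\<^sub>R translation (axis 2 1)" for t
    by (simp add: translation_def vec_eq_iff forall_2 axis_def)
  have expand: "u \<bullet> translation t = t $ 1 * (u \<bullet> translation (axis 1 1)) + t $ 2 * (u \<bullet> translation (axis 2 1))" for t
    using arg_cong[OF eq[of t], of "(\<bullet>) u"] by (simp add: inner_add_right)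
  show ?thesis
  proof
    assume h: "\<forall>\<tau>\<in>trivial_motions x. u \<bullet> \<tau> = 0"
    have "u \<bullet> translation t = 0" for t
      unfolding expand[of t] using h by (simp add: trivial_motions_def)
    moreover have "u \<bullet> turn x = 0" using h by (simp add: trivial_motions_def)
    ultimately show "(\<forall>t. u \<bullet> translation t = 0) \<and> u \<bullet> turn x = 0" by blast
  qed (auto simp: trivial_motions_def)
qed

text \<open>Translations have lattice part \<open>0\<close>, whereas \<open>turn\<close> acts
  injectively on the lattice part of \<open>x\<close>.\<close>

lemma dim_trivial_motions:
  fixes x :: "'v::finite coords"
  assumes "snd x \<noteq> 0" shows "dim (trivial_motions x) = 3"
proof -
  let ?a = "translation (axis 1 1) :: 'v coords" and ?b = "translation (axis 2 1) :: 'v coords"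
  have "?b \<noteq> 0" by (simp add: translation_def prod_eq_iff vec_eq_iff axis_def exI[of _ 2])
  then have 1: "dim {?b} = 1" by (simp add: dim_singleton)
  have "?a \<notin> span {?b}"
  proof
    assume "?a \<in> span {?b}"
    then obtain k where "?a = k *\<^sub>R ?b" by (auto simp: span_singleton)
    from arg_cong[OF this, of "\<lambda>z. fst z $ undefined $ 1"] show False
      by (simp add: translation_def axis_def)
  qed
  then have 2: "dim {?a, ?b} = 2" using 1 by (simp add: dim_insert)
  have "turn x \<notin> span {?a, ?b}"
  proof
    assume "turn x \<in> span {?a, ?b}"
    then have "snd (turn x) = 0"
    proof (induction rule: span_induct_alt)
      case (step c y z)
      then show ?case by (auto simp: translation_def)
    qed simp
    then have "snd x = 0" using snd_turn[of x] by (simp add: vec_eq_iff[of "snd x"] forall_2)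
    with assms show False by simp
  qed
  then show ?thesis using 2 by (simp add: trivial_motions_def dim_insert)
qed

lemma rigidity_row_trivial_motion:
  assumes "\<tau> \<in> trivial_motions x" shows "rigidity_row G e x \<bullet> \<tau> = 0"
proof -
  have "displacement G e (translation t) = 0" for t
    by (simp add: displacement_def translation_def)
  then show ?thesis
    using assms by (auto simp: trivial_motions_def inner_rigidity_row displacement_euclidean_act)
qed

lemma dim_rows_and_trivial_motions:
  fixes G :: "('v::finite, 'e) colored_graph"
  assumes "snd x \<noteq> 0" "indep_family I (\<lambda>e. rigidity_row G e x)"
  shows "dim ((\<lambda>e. rigidity_row G e x) ` I \<union> trivial_motions x) = card I + 3"
proof -
  have "dim ((\<lambda>e. rigidity_row G e x) ` I \<union> trivial_motions x)
      = dim ((\<lambda>e. rigidity_row G e x) ` I) + dim (trivial_motions x)"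
    by (rule dim_orthogonal_sum) (auto simp: rigidity_row_trivial_motion)
  then show ?thesis using assms by (simp add: dim_trivial_motions indep_family_dim)
qed

text \<open>The bound is the ambient dimension \<open>2n + 4\<close> minus the three trivial
  motions, to which all rows are orthogonal.\<close>

lemma card_indep_rigidity_rows:
  fixes G :: "('v::finite, 'e) colored_graph"
  assumes "snd x \<noteq> 0" "indep_family I (\<lambda>e. rigidity_row G e x)"
  shows "card I \<le> 2 * CARD('v) + 1"
  using dim_rows_and_trivial_motions[OF assms]
    dim_subset_UNIV[of "(\<lambda>e. rigidity_row G e x) ` I \<union> trivial_motions x"] by simp

subsection \<open>Rigidity and infinitesimal rigidity\<close>

definition same_lengths :: "('v::finite, 'e) colored_graph \<Rightarrow> 'e set \<Rightarrow> 'v coords \<Rightarrow> 'v coords \<Rightarrow> bool" where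
  "same_lengths G F x y \<longleftrightarrow> (\<forall>e\<in>F. norm (displacement G e y) = norm (displacement G e x))"

text \<open>Isolation in the configuration space, pulled back to the coordinates near
  \<open>x\<close>.\<close>

definition locally_rigid :: "('v::finite, 'e) colored_graph \<Rightarrow> 'e set \<Rightarrow> 'v coords \<Rightarrow> bool" where
  "locally_rigid G F x \<longleftrightarrow>
     (\<exists>\<epsilon>>0. \<forall>y. dist y x < \<epsilon> \<longrightarrow> same_lengths G F x y \<longrightarrow> y \<in> congruence_class x)"

text \<open>After alignment the difference \<open>u\<close> is orthogonal to the trivial motions,
  where the rows detect \<open>u\<close> linearly. Equal lengths make the pairing of each row with
  \<open>u\<close> of second order in \<open>u\<close>, so a small \<open>u\<close> must
  vanish.\<close>

lemma locally_rigid_if_full_rank: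
  fixes G :: "('v::finite, 'e) colored_graph"
  assumes x: "snd x \<noteq> 0" and IF: "I \<subseteq> F" and ind: "indep_family I (\<lambda>e. rigidity_row G e x)"
    and card: "card I = 2 * CARD('v) + 1"
  shows "locally_rigid G F x"
proof -
  let ?r = "\<lambda>e. rigidity_row G e x"
  let ?K = "{u. \<forall>\<tau>\<in>trivial_motions x. u \<bullet> \<tau> = 0}"
  \<comment> \<open>\<open>N\<close> gathers the pairings with all rows into one linear map. By full
    rank it is injective on \<open>?K\<close>, hence bounded below there.\<close>
  define N where "N = (\<lambda>u. \<Sum>e\<in>I. (?r e \<bullet> u) *\<^sub>R ?r e)"
  have "linear N"
    unfolding N_def by (rule linearI)
      (simp_all add: inner_add_right scaleR_add_left sum.distrib scaleR_sum_right)
  then have bl: "bounded_linear N" by (simp add: linear_conv_bounded_linear)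
  have K: "subspace ?K" by (auto simp: subspace_def inner_add_left)
  have full: "span (?r ` I \<union> trivial_motions x) = UNIV"
  proof -
    have "dim (?r ` I \<union> trivial_motions x) = DIM('v coords)"
      using dim_rows_and_trivial_motions[OF x ind] card by simp
    then show ?thesis by (simp only: dim_eq_full)
  qed
  have "u = 0" if u: "u \<in> ?K" "N u = 0" for u
  proof -
    have "?r e \<bullet> u = 0" if "e \<in> I" for e
      using indep_familyD[OF ind, of "\<lambda>e. ?r e \<bullet> u" e] u(2) that by (simp add: N_def)
    then have "u \<bullet> z = 0" if "z \<in> ?r ` I \<union> trivial_motions x" for z
      using that u(1) by (auto simp: inner_commute)
    then have "orthogonal u z" if "z \<in> span (?r ` I \<union> trivial_motions x)" for z
      using that orthogonal_to_span[of z "?r ` I \<union> trivial_motions x" u] by (auto simp: orthogonal_def)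
    then have "orthogonal u u" unfolding full by blast
    then show ?thesis by (simp add: orthogonal_def)
  qed
  then obtain k where k: "k > 0" "\<And>u. u \<in> ?K \<Longrightarrow> k * norm u \<le> norm (N u)"
    using injective_imp_isometric[OF closed_subspace[OF K] K bl] by blast
  have "bounded_linear (displacement G e)" for e
    using linear_displacement by (simp add: linear_conv_bounded_linear)
  from bounded_linear.bounded[OF this] obtain B where B: "\<And>e u. norm (displacement G e u) \<le> norm u * B e" by metis
  \<comment> \<open>The sum comes from the estimate \<open>half\<close>; the \<open>+ 1\<close>
    keeps \<open>C\<close> positive even if the sum vanishes.\<close>
  define C where "C = (\<Sum>e\<in>I. (B e)\<^sup>2 / 2 * norm (?r e)) + 1"
  have C: "C > 0" unfolding C_def by (intro add_nonneg_pos sum_nonneg) auto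
  have "y \<in> congruence_class x" if near: "dist y x < k / C" and len: "same_lengths G F x y" for y
  proof -
    obtain y' where y': "y' \<in> congruence_class y" "norm (y' - x) \<le> norm (y - x)"
      "\<And>t. (y' - x) \<bullet> translation t = 0" "(y' - x) \<bullet> turn x = 0"
      using exists_aligning_congruence by metis
    define u where "u = y' - x"
    have uK: "u \<in> ?K" using y'(3,4) orthogonal_trivial_motions_iff[of x u] by (simp add: u_def)
    \<comment> \<open>Expanding the squared length at \<open>x + u\<close> leaves twice the pairing
      with the row equal to minus the squared displacement of \<open>u\<close>.\<close>
    have half: "\<bar>?r e \<bullet> u\<bar> \<le> (B e)\<^sup>2 / 2 * (norm u)\<^sup>2" if e: "e \<in> I" for e
    proof -
      let ?d = "displacement G e"
      have "norm (?d y') = norm (?d x)"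
        using len e IF norm_displacement_congruent[OF y'(1), of G e] by (auto simp: same_lengths_def)
      moreover have "?d y' = ?d x + ?d u" by (simp add: u_def linear_diff[OF linear_displacement])
      ultimately have "(?d x + ?d u) \<bullet> (?d x + ?d u) = ?d x \<bullet> ?d x" by (metis norm_eq)
      then have "2 * (?r e \<bullet> u) = - (?d u \<bullet> ?d u)"
        by (simp add: inner_rigidity_row inner_add_left inner_add_right inner_commute[of "?d u" "?d x"])
      then have "?r e \<bullet> u = - ((norm (?d u))\<^sup>2 / 2)" by (simp add: power2_norm_eq_inner)
      then have "\<bar>?r e \<bullet> u\<bar> = (norm (?d u))\<^sup>2 / 2" by simp
      also have "\<dots> \<le> (norm u * B e)\<^sup>2 / 2"
        using B[where e=e and u=u] by (intro divide_right_mono power_mono) auto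
      finally show ?thesis by (simp add: power_mult_distrib mult.commute)
    qed
    have "norm (N u) \<le> (\<Sum>e\<in>I. norm ((?r e \<bullet> u) *\<^sub>R ?r e))" unfolding N_def by (rule norm_sum)
    also have "\<dots> \<le> (\<Sum>e\<in>I. (B e)\<^sup>2 / 2 * (norm u)\<^sup>2 * norm (?r e))"
      unfolding norm_scaleR by (intro sum_mono mult_right_mono half norm_ge_zero)
    also have "\<dots> = (norm u)\<^sup>2 * (C - 1)" by (simp add: C_def sum_distrib_left mult_ac)
    also have "\<dots> \<le> (norm u)\<^sup>2 * C" by (intro mult_left_mono) auto
    finally have "k * norm u \<le> norm u * (norm u * C)" using k(2)[OF uK] by (simp add: power2_eq_square mult_ac)
    moreover have "norm u < k / C" using near y'(2) by (simp add: u_def dist_norm)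
    then have small: "norm u * C < k" using C by (simp add: pos_less_divide_eq)
    ultimately have "\<not> norm u > 0"
      using mult_strict_left_mono[OF small, of "norm u"] by (simp only: mult.commute[of k] not_le[symmetric]) blast
    then have "y' = x" by (simp add: u_def)
    then show ?thesis using y'(1) congruence_class_sym by blast
  qed
  then show ?thesis unfolding locally_rigid_def using k(1) C by (intro exI[of _ "k / C"]) auto
qed

text \<open>The sign of the determinant excludes reflections near \<open>x\<close>. For a rotation
  about the barycenter followed by a translation, orthogonality to the translations removes the
  translation, and orthogonality to \<open>turn x\<close> leaves only the identity and the half
  turn.\<close>

lemma congruent_in_slice_unique:
  fixes x :: "'v::finite coords"
  assumes det: "det (snd x) \<noteq> 0"
  shows "\<exists>\<epsilon>>0. \<forall>y\<in>congruence_class x. dist y x < \<epsilon> \<longrightarrow>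
    (\<forall>\<tau>\<in>trivial_motions x. (y - x) \<bullet> \<tau> = 0) \<longrightarrow> y = x"
proof -
  have x0: "snd x \<noteq> 0" using det by (auto simp: det_2)
  let ?S = "{y :: 'v coords. 0 < det (snd y) * det (snd x)}"
  have "open ?S" unfolding det_2 by (intro open_Collect_less continuous_intros)
  moreover have "x \<in> ?S" using det by (auto simp: zero_less_mult_iff)
  ultimately obtain \<delta> where \<delta>: "\<delta> > 0" "ball x \<delta> \<subseteq> ?S" using openE by blast
  \<comment> \<open>The radius \<open>norm (snd x)\<close> excludes the half turn, which moves
    \<open>L\<close> by twice its norm.\<close>
  have "y = x" if y: "y \<in> congruence_class x" "dist y x < min \<delta> (norm (snd x))"
    and perp: "\<forall>\<tau>\<in>trivial_motions x. (y - x) \<bullet> \<tau> = 0" for y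
  proof -
    obtain Q t where Q: "orthogonal_matrix Q" "y = euclidean_act Q t x"
      using y(1) by (auto simp: congruence_class_def)
    have "y \<in> ?S" using \<delta>(2) y(2) by (auto simp: dist_commute)
    then have "0 < det Q * (det (snd x) * det (snd x))"
      using Q(2) by (simp add: euclidean_act_def det_mul mult.assoc)
    then have "det Q > 0" by (metis zero_less_mult_iff not_square_less_zero)
    then have "det Q = 1" using det_orthogonal_matrix[OF Q(1)] by auto
    then obtain c s where cs: "Q = rotation_mat c s" "c\<^sup>2 + s\<^sup>2 = 1"
      using orthogonal_matrix_2_det_1[OF Q(1)] by blast
    define a where "a = centered x"
    obtain m where m: "x = a + translation m" using decompose_centered a_def by blast
    \<comment> \<open>The translation that remains when the rotation is taken about the barycenter
      instead of the origin.\<close>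
    define l where "l = (c - 1) *\<^sub>R m + s *\<^sub>R (quarter_turn *v m) + t"
    have "y = c *\<^sub>R x + s *\<^sub>R turn x + translation t"
      using Q(2) euclidean_act_translation[of Q t x] by (simp add: cs(1) euclidean_act_rotation)
    then have yx: "y - x = (c - 1) *\<^sub>R a + s *\<^sub>R turn a + translation l"
      using m turn_decompose[OF m]
      by (simp add: l_def linear_add[OF linear_translation] linear_diff[OF linear_translation]
        linear_scale[OF linear_translation] algebra_simps)
    have perp': "(y - x) \<bullet> translation u = 0" "(y - x) \<bullet> turn x = 0" for u
      using perp by (auto simp: orthogonal_trivial_motions_iff)
    have orth: "a \<bullet> translation u = 0" "turn a \<bullet> translation u = 0" for u
      by (simp_all add: a_def inner_centered_translation inner_turn_centered_translation)
    have "(translation l :: 'v coords) \<bullet> translation l = 0"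
      using perp'(1)[of l] orth unfolding yx by (simp add: inner_add_left)
    then have l0: "(translation l :: 'v coords) = 0" by simp
    then have yx': "y - x = (c - 1) *\<^sub>R a + s *\<^sub>R turn a" using yx by simp
    have "(y - x) \<bullet> turn a = 0"
      using perp'(1)[of "quarter_turn *v m"] perp'(2) unfolding turn_decompose[OF m] by (simp add: inner_add_right)
    then have "s * (a \<bullet> a) = 0"
      unfolding yx' by (simp add: inner_add_left inner_turn_turn)
    moreover have "a \<noteq> 0" using x0 snd_centered[of x] by (auto simp: a_def)
    ultimately have s: "s = 0" by simp
    then have "c = 1 \<or> c = -1" using cs(2) by (simp add: power2_eq_1_iff)
    moreover have "c \<noteq> -1"
    proof
      assume "c = -1"
      then have "snd (y - x) = (-2) *\<^sub>R snd x" using s snd_centered[of x] by (simp add: yx' a_def)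
      then have "norm (snd (y - x)) = 2 * norm (snd x)" by simp
      moreover have "norm (snd (y - x)) \<le> norm (y - x)" by (metis norm_snd_le prod.collapse)
      moreover have "norm (y - x) < norm (snd x)" using y(2) by (simp add: dist_norm)
      ultimately show False using norm_ge_zero[of "snd x"] by linarith
    qed
    ultimately show ?thesis using yx' s by simp
  qed
  then show ?thesis using \<delta>(1) x0 by (intro exI[of _ "min \<delta> (norm (snd x))"]) auto
qed

text \<open>The path is the preimage of a line under a local diffeomorphism whose components along the
  independent rows are the corresponding squared lengths.\<close>

lemma not_locally_rigid_if_rank_deficient:
  fixes G :: "('v::finite, 'e) colored_graph"
  assumes det: "det (snd x) \<noteq> 0" and IF: "I \<subseteq> F" and ind: "indep_family I (\<lambda>e. rigidity_row G e x)"
    and card: "card I < 2 * CARD('v) + 1" and \<delta>: "\<delta> > 0"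
    and spanning: "\<And>y f. dist y x < \<delta> \<Longrightarrow> f \<in> F \<Longrightarrow> rigidity_row G f y \<in> span ((\<lambda>e. rigidity_row G e y) ` I)"
  shows "\<not> locally_rigid G F x"
proof
  assume "locally_rigid G F x"
  then obtain \<epsilon> where \<epsilon>: "\<epsilon> > 0"
    and rigid: "\<And>y. dist y x < \<epsilon> \<Longrightarrow> same_lengths G F x y \<Longrightarrow> y \<in> congruence_class x"
    unfolding locally_rigid_def by blast
  obtain \<epsilon>' where \<epsilon>': "\<epsilon>' > 0" and slice: "\<And>y. y \<in> congruence_class x \<Longrightarrow> dist y x < \<epsilon>' \<Longrightarrow>
      (\<forall>\<tau>\<in>trivial_motions x. (y - x) \<bullet> \<tau> = 0) \<Longrightarrow> y = x"
    using congruent_in_slice_unique[OF det] by blast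
  have x0: "snd x \<noteq> 0" using det by (auto simp: det_2)
  have fin: "finite I" using ind by (rule indep_family_finite)
  let ?r = "\<lambda>e. rigidity_row G e x"
  define q where "q = (\<lambda>e y. displacement G e y \<bullet> displacement G e y / 2)"
  have "\<exists>s. s \<in> span (?r ` I) \<and> (\<forall>f\<in>I. s \<bullet> ?r f = (if f = e then 1 else 0))" if e: "e \<in> I" for e
  proof -
    have "insert e (I - {e}) = I" using e by blast
    then obtain y where y: "y \<in> span (?r ` I)" "\<And>j. j \<in> I - {e} \<Longrightarrow> y \<bullet> ?r j = 0" "y \<bullet> ?r e \<noteq> 0"
      using indep_family_dual[of e "I - {e}" ?r] ind by auto
    then show ?thesis
      by (intro exI[of _ "(1 / (y \<bullet> ?r e)) *\<^sub>R y"]) (auto intro: span_scale)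
  qed
  \<comment> \<open>The family dual to the rows. It is taken inside their span, so that adding its
    members does not change pairings with trivial motions.\<close>
  then obtain s where s: "\<And>e. e \<in> I \<Longrightarrow> s e \<in> span (?r ` I)"
    "\<And>e f. e \<in> I \<Longrightarrow> f \<in> I \<Longrightarrow> s e \<bullet> ?r f = (if f = e then 1 else 0)" by metis
  have s_triv: "s e \<bullet> \<tau> = 0" if "e \<in> I" "\<tau> \<in> trivial_motions x" for e \<tau>
    using s(1)[OF that(1)]
  proof (induction rule: span_induct_alt)
    case (step c y z)
    then show ?case using that(2) by (auto simp: inner_add_left rigidity_row_trivial_motion)
  qed simp
  \<comment> \<open>A direction in which neither the lengths of \<open>I\<close> nor the position
    relative to the trivial motions should change; it exists because \<open>card I + 3\<close> is
    less than \<open>2n + 4\<close>.\<close>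
  obtain w where "w \<noteq> 0" and w: "\<And>z. z \<in> ?r ` I \<union> trivial_motions x \<Longrightarrow> w \<bullet> z = 0"
  proof -
    have "dim (?r ` I \<union> trivial_motions x) < DIM('v coords)"
      using dim_rows_and_trivial_motions[OF x0 ind] card by simp
    then show thesis using that orthogonal_to_subspace_exists by (metis orthogonal_def span_base)
  qed
  \<comment> \<open>\<open>\<Psi>\<close> changes \<open>y\<close> so that its pairing with row
    \<open>e\<close> becomes \<open>q e y\<close> and its pairings with trivial motions stay. As row
    \<open>e\<close> is the gradient of \<open>q e\<close> at \<open>x\<close>, the derivative at
    \<open>x\<close> is the identity.\<close>
  define \<Psi> where "\<Psi> = (\<lambda>y. y + (\<Sum>e\<in>I. (q e y - ?r e \<bullet> y) *\<^sub>R s e))"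
  define \<Psi>' where "\<Psi>' = (\<lambda>y. id_blinfun + (\<Sum>e\<in>I. blinfun_scaleR_left (s e) o\<^sub>L
    blinfun_inner_left (rigidity_row G e y - ?r e)))"
  have bl: "bounded_linear (displacement G e)" "bounded_linear (rigidity_row G e)" for e
    using linear_displacement linear_rigidity_row by (simp_all add: linear_conv_bounded_linear)
  have der_q: "(q e has_derivative (\<lambda>u. rigidity_row G e y \<bullet> u)) (at y)" for e y
  proof -
    have "(q e has_derivative (\<lambda>u. (displacement G e y \<bullet> displacement G e u + displacement G e u \<bullet> displacement G e y) / 2)) (at y)"
      unfolding q_def
      by (intro bounded_linear.has_derivative[OF bounded_linear_divide] has_derivative_inner
          bounded_linear_imp_has_derivative bl)
    moreover have "(displacement G e y \<bullet> displacement G e u + displacement G e u \<bullet> displacement G e y) / 2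
        = rigidity_row G e y \<bullet> u" for u
      by (simp add: inner_rigidity_row inner_commute[of "displacement G e u"])
    ultimately show ?thesis by (simp only:)
  qed
  have der: "(\<Psi> has_derivative blinfun_apply (\<Psi>' y)) (at y)" for y
  proof -
    have "((\<lambda>y. y + (\<Sum>e\<in>I. (q e y - ?r e \<bullet> y) *\<^sub>R s e)) has_derivative
        (\<lambda>u. u + (\<Sum>e\<in>I. (rigidity_row G e y \<bullet> u - ?r e \<bullet> u) *\<^sub>R s e))) (at y)"
      by (intro derivative_intros der_q has_derivative_inner_right) 
    moreover have "blinfun_apply (\<Psi>' y) = (\<lambda>u. u + (\<Sum>e\<in>I. (rigidity_row G e y \<bullet> u - ?r e \<bullet> u) *\<^sub>R s e))"
      by (rule ext) (simp add: \<Psi>'_def blinfun.add_left blinfun.sum_left inner_diff_left inner_diff_right inner_commute)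
    ultimately show ?thesis by (simp add: \<Psi>_def)
  qed
  have cont: "continuous_on UNIV \<Psi>'"
    unfolding \<Psi>'_def
    by (intro continuous_intros bounded_linear.continuous_on[OF bounded_linear_blinfun_inner_left]
        bounded_linear.continuous_on[OF bl(2)] bounded_bilinear.continuous_on[OF bounded_bilinear_blinfun_compose])
  have "\<Psi>' x = id_blinfun"
    by (rule blinfun_eqI) (simp add: \<Psi>'_def blinfun.add_left blinfun.sum_left)
  then have inv: "id_blinfun o\<^sub>L \<Psi>' x = id_blinfun" by (intro blinfun_eqI) simp
  obtain U V g g' where UV: "x \<in> U" "open V" "\<Psi> x \<in> V" "homeomorphism U V \<Psi> g"
    and g: "\<And>y. y \<in> V \<Longrightarrow> (g has_derivative (g' y)) (at y)"
    using inverse_function_theorem[OF open_UNIV der cont UNIV_I inv] by metis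
  have gx: "g (\<Psi> x) = x" using UV by (auto simp: homeomorphism_def)
  have \<Psi>g: "\<Psi> (g z) = z" if "z \<in> V" for z using UV that by (auto simp: homeomorphism_def)
  obtain \<eta>1 where \<eta>1: "\<eta>1 > 0" "ball (\<Psi> x) \<eta>1 \<subseteq> V" using UV openE by blast
  have "continuous (at (\<Psi> x)) g" using has_derivative_continuous[OF g[OF UV(3)]] .
  then obtain \<eta>2 where \<eta>2: "\<eta>2 > 0"
    "\<And>z. dist z (\<Psi> x) < \<eta>2 \<Longrightarrow> dist (g z) (g (\<Psi> x)) < min \<delta> (min \<epsilon> \<epsilon>')"
    using \<delta> \<epsilon> \<epsilon>' unfolding continuous_at_eps_delta by (metis min_less_iff_conj)
  define p where "p = (\<lambda>t. \<Psi> x + t *\<^sub>R w)"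
  define a where "a = min \<eta>1 \<eta>2 / norm w"
  have a: "a > 0" using \<open>w \<noteq> 0\<close> \<eta>1(1) \<eta>2(1) by (simp add: a_def)
  have pd: "dist (p t) (\<Psi> x) < \<eta>1" "dist (p t) (\<Psi> x) < \<eta>2" if "t \<in> {-a<..<a}" for t
  proof -
    have "\<bar>t\<bar> * norm w < min \<eta>1 \<eta>2" using that \<open>w \<noteq> 0\<close> by (simp add: a_def pos_less_divide_eq[symmetric] abs_less_iff del: min_less_iff_conj)
    then show "dist (p t) (\<Psi> x) < \<eta>1" "dist (p t) (\<Psi> x) < \<eta>2" by (simp_all add: p_def dist_norm)
  qed
  have pV: "p t \<in> V" if "t \<in> {-a<..<a}" for t
    using pd(1)[OF that] \<eta>1(2) by (auto simp: dist_commute)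
  define y where "y = (\<lambda>t. g (p t))"
  have near: "dist (y t) x < \<delta>" "dist (y t) x < \<epsilon>" "dist (y t) x < \<epsilon>'" if "t \<in> {-a<..<a}" for t
    using \<eta>2(2)[OF pd(2)[OF that]] by (simp_all add: y_def gx)
  have \<Psi>y: "\<Psi> (y t) = \<Psi> x + t *\<^sub>R w" if "t \<in> {-a<..<a}" for t
    using \<Psi>g[OF pV[OF that]] by (simp add: y_def p_def)
  have row_\<Psi>: "\<Psi> z \<bullet> ?r f = q f z" if f: "f \<in> I" for f z
  proof -
    have "(\<Sum>e\<in>I. (q e z - ?r e \<bullet> z) * (s e \<bullet> ?r f)) = (\<Sum>e\<in>I. if e = f then q e z - ?r e \<bullet> z else 0)"
      using s(2) f by (intro sum.cong) auto
    then show ?thesis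
      using fin f by (simp add: \<Psi>_def inner_add_left inner_sum_left inner_commute[of z])
  qed
  have q_const: "q f (y t) = q f x" if "f \<in> I" "t \<in> {-a<..<a}" for f t
    using row_\<Psi>[OF that(1), of "y t"] row_\<Psi>[OF that(1), of x] \<Psi>y[OF that(2)] w[of "?r f"] that(1)
    by (simp add: inner_add_left)
  have triv_\<Psi>: "\<Psi> z \<bullet> \<tau> = z \<bullet> \<tau>" if "\<tau> \<in> trivial_motions x" for z \<tau>
    using s_triv that by (simp add: \<Psi>_def inner_add_left inner_sum_left)
  have in_slice: "\<forall>\<tau>\<in>trivial_motions x. (y t - x) \<bullet> \<tau> = 0" if "t \<in> {-a<..<a}" for t
  proof
    fix \<tau> assume \<tau>: "\<tau> \<in> trivial_motions x"
    have "(y t - x) \<bullet> \<tau> = (\<Psi> (y t) - \<Psi> x) \<bullet> \<tau>" using triv_\<Psi>[OF \<tau>] by (simp add: inner_diff_left)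
    also have "\<dots> = 0" using \<Psi>y[OF that] w[of \<tau>] \<tau> by simp
    finally show "(y t - x) \<bullet> \<tau> = 0" .
  qed
  have der_qy: "((\<lambda>t. q f (y t)) has_real_derivative rigidity_row G f (y t) \<bullet> g' (p t) w) (at t)"
    if t: "t \<in> {-a<..<a}" for f t
  proof -
    have dp: "(p has_derivative (\<lambda>h. h *\<^sub>R w)) (at t)"
      unfolding p_def by (auto intro!: derivative_eq_intros)
    have "((\<lambda>t. g (p t)) has_derivative (\<lambda>h. g' (p t) (h *\<^sub>R w))) (at t)"
      using has_derivative_compose[OF dp g[OF pV[OF t]]] .
    from has_derivative_compose[OF this der_q[of f]]
    have "((\<lambda>t. q f (y t)) has_derivative (\<lambda>h. rigidity_row G f (y t) \<bullet> g' (p t) (h *\<^sub>R w))) (at t)"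
      by (simp add: y_def)
    moreover have "g' (p t) (h *\<^sub>R w) = h *\<^sub>R g' (p t) w" for h
      using has_derivative_linear[OF g[OF pV[OF t]]] by (rule linear_scale)
    ultimately show ?thesis by (simp add: has_field_derivative_def mult_commute_abs)
  qed
  \<comment> \<open>\<open>q e\<close> is constant along the path, so its gradient annihilates the
    velocity.\<close>
  have zero_I: "rigidity_row G e (y t) \<bullet> g' (p t) w = 0" if "e \<in> I" "t \<in> {-a<..<a}" for e t
  proof -
    have "((\<lambda>t. q e (y t)) has_real_derivative 0) (at t)"
      by (rule has_field_derivative_transform_within_open[where f = "\<lambda>_. q e x" and S = "{-a<..<a}"])
        (use that q_const in auto)
    then show ?thesis using DERIV_unique der_qy[OF that(2)] by blast
  qed
  \<comment> \<open>Constancy of the rank enters here: along the path every row of \<open>F\<close>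
    is a combination of rows of \<open>I\<close>, so the remaining lengths are stationary
    too.\<close>
  have zero_F: "rigidity_row G f (y t) \<bullet> g' (p t) w = 0" if "f \<in> F" "t \<in> {-a<..<a}" for f t
    using spanning[OF near(1)[OF that(2)] that(1)]
  proof (induction rule: span_induct_alt)
    case (step c u z)
    then show ?case using zero_I that(2) by (auto simp: inner_add_left)
  qed simp
  \<comment> \<open>Any nonzero parameter of the interval works: \<open>y t = x\<close> would force
    \<open>t *\<^sub>R w\<close> to be \<open>0\<close>.\<close>
  define t where "t = a / 2"
  have t: "t \<in> {-a<..<a}" "0 \<in> {-a<..<a}" "t \<noteq> 0" using a by (auto simp: t_def)
  have "q f (y t) = q f x" if "f \<in> F" for f
  proof -
    have "q f (y t) = q f (y 0)"
      using a t by (intro DERIV_isconst3[of "-a" a]) (auto intro!: der_qy[THEN DERIV_cong] zero_F[OF that])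
    then show ?thesis by (simp add: y_def p_def gx)
  qed
  then have "same_lengths G F x (y t)"
    by (simp add: same_lengths_def q_def norm_eq)
  then have "y t \<in> congruence_class x" using rigid near(2)[OF t(1)] by blast
  then have "y t = x" using slice near(3)[OF t(1)] in_slice[OF t(1)] by blast
  then show False using \<Psi>y[OF t(1)] t(3) \<open>w \<noteq> 0\<close> by simp
qed

subsection \<open>Realizations of the periodic graph\<close>

definition edge_cover :: "(int^2 \<Rightarrow> 'a \<Rightarrow> 'a) \<Rightarrow> ('v \<Rightarrow> 'a) \<Rightarrow> ('v, 'e) colored_graph \<Rightarrow> 'e set \<Rightarrow> 'a set set" where
  "edge_cover \<phi> rep G F = (\<Union>e\<in>F. edge_orbit \<phi> (lifted_edge \<phi> rep G e))"

text \<open>Exchanging the endpoints does not change the norm, so the \<open>THE\<close> is well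
  defined.\<close>

lemma induced_length_doubleton:
  "induced_length \<phi> rep x {u, v} = norm (lifted_placement \<phi> rep x v - lifted_placement \<phi> rep x u)"
  unfolding induced_length_def
  by (rule the_equality) (auto simp: doubleton_eq_iff norm_minus_commute)

locale periodic_quotient =
  fixes V :: "'a set" and E :: "'a set set" and \<phi> :: "int^2 \<Rightarrow> 'a \<Rightarrow> 'a" and rep :: "'v::finite \<Rightarrow> 'a"
    and G :: "('v, 'e) colored_graph"
  assumes periodic: "periodic_graph V E \<phi>" and quotient: "quotient_colored_graph V E \<phi> rep G"
begin

lemma act_zero: "v \<in> V \<Longrightarrow> \<phi> 0 v = v"
  and act_add: "v \<in> V \<Longrightarrow> \<phi> (g + h) v = \<phi> g (\<phi> h v)"
  and act_free: "v \<in> V \<Longrightarrow> \<phi> g v = v \<Longrightarrow> g = 0"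
  using periodic by (auto simp: periodic_graph_def)

lemma act_closed: "v \<in> V \<Longrightarrow> \<phi> g v \<in> V"
  using periodic bij_betwE unfolding periodic_graph_def graph_automorphism_def by metis

lemma rep_in: "rep i \<in> V"
  and vertex_orbits: "range (\<lambda>i. vertex_orbit \<phi> (rep i)) = vertex_orbit \<phi> ` V"
  and inj_vertex_orbits: "inj (\<lambda>i. vertex_orbit \<phi> (rep i))"
  and lifted_edge_in: "e \<in> edges G \<Longrightarrow> lifted_edge \<phi> rep G e \<in> E"
  and edge_orbits: "(\<lambda>e. edge_orbit \<phi> (lifted_edge \<phi> rep G e)) ` edges G = edge_orbit \<phi> ` E"
  and inj_edge_orbits: "inj_on (\<lambda>e. edge_orbit \<phi> (lifted_edge \<phi> rep G e)) (edges G)"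
  using quotient by (simp_all add: quotient_colored_graph_def bij_betw_def image_subset_iff)

lemma edge_subset: "e \<in> E \<Longrightarrow> e \<subseteq> V"
  using periodic by (fastforce simp: periodic_graph_def simple_graph_def)

lemma edge_act_closed:
  assumes "e \<in> E" shows "\<phi> g ` e \<in> E"
proof -
  obtain u v where uv: "u \<in> V" "v \<in> V" "e = {u, v}"
    using assms periodic by (auto simp: periodic_graph_def simple_graph_def)
  moreover have "graph_automorphism V E (\<phi> g)" using periodic by (simp add: periodic_graph_def)
  ultimately show ?thesis using assms by (auto simp: graph_automorphism_def)
qed

lemma vertex_orbit_act:
  assumes "v \<in> V" shows "vertex_orbit \<phi> (\<phi> h v) = vertex_orbit \<phi> v"
proof -
  have "range (\<lambda>g. \<phi> g (\<phi> h v)) = (\<lambda>g. \<phi> g v) ` range (\<lambda>g. g + h)"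
    by (simp only: image_image act_add[OF assms])
  also have "\<dots> = range (\<lambda>g. \<phi> g v)" by simp
  finally show ?thesis by (simp only: vertex_orbit_def)
qed

lemma edge_orbit_act:
  assumes "e \<subseteq> V" shows "edge_orbit \<phi> (\<phi> h ` e) = edge_orbit \<phi> e"
proof -
  have "\<phi> g ` \<phi> h ` e = \<phi> (g + h) ` e" for g
    unfolding image_image using act_add assms by (intro image_cong) auto
  then have "range (\<lambda>g. \<phi> g ` \<phi> h ` e) = range (\<lambda>g. \<phi> (g + h) ` e)" by (simp only:)
  also have "\<dots> = (\<lambda>g. \<phi> g ` e) ` range (\<lambda>g. g + h)" by (rule image_image[symmetric])
  also have "\<dots> = range (\<lambda>g. \<phi> g ` e)" by simp
  finally show ?thesis by (simp only: edge_orbit_def)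
qed

lemma edge_orbit_self:
  assumes "e \<subseteq> V" shows "e \<in> edge_orbit \<phi> e"
proof -
  have "\<phi> 0 ` e = id ` e" using act_zero assms by (intro image_cong) auto
  then show ?thesis unfolding edge_orbit_def by (metis image_id rangeI id_apply)
qed

lemma vertex_representation:
  assumes "v \<in> V" obtains i g where "v = \<phi> g (rep i)"
proof -
  have "vertex_orbit \<phi> v \<in> (\<lambda>i. vertex_orbit \<phi> (rep i)) ` UNIV"
    unfolding vertex_orbits using assms by (rule imageI)
  then obtain i where "vertex_orbit \<phi> v = vertex_orbit \<phi> (rep i)" by auto
  moreover have "v \<in> vertex_orbit \<phi> v"
    unfolding vertex_orbit_def using act_zero[OF assms] by (metis rangeI)
  ultimately show thesis using that by (auto simp: vertex_orbit_def)
qed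

lemma vertex_representation_unique:
  assumes "\<phi> g (rep i) = \<phi> h (rep j)" shows "i = j \<and> g = h"
proof -
  have "vertex_orbit \<phi> (rep i) = vertex_orbit \<phi> (rep j)"
    using vertex_orbit_act[OF rep_in, of g i] vertex_orbit_act[OF rep_in, of h j] assms by simp
  then have ij: "i = j"
    by (rule injD[OF inj_vertex_orbits])
  have "\<phi> (- h + g) (rep i) = \<phi> (- h + h) (rep i)"
    unfolding act_add[OF rep_in] using assms ij by simp
  then have "\<phi> (g - h) (rep i) = rep i" using act_zero[OF rep_in] by simp
  then have "g - h = 0" by (rule act_free[OF rep_in])
  with ij show ?thesis by simp
qed

lemma lifted_placement_act_rep:
  "lifted_placement \<phi> rep x (\<phi> g (rep i)) = fst x $ i + snd x *v real_vec g"
proof -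
  have "(THE (j, h). \<phi> g (rep i) = \<phi> h (rep j)) = (i, g)"
    by (rule the_equality) (auto dest: vertex_representation_unique)
  then show ?thesis by (simp add: lifted_placement_def)
qed

lemma lifted_placement_act:
  assumes "v \<in> V"
  shows "lifted_placement \<phi> rep x (\<phi> g v) = lifted_placement \<phi> rep x v + snd x *v real_vec g"
proof -
  obtain i h where v: "v = \<phi> h (rep i)" using vertex_representation[OF assms] .
  have "\<phi> g v = \<phi> (g + h) (rep i)" using act_add[OF rep_in] by (simp add: v)
  then show ?thesis by (simp add: v lifted_placement_act_rep matrix_vector_right_distrib)
qed

lemma lifted_edge_displacement:
  "lifted_placement \<phi> rep x (\<phi> g (\<phi> (color G e) (rep (head G e)))) - lifted_placement \<phi> rep x (\<phi> g (rep (tail G e)))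
    = displacement G e x"
proof -
  have "\<phi> g (\<phi> (color G e) (rep (head G e))) = \<phi> (g + color G e) (rep (head G e))"
    using act_add[OF rep_in] by simp
  then show ?thesis
    by (simp add: lifted_placement_act_rep displacement_def matrix_vector_right_distrib)
qed

lemma induced_length_lifted_edge:
  "induced_length \<phi> rep x (\<phi> g ` lifted_edge \<phi> rep G e) = norm (displacement G e x)"
  by (simp add: lifted_edge_def induced_length_doubleton lifted_edge_displacement)

lemma lifted_edge_subset: "lifted_edge \<phi> rep G e \<subseteq> V"
  by (simp add: lifted_edge_def rep_in act_closed)

lemma edge_cover_cases:
  assumes "e' \<in> edge_cover \<phi> rep G F" obtains e g where "e \<in> F" "e' = \<phi> g ` lifted_edge \<phi> rep G e"
  using assms by (auto simp: edge_cover_def edge_orbit_def)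

lemma edge_cover_edges: "edge_cover \<phi> rep G (edges G) = E"
proof
  show "edge_cover \<phi> rep G (edges G) \<subseteq> E"
    using edge_act_closed[OF lifted_edge_in] by (auto simp: edge_cover_def edge_orbit_def)
  show "E \<subseteq> edge_cover \<phi> rep G (edges G)"
  proof
    fix e' assume e': "e' \<in> E"
    have "edge_orbit \<phi> e' \<in> (\<lambda>e. edge_orbit \<phi> (lifted_edge \<phi> rep G e)) ` edges G"
      unfolding edge_orbits using e' by (rule imageI)
    then show "e' \<in> edge_cover \<phi> rep G (edges G)"
      using edge_orbit_self[OF edge_subset[OF e']] by (auto simp: edge_cover_def)
  qed
qed

text \<open>Orbits over distinct edges of \<open>G\<close> are disjoint: a common lift would make
  the two orbits equal.\<close>

lemma edge_cover_remove:
  assumes f: "f \<in> edges G"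
  shows "E - edge_orbit \<phi> (lifted_edge \<phi> rep G f) = edge_cover \<phi> rep G (edges G - {f})"
proof -
  have "e = f" if "e \<in> edges G" and z: "z \<in> edge_orbit \<phi> (lifted_edge \<phi> rep G e)"
    "z \<in> edge_orbit \<phi> (lifted_edge \<phi> rep G f)" for e z
  proof -
    obtain g where "z = \<phi> g ` lifted_edge \<phi> rep G e" using z(1) by (auto simp: edge_orbit_def)
    moreover obtain h where "z = \<phi> h ` lifted_edge \<phi> rep G f" using z(2) by (auto simp: edge_orbit_def)
    ultimately have "edge_orbit \<phi> (lifted_edge \<phi> rep G e) = edge_orbit \<phi> (lifted_edge \<phi> rep G f)"
      using edge_orbit_act[OF lifted_edge_subset] by metis
    then show ?thesis using that(1) f by (rule inj_onD[OF inj_edge_orbits])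
  qed
  then show ?thesis unfolding edge_cover_edges[symmetric] by (auto simp: edge_cover_def)
qed

lemma finite_edges: "finite (edges G)"
proof (rule finite_imageD[OF _ inj_edge_orbits])
  show "finite ((\<lambda>e. edge_orbit \<phi> (lifted_edge \<phi> rep G e)) ` edges G)"
    unfolding edge_orbits using periodic by (simp add: periodic_graph_def)
qed

text \<open>Lifted placements are equivariant by construction, so only the lengths remain, and these
  reduce to one condition for each edge orbit.\<close>

lemma realization_space_eq:
  "realization_space V (edge_cover \<phi> rep G F) \<phi> (induced_length \<phi> rep x) rep = {y. same_lengths G F x y}"
proof (intro set_eqI iffI)
  fix y assume "y \<in> realization_space V (edge_cover \<phi> rep G F) \<phi> (induced_length \<phi> rep x) rep"
  then have y: "realization V (edge_cover \<phi> rep G F) \<phi> (induced_length \<phi> rep x) (lifted_placement \<phi> rep y) (snd y)"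
    by (simp add: realization_space_def)
  have "norm (displacement G e y) = norm (displacement G e x)" if "e \<in> F" for e
  proof -
    let ?u = "\<phi> 0 (rep (tail G e))" and ?v = "\<phi> 0 (\<phi> (color G e) (rep (head G e)))"
    have uv: "\<phi> 0 ` lifted_edge \<phi> rep G e = {?u, ?v}" by (simp add: lifted_edge_def)
    have "{?u, ?v} \<in> edge_cover \<phi> rep G F"
      unfolding uv[symmetric] using \<open>e \<in> F\<close> by (auto simp: edge_cover_def edge_orbit_def)
    then have "norm (lifted_placement \<phi> rep y ?v - lifted_placement \<phi> rep y ?u) = induced_length \<phi> rep x {?u, ?v}"
      using y by (simp only: realization_def)
    then show ?thesis by (simp only: lifted_edge_displacement induced_length_doubleton)
  qed
  then show "y \<in> {y. same_lengths G F x y}" by (simp add: same_lengths_def)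
next
  fix y assume "y \<in> {y. same_lengths G F x y}"
  then have y: "same_lengths G F x y" by simp
  have "realization V (edge_cover \<phi> rep G F) \<phi> (induced_length \<phi> rep x) (lifted_placement \<phi> rep y) (snd y)"
    unfolding realization_def
  proof (intro conjI allI ballI impI)
    fix u v assume "{u, v} \<in> edge_cover \<phi> rep G F"
    then obtain e g where e: "e \<in> F" "{u, v} = \<phi> g ` lifted_edge \<phi> rep G e" by (rule edge_cover_cases)
    have "norm (lifted_placement \<phi> rep y v - lifted_placement \<phi> rep y u) = induced_length \<phi> rep y {u, v}"
      by (simp add: induced_length_doubleton)
    also have "\<dots> = induced_length \<phi> rep x {u, v}"
      using y e by (simp add: induced_length_lifted_edge same_lengths_def)
    finally show "norm (lifted_placement \<phi> rep y v - lifted_placement \<phi> rep y u) = induced_length \<phi> rep x {u, v}" .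
  qed (simp add: lifted_placement_act)
  then show "y \<in> realization_space V (edge_cover \<phi> rep G F) \<phi> (induced_length \<phi> rep x) rep"
    by (simp add: realization_space_def)
qed

text \<open>The preimage of the point is the congruence class, so isolation means that the class is
  open in the realization space. Openness at \<open>x\<close> suffices, since a congruence preserves
  lengths and carries any other point of the class to \<open>x\<close>.\<close>

lemma rigid_iff_locally_rigid:
  "rigid V (edge_cover \<phi> rep G F) \<phi> (induced_length \<phi> rep x) rep x \<longleftrightarrow> locally_rigid G F x"
proof -
  let ?S = "{y. same_lengths G F x y}"
  have class_S: "congruence_class x \<subseteq> ?S"
  proof
    fix y assume "y \<in> congruence_class x"
    then show "y \<in> ?S" by (simp add: same_lengths_def norm_displacement_congruent[of y x])
  qed
  have xS: "x \<in> ?S" by (simp add: same_lengths_def)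
  have "{y \<in> ?S. congruence_class y \<in> {congruence_class x}} = congruence_class x"
    using class_S by (auto simp: congruence_class_eq_iff)
  then have "rigid V (edge_cover \<phi> rep G F) \<phi> (induced_length \<phi> rep x) rep x \<longleftrightarrow>
      openin (top_of_set ?S) (congruence_class x)"
    unfolding rigid_def configuration_space_def realization_space_eq openin_quotient_topology
      topspace_euclidean_subtopology using xS by auto
  also have "\<dots> \<longleftrightarrow> locally_rigid G F x"
  proof
    assume "openin (top_of_set ?S) (congruence_class x)"
    then show "locally_rigid G F x"
      using congruence_class_refl[of x] unfolding openin_euclidean_subtopology_iff locally_rigid_def by blast
  next
    assume "locally_rigid G F x"
    then obtain \<epsilon> where \<epsilon>: "\<epsilon> > 0"
      and near: "\<And>y. dist y x < \<epsilon> \<Longrightarrow> same_lengths G F x y \<Longrightarrow> y \<in> congruence_class x"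
      unfolding locally_rigid_def by blast
    show "openin (top_of_set ?S) (congruence_class x)"
      unfolding openin_euclidean_subtopology_iff
    proof (intro conjI class_S ballI)
      fix y assume "y \<in> congruence_class x"
      then obtain Q t where Q: "orthogonal_matrix Q" "x = euclidean_act Q t y"
        using congruence_class_sym unfolding congruence_class_def by blast
      have "continuous_on UNIV (euclidean_act Q 0 :: 'v coords \<Rightarrow> _)"
        using linear_euclidean_act by (rule linear_continuous_on[OF linear_conv_bounded_linear[THEN iffD1]])
      then have "continuous_on UNIV (\<lambda>z :: 'v coords. euclidean_act Q 0 z + translation t)"
        by (intro continuous_intros)
      then have "continuous (at y) (euclidean_act Q t)"
        unfolding euclidean_act_translation[of Q t, abs_def] by (simp add: continuous_on_eq_continuous_at del: split_paired_All)
      then obtain \<delta> where \<delta>: "\<delta> > 0"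
        "\<And>z. dist z y < \<delta> \<Longrightarrow> dist (euclidean_act Q t z) (euclidean_act Q t y) < \<epsilon>"
        using \<epsilon> unfolding continuous_at_eps_delta by blast
      have "z \<in> congruence_class x" if z: "z \<in> ?S" "dist z y < \<delta>" for z
      proof -
        have c: "euclidean_act Q t z \<in> congruence_class z" using Q(1) by (auto simp: congruence_class_def)
        have "same_lengths G F x (euclidean_act Q t z)"
          using z(1) by (simp add: same_lengths_def norm_displacement_congruent[OF c])
        then have "euclidean_act Q t z \<in> congruence_class x" using near \<delta>(2)[OF z(2)] Q(2) by simp
        then show ?thesis using congruence_class_trans congruence_class_sym[OF c] by blast
      qed
      with \<delta>(1) show "\<exists>e>0. \<forall>x'\<in>?S. dist x' y < e \<longrightarrow> x' \<in> congruence_class x" by blast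
    qed
  qed
  finally show ?thesis .
qed

lemma minimally_rigid_iff:
  "minimally_rigid V E \<phi> (induced_length \<phi> rep x) rep x \<longleftrightarrow>
     locally_rigid G (edges G) x \<and> (\<forall>f\<in>edges G. \<not> locally_rigid G (edges G - {f}) x)"
proof -
  let ?r = "\<lambda>E'. rigid V E' \<phi> (induced_length \<phi> rep x) rep x"
  have "?r E \<longleftrightarrow> locally_rigid G (edges G) x"
    using rigid_iff_locally_rigid[of "edges G"] by (simp only: edge_cover_edges)
  moreover have remove: "?r (E - edge_orbit \<phi> (lifted_edge \<phi> rep G f)) \<longleftrightarrow> locally_rigid G (edges G - {f}) x"
    if "f \<in> edges G" for f
    using edge_cover_remove[OF that] rigid_iff_locally_rigid by simp
  have "(\<forall>e\<in>E. \<not> ?r (E - edge_orbit \<phi> e)) \<longleftrightarrow>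
      (\<forall>f\<in>edges G. \<not> ?r (E - edge_orbit \<phi> (lifted_edge \<phi> rep G f)))" (is "?L \<longleftrightarrow> ?R")
  proof
    assume ?L
    then show ?R using lifted_edge_in by blast
  next
    assume R: ?R
    show ?L
    proof
      fix e assume "e \<in> E"
      then have "e \<in> edge_cover \<phi> rep G (edges G)" by (simp only: edge_cover_edges)
      then obtain f g where f: "f \<in> edges G" "e = \<phi> g ` lifted_edge \<phi> rep G f" by (rule edge_cover_cases)
      then have "edge_orbit \<phi> e = edge_orbit \<phi> (lifted_edge \<phi> rep G f)"
        using edge_orbit_act[OF lifted_edge_subset] by simp
      then show "\<not> ?r (E - edge_orbit \<phi> e)" using R f(1) by simp
    qed
  qed
  then have "(\<forall>e\<in>E. \<not> ?r (E - edge_orbit \<phi> e)) \<longleftrightarrow> (\<forall>f\<in>edges G. \<not> locally_rigid G (edges G - {f}) x)"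
    using remove by simp
  ultimately show ?thesis by (simp only: minimally_rigid_def)
qed

text \<open>Simplicity of the periodic graph is what counts: the lift of a loop has two different
  ends, so a loop has a nonzero color. This will make the induced lengths positive.\<close>

lemma exists_nonzero_displacement:
  assumes "e \<in> edges G" shows "\<exists>x. displacement G e x \<noteq> 0"
proof -
  have "lifted_edge \<phi> rep G e \<in> E" using assms by (rule lifted_edge_in)
  then have ne: "rep (tail G e) \<noteq> \<phi> (color G e) (rep (head G e))"
    using periodic by (fastforce simp: periodic_graph_def simple_graph_def lifted_edge_def doubleton_eq_iff)
  show ?thesis
  proof (cases "tail G e = head G e")
    case False
    then have "displacement G e (axis (head G e) (axis 1 1), 0) = axis 1 1"
      by (simp add: displacement_def axis_def)
    moreover have "(axis 1 1 :: real^2) \<noteq> 0" by (simp add: axis_eq_0_iff)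
    ultimately show ?thesis by metis
  next
    case True
    then have "color G e \<noteq> 0" using ne act_zero[OF rep_in] by auto
    moreover have "displacement G e (0, mat 1) = real_vec (color G e)" by (simp add: displacement_def)
    ultimately show ?thesis by (metis real_vec_eq_0_iff)
  qed
qed

lemma periodic_framework_induced:
  assumes "\<And>e. e \<in> edges G \<Longrightarrow> displacement G e x \<noteq> 0"
  shows "periodic_framework V E \<phi> (induced_length \<phi> rep x)"
proof -
  have cover: "\<exists>f g. f \<in> edges G \<and> e = \<phi> g ` lifted_edge \<phi> rep G f" if "e \<in> E" for e
    using that edge_cover_cases[of e "edges G"] by (metis edge_cover_edges)
  have "induced_length \<phi> rep x e > 0" if "e \<in> E" for e
    using cover[OF that] assms by (auto simp: induced_length_lifted_edge)
  moreover have "induced_length \<phi> rep x (\<phi> g ` e) = induced_length \<phi> rep x e" if "e \<in> E" for e g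
  proof -
    from cover[OF that] obtain f h where f: "e = \<phi> h ` lifted_edge \<phi> rep G f" by blast
    have "\<phi> g ` e = \<phi> (g + h) ` lifted_edge \<phi> rep G f"
      unfolding f image_image using act_add lifted_edge_subset[of f] by (intro image_cong) auto
    then show ?thesis by (simp only: f induced_length_lifted_edge)
  qed
  ultimately show ?thesis using periodic by (simp add: periodic_framework_def)
qed

end

subsection \<open>The generic locus\<close>

text \<open>All edge sets attain their maximal rank at \<open>x\<close> simultaneously. The
  determinant is what the comparison of congruent points near \<open>x\<close> needs.\<close>

definition generic_point :: "('v::finite, 'e) colored_graph \<Rightarrow> 'v coords \<Rightarrow> bool" where
  "generic_point G x \<longleftrightarrow> det (snd x) \<noteq> 0 \<and>
     (\<forall>I\<subseteq>edges G. (\<exists>y. indep_family I (\<lambda>e. rigidity_row G e y)) \<longrightarrow> indep_family I (\<lambda>e. rigidity_row G e x))"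

text \<open>A maximal independent set of rows at \<open>x\<close> remains maximal at nearby points:
  a further row independent at some \<open>y\<close> would, by genericity of \<open>x\<close>, be
  independent at \<open>x\<close>.\<close>

lemma locally_rigid_iff:
  fixes G :: "('v::finite, 'e) colored_graph"
  assumes fin: "finite (edges G)" and F: "F \<subseteq> edges G"
    and gen: "generic_point G x" and nbhd: "open U" "x \<in> U" "\<And>y. y \<in> U \<Longrightarrow> generic_point G y"
  shows "locally_rigid G F x \<longleftrightarrow>
    (\<exists>I\<subseteq>F. indep_family I (\<lambda>e. rigidity_row G e x) \<and> card I = 2 * CARD('v) + 1)"
proof
  have det: "det (snd x) \<noteq> 0" using gen by (simp add: generic_point_def)
  then have x0: "snd x \<noteq> 0" by (auto simp: det_2)
  show "locally_rigid G F x"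
    if "\<exists>I\<subseteq>F. indep_family I (\<lambda>e. rigidity_row G e x) \<and> card I = 2 * CARD('v) + 1"
    using that locally_rigid_if_full_rank[OF x0] by blast
  assume rigid: "locally_rigid G F x"
  obtain I where I: "I \<subseteq> F" "indep_family I (\<lambda>e. rigidity_row G e x)"
    and spans: "\<And>f. f \<in> F \<Longrightarrow> rigidity_row G f x \<in> span ((\<lambda>e. rigidity_row G e x) ` I)"
    using maximal_indep_family[OF finite_subset[OF F fin], of "\<lambda>e. rigidity_row G e x"] by blast
  obtain \<delta> where \<delta>: "\<delta> > 0" "ball x \<delta> \<subseteq> U" using nbhd openE by blast
  have spanning: "rigidity_row G f y \<in> span ((\<lambda>e. rigidity_row G e y) ` I)"
    if y: "dist y x < \<delta>" and f: "f \<in> F" for y f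
  proof (rule ccontr)
    assume n: "rigidity_row G f y \<notin> span ((\<lambda>e. rigidity_row G e y) ` I)"
    have "y \<in> U" using y by (intro subsetD[OF \<delta>(2)]) (simp add: dist_commute)
    then have "generic_point G y" by (rule nbhd(3))
    then have "indep_family I (\<lambda>e. rigidity_row G e y)"
      using I F unfolding generic_point_def by (meson order_trans)
    then have "indep_family (insert f I) (\<lambda>e. rigidity_row G e y)" using n by (rule indep_family_insert)
    moreover have "insert f I \<subseteq> edges G" using I(1) F f by blast
    ultimately have "indep_family (insert f I) (\<lambda>e. rigidity_row G e x)"
      using gen unfolding generic_point_def by blast
    moreover have "f \<notin> I" using n by (auto intro: span_base)
    ultimately show False using indep_family_not_in_span[of f I "\<lambda>e. rigidity_row G e x"] spans[OF f] by simp
  qed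
  have "\<not> card I < 2 * CARD('v) + 1"
    using not_locally_rigid_if_rank_deficient[OF det I _ \<delta>(1) spanning] rigid by blast
  then have "card I = 2 * CARD('v) + 1" using card_indep_rigidity_rows[OF x0 I(2)] by simp
  then show "\<exists>I\<subseteq>F. indep_family I (\<lambda>e. rigidity_row G e x) \<and> card I = 2 * CARD('v) + 1"
    using I by blast
qed

text \<open>The count follows from independence at \<open>x\<close> itself; conversely it gives
  independence at some point, which genericity transfers to \<open>x\<close>.\<close>

lemma colored_laman_iff:
  fixes G :: "('v::finite, 'e) colored_graph"
  assumes fin: "finite (edges G)" and gen: "generic_point G x"
  shows "colored_laman G \<longleftrightarrow>
    indep_family (edges G) (\<lambda>e. rigidity_row G e x) \<and> card (edges G) = 2 * CARD('v) + 1"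
proof -
  have "colored_laman_sparse G \<longleftrightarrow> indep_family (edges G) (\<lambda>e. rigidity_row G e x)"
  proof
    assume "colored_laman_sparse G"
    then have "\<exists>y. indep_family (edges G) (\<lambda>e. rigidity_row G e y)"
      unfolding colored_laman_sparse_iff[OF fin] by (intro exists_indep_rigidity_rows[OF fin]) blast
    then show "indep_family (edges G) (\<lambda>e. rigidity_row G e x)"
      using gen by (simp add: generic_point_def)
  next
    assume ind: "indep_family (edges G) (\<lambda>e. rigidity_row G e x)"
    show "colored_laman_sparse G"
      unfolding colored_laman_sparse_iff[OF fin]
      using rigidity_rows_count[OF indep_family_subset[OF ind]] by blast
  qed
  then show ?thesis by (simp add: colored_laman_def)
qed

lemma exists_generic_polynomial:
  fixes G :: "('v::finite, 'e) colored_graph"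
  assumes fin: "finite (edges G)"
  obtains P :: "'v coords \<Rightarrow> real" where "real_polynomial_function P" "\<exists>x. P x \<noteq> 0"
    "\<And>x. P x \<noteq> 0 \<Longrightarrow> generic_point G x"
proof -
  define \<I> where "\<I> = {I. I \<subseteq> edges G \<and> (\<exists>y. indep_family I (\<lambda>e. rigidity_row G e y))}"
  have "\<exists>P. real_polynomial_function P \<and> (\<exists>x. P x \<noteq> 0) \<and> (\<forall>x. P x \<noteq> 0 \<longrightarrow> indep_family I (\<lambda>e. rigidity_row G e x))"
    if "I \<in> \<I>" for I
  proof -
    from that obtain y where y: "indep_family I (\<lambda>e. rigidity_row G e y)" unfolding \<I>_def by blast
    have "polynomial_function (rigidity_row G e)" for e
      using linear_rigidity_row by (intro polynomial_function_bounded_linear) (simp add: linear_conv_bounded_linear)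
    from indep_family_polynomial[OF y this] show ?thesis by blast
  qed
  then obtain p where p: "\<And>I. I \<in> \<I> \<Longrightarrow> real_polynomial_function (p I)" "\<And>I. I \<in> \<I> \<Longrightarrow> \<exists>x. p I x \<noteq> 0"
    "\<And>I x. I \<in> \<I> \<Longrightarrow> p I x \<noteq> 0 \<Longrightarrow> indep_family I (\<lambda>e. rigidity_row G e x)" by metis
  define q where "q = (\<lambda>j. case j of None \<Rightarrow> (\<lambda>x :: 'v coords. det (snd x)) | Some I \<Rightarrow> p I)"
  let ?J = "insert None (Some ` \<I>)"
  have finJ: "finite ?J" using fin by (simp add: \<I>_def)
  have "real_polynomial_function (\<lambda>x :: 'v coords. snd x $ i $ j)" for i j
    by (intro real_polynomial_function.intros(1) bounded_linear_compose[OF bounded_linear_vec_nth]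
        bounded_linear_snd)
  then have "real_polynomial_function (\<lambda>x :: 'v coords. det (snd x))"
    unfolding det_2 by (intro real_polynomial_function_diff real_polynomial_function.intros(4))
  then have poly: "real_polynomial_function (q j)" if "j \<in> ?J" for j
    using that p(1) by (auto simp: q_def)
  \<comment> \<open>With the one-element index type \<open>unit\<close>, assignments are just
    points, so the argument along lines yields a common nonroot of all the polynomials.\<close>
  have "\<exists>d :: unit \<Rightarrow> 'v coords. q j (d ()) \<noteq> 0" if "j \<in> ?J" for j
  proof -
    have "\<exists>x. q j x \<noteq> 0"
    proof (cases j)
      case None
      have "det (snd (0 :: (real^2)^'v, mat 1 :: real^2^2)) \<noteq> 0" by simp
      then show ?thesis unfolding None q_def option.case by blast
    qed (use that p(2) in \<open>auto simp: q_def\<close>)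
    then obtain x where "q j x \<noteq> 0" by blast
    then show ?thesis by (intro exI[of _ "\<lambda>_. x"])
  qed
  then have "\<exists>d :: unit \<Rightarrow> 'v coords. \<forall>j\<in>?J. q j (d ()) \<noteq> 0"
    using poly by (intro generic_cond_simultaneous[OF finJ] generic_cond_polynomial) auto
  then obtain x where x: "\<forall>j\<in>?J. q j x \<noteq> 0" by blast
  define P where "P = (\<lambda>x. \<Prod>j\<in>?J. q j x)"
  have "real_polynomial_function P"
    unfolding P_def using poly finJ by (intro real_polynomial_function_prod)
  moreover have "P x \<noteq> 0" using x finJ by (simp add: P_def)
  moreover have "generic_point G x" if "P x \<noteq> 0" for x
  proof -
    have nz: "q j x \<noteq> 0" if "j \<in> ?J" for j using \<open>P x \<noteq> 0\<close> that finJ by (auto simp: P_def)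
    have "det (snd x) \<noteq> 0" using nz[of None] by (simp add: q_def)
    moreover have "indep_family I (\<lambda>e. rigidity_row G e x)" if "I \<in> \<I>" for I
      using nz[of "Some I"] that p(3) by (simp add: q_def)
    ultimately show ?thesis by (auto simp: generic_point_def \<I>_def)
  qed
  ultimately show thesis using that by blast
qed

theorem theorem1:
  fixes G :: "('v::finite, 'e) colored_graph"
  shows "\<exists>X :: 'v coords set. algebraic_set X \<and> X \<noteq> UNIV \<and>
    (\<forall>(V :: 'a set) E \<phi> rep.
       periodic_graph V E \<phi> \<and> quotient_colored_graph V E \<phi> rep G \<longrightarrow>
       (\<forall>x. x \<notin> X \<longrightarrow>
          periodic_framework V E \<phi> (induced_length \<phi> rep x) \<and>
          (minimally_rigid V E \<phi> (induced_length \<phi> rep x) rep x \<longleftrightarrow> colored_laman G)))"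
proof (cases "finite (edges G)")
  case False
  \<comment> \<open>A graph with infinitely many edges is the quotient of no periodic graph, so the
    empty set will do.\<close>
  have "algebraic_set ({} :: 'v coords set)"
    unfolding algebraic_set_def by (intro exI[of _ "{\<lambda>_. 1}"]) auto
  then show ?thesis
    using False periodic_quotient.finite_edges periodic_quotient.intro
    by (intro exI[of _ "{}"]) blast
next
  case fin: True
  obtain P :: "'v coords \<Rightarrow> real" where P: "real_polynomial_function P" "\<exists>x. P x \<noteq> 0"
    and gen: "\<And>x. P x \<noteq> 0 \<Longrightarrow> generic_point G x"
    using exists_generic_polynomial[OF fin] by blast
  let ?X = "{x. P x = 0}"
  have "algebraic_set ?X"
    unfolding algebraic_set_def using P(1) by (intro exI[of _ "{P}"]) auto
  moreover have "?X \<noteq> UNIV" using P(2) by auto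
  moreover have "periodic_framework V E \<phi> (induced_length \<phi> rep x) \<and>
      (minimally_rigid V E \<phi> (induced_length \<phi> rep x) rep x \<longleftrightarrow> colored_laman G)"
    if hyps: "periodic_graph V E \<phi>" "quotient_colored_graph V E \<phi> rep G" and x: "P x \<noteq> 0"
    for V :: "'a set" and E \<phi> rep x
  proof
    interpret periodic_quotient V E \<phi> rep G using hyps by (rule periodic_quotient.intro)
    let ?r = "\<lambda>e. rigidity_row G e x"
    have open_P: "open {y. P y \<noteq> 0}"
      using continuous_real_polymonial_function[OF P(1)]
      by (intro open_Collect_neq continuous_at_imp_continuous_on) auto
    have rigid_iff: "locally_rigid G F x \<longleftrightarrow> (\<exists>I\<subseteq>F. indep_family I ?r \<and> card I = 2 * CARD('v) + 1)"
      if "F \<subseteq> edges G" for F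
      using locally_rigid_iff[OF fin that gen[OF x] open_P] x gen by simp
    show "periodic_framework V E \<phi> (induced_length \<phi> rep x)"
    proof (rule periodic_framework_induced)
      fix e assume e: "e \<in> edges G"
      obtain y where y: "displacement G e y \<noteq> 0" using exists_nonzero_displacement[OF e] by blast
      \<comment> \<open>A single row that is nonzero somewhere is nonzero at the generic point
        \<open>x\<close>, so \<open>e\<close> receives a positive length.\<close>
      have "rigidity_row G e y \<bullet> y \<noteq> 0" using y by (simp add: inner_rigidity_row)
      then have "indep_family (insert e {}) (\<lambda>e. rigidity_row G e y)" by (intro indep_family_insert) auto
      then have "indep_family {e} ?r" using gen[OF x] e unfolding generic_point_def by blast
      then have "?r e \<noteq> 0" using indep_family_not_in_span[of e "{}" ?r] by auto
      then show "displacement G e x \<noteq> 0"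
        by (auto simp: rigidity_row_def linear_0[OF linear_edge_tensor])
    qed
    show "minimally_rigid V E \<phi> (induced_length \<phi> rep x) rep x \<longleftrightarrow> colored_laman G"
      unfolding minimally_rigid_iff colored_laman_iff[OF fin gen[OF x]]
    proof
      assume min: "locally_rigid G (edges G) x \<and> (\<forall>f\<in>edges G. \<not> locally_rigid G (edges G - {f}) x)"
      then obtain I where I: "I \<subseteq> edges G" "indep_family I ?r" "card I = 2 * CARD('v) + 1"
        using rigid_iff[of "edges G"] by blast
      \<comment> \<open>If \<open>f\<close> were outside \<open>I\<close>, it could be removed and
        \<open>I\<close> would still certify rigidity.\<close>
      have "f \<in> I" if "f \<in> edges G" for f
      proof (rule ccontr)
        assume "f \<notin> I"
        then have "locally_rigid G (edges G - {f}) x" using rigid_iff[of "edges G - {f}"] I by blast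
        then show False using min that by blast
      qed
      then have "I = edges G" using I(1) by blast
      then show "indep_family (edges G) ?r \<and> card (edges G) = 2 * CARD('v) + 1" using I by blast
    next
      assume full: "indep_family (edges G) ?r \<and> card (edges G) = 2 * CARD('v) + 1"
      have "\<not> locally_rigid G (edges G - {f}) x" if f: "f \<in> edges G" for f
      proof
        assume "locally_rigid G (edges G - {f}) x"
        then obtain I where "I \<subseteq> edges G - {f}" "card I = card (edges G)"
          using rigid_iff[of "edges G - {f}"] full by auto
        then show False
          using card_mono[of "edges G - {f}" I] card_Diff1_less[OF fin f] fin by simp
      qed
      then show "locally_rigid G (edges G) x \<and> (\<forall>f\<in>edges G. \<not> locally_rigid G (edges G - {f}) x)"
        using rigid_iff[of "edges G"] full by blast
    qed
  qed
  ultimately show ?thesis by (intro exI[of _ ?X]) blast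
qed

end
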